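(* Let $(X,\mathfrak A,\mu)$ be a $\sigma$-finite measure space and let $q$ be an irreducible closed quadratic form on $L^2(X,\mu)$ satisfying the first Beurling-Deny criterion. Then precisely one of the following assertions holds. (i) $q$ is subcritical. (ii) $\ker q_e=\mathbb R h$ for some strictly positive $h\in L^0(X,\mu)$. (iii) $\ker q^+=\{0,\infty\}$ (where $0$ and $\infty$ denote the constant functions). Moreover, (iii) holds if and only if $q$ does not possess a nontrivial nonnegative excessive function.
   Context: $L^0(X,\mu)$ is the space of a.e.-classes of measurable real-valued functions and $L^+(X,\mu)$ is the cone of a.e.-classes of measurable functions $X\to[0,\infty]$, both with the topology of local convergence in measure: a sequence converges to $f$ iff each of its subsequences has a further subsequence converging to $f$ $\mu$-a.e. Strictly positive means $>0$ a.e. A quadratic form $q\colon L^2(X,\mu)\to[0,\infty]$ satisfies $q(\lambda f)=\lambda^2q(f)$ ($0\cdot\infty=0$) and the parallelogram identity; $D(q)=\{q<\infty\}$, $\ker q=\{q=0\}$ (likewise for forms on $L^0(X,\mu)$). $q$ is closed if $D(q)$ is complete with respect to $q(f-g)^{1/2}+\|f-g\|_2$ (equivalently, $q$ is lower semicontinuous). Standing assumption: $D(q)$ is dense. First Beurling-Deny criterion: $q(|f|)\le q(f)$ for all $f$. A nonnegative $h\in L^0(X,\mu)$ is excessive ($q$-excessive) if $q(f\wedge h)\le q(f)$ for all $f\in L^2(X,\mu)$. A measurable $A\subseteq X$ is $q$-invariant if $q(1_Af)\le q(f)$ for all $f\in L^2(X,\mu)$; $q$ is irreducible if each $q$-invariant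 $A$ satisfies $\mu(A)=0$ or $\mu(X\setminus A)=0$. The extended form $q_e\colon L^0(X,\mu)\to[0,\infty]$ is given by $q_e(f)=\lim_n q(f_n)$ if there is a $q$-Cauchy sequence $(f_n)$ in $D(q)$ with $f_n\to f$ in $L^0(X,\mu)$, and $q_e(f)=\infty$ otherwise (well defined, and a lower semicontinuous quadratic form on $L^0(X,\mu)$). The functional $q^+\colon L^+(X,\mu)\to[0,\infty]$, a lower semicontinuous extension of the restriction of $q_e$ to $D(q_e)\cap L^+(X,\mu)$, is defined by: $q^+(f)=\lim_n q_e(f_n)$ if there exists a $q_e$-Cauchy sequence $(f_n)$ in $D(q_e)\cap L^+(X,\mu)$ with $f_n\to f$ in $L^+(X,\mu)$, and $q^+(f)=\infty$ otherwise; $\ker q^+=\{f\in L^+(X,\mu)\mid q^+(f)=0\}$. $q$ is subcritical if there is a strictly positive $w\in L^0(X,\mu)$ with $\int_X|f|^2w\,d\mu\le q(f)$ for all $f\in D(q)$. *)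

theory Defs
  imports "HOL-Analysis.Analysis"
begin

text \<open>
  Classes modulo a.e. equality are represented by measurable functions: functionals act on
  functions and are required (or, when defined below, turn out) to depend on them only up to null
  sets, and subsets of the function spaces are given by the corresponding a.e.-saturated sets of
  functions.
\<close>

abbreviation L0_functions :: "'a measure \<Rightarrow> ('a \<Rightarrow> real) set" where
  "L0_functions M \<equiv> borel_measurable M"

abbreviation Lplus_functions :: "'a measure \<Rightarrow> ('a \<Rightarrow> ennreal) set" where
  "Lplus_functions M \<equiv> borel_measurable M"

definition L2_functions :: "'a measure \<Rightarrow> ('a \<Rightarrow> real) set" where
  "L2_functions M = {f \<in> borel_measurable M. integrable M (\<lambda>x. (f x)\<^sup>2)}"

definition L2_norm :: "'a measure \<Rightarrow> ('a \<Rightarrow> real) \<Rightarrow> real" where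
  "L2_norm M f = sqrt (\<integral>x. (f x)\<^sup>2 \<partial>M)"

definition strictly_positive :: "'a measure \<Rightarrow> ('a \<Rightarrow> real) \<Rightarrow> bool" where
  "strictly_positive M f \<longleftrightarrow> (AE x in M. f x > 0)"

definition tendsto_locally_in_measure ::
    "'a measure \<Rightarrow> (nat \<Rightarrow> 'a \<Rightarrow> 'b::topological_space) \<Rightarrow> ('a \<Rightarrow> 'b) \<Rightarrow> bool" where
  "tendsto_locally_in_measure M u f \<longleftrightarrow>
     (\<forall>r::nat \<Rightarrow> nat. strict_mono r \<longrightarrow>
       (\<exists>s::nat \<Rightarrow> nat. strict_mono s \<and> (AE x in M. (\<lambda>n. u (r (s n)) x) \<longlonglongrightarrow> f x)))"

definition quadratic_form_L2 :: "'a measure \<Rightarrow> (('a \<Rightarrow> real) \<Rightarrow> ennreal) \<Rightarrow> bool" where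
  "quadratic_form_L2 M q \<longleftrightarrow>
     (\<forall>f \<in> L2_functions M. \<forall>g \<in> L2_functions M. (AE x in M. f x = g x) \<longrightarrow> q f = q g) \<and>
     (\<forall>f \<in> L2_functions M. \<forall>c::real. q (\<lambda>x. c * f x) = ennreal (c\<^sup>2) * q f) \<and>
     (\<forall>f \<in> L2_functions M. \<forall>g \<in> L2_functions M.
        q (\<lambda>x. f x + g x) + q (\<lambda>x. f x - g x) = 2 * q f + 2 * q g)"

definition form_domain :: "'b set \<Rightarrow> ('b \<Rightarrow> ennreal) \<Rightarrow> 'b set" where
  "form_domain V q = {f \<in> V. q f < \<infinity>}"

definition form_kernel :: "'b set \<Rightarrow> ('b \<Rightarrow> ennreal) \<Rightarrow> 'b set" where
  "form_kernel V q = {f \<in> V. q f = 0}"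

definition densely_defined :: "'a measure \<Rightarrow> (('a \<Rightarrow> real) \<Rightarrow> ennreal) \<Rightarrow> bool" where
  "densely_defined M q \<longleftrightarrow>
     (\<forall>f \<in> L2_functions M. \<forall>e>0. \<exists>g \<in> form_domain (L2_functions M) q.
        L2_norm M (\<lambda>x. f x - g x) < e)"

text \<open>
  Only used for functions in the domain, where \<open>q\<close> is finite and \<open>enn2real\<close> loses nothing.
\<close>

definition form_norm :: "'a measure \<Rightarrow> (('a \<Rightarrow> real) \<Rightarrow> ennreal) \<Rightarrow> ('a \<Rightarrow> real) \<Rightarrow> real" where
  "form_norm M q f = sqrt (enn2real (q f)) + L2_norm M f"

definition closed_form :: "'a measure \<Rightarrow> (('a \<Rightarrow> real) \<Rightarrow> ennreal) \<Rightarrow> bool" where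
  "closed_form M q \<longleftrightarrow>
     (\<forall>u. (\<forall>n. u n \<in> form_domain (L2_functions M) q) \<and>
        (\<forall>e>0. \<exists>N::nat. \<forall>m\<ge>N. \<forall>n\<ge>N. form_norm M q (\<lambda>x. u m x - u n x) < e) \<longrightarrow>
        (\<exists>f \<in> form_domain (L2_functions M) q. (\<lambda>n. form_norm M q (\<lambda>x. u n x - f x)) \<longlonglongrightarrow> 0))"

definition first_Beurling_Deny :: "'a measure \<Rightarrow> (('a \<Rightarrow> real) \<Rightarrow> ennreal) \<Rightarrow> bool" where
  "first_Beurling_Deny M q \<longleftrightarrow> (\<forall>f \<in> L2_functions M. q (\<lambda>x. \<bar>f x\<bar>) \<le> q f)"

definition excessive :: "'a measure \<Rightarrow> (('a \<Rightarrow> real) \<Rightarrow> ennreal) \<Rightarrow> ('a \<Rightarrow> real) \<Rightarrow> bool" where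
  "excessive M q h \<longleftrightarrow>
     h \<in> L0_functions M \<and> (AE x in M. h x \<ge> 0) \<and>
     (\<forall>f \<in> L2_functions M. q (\<lambda>x. min (f x) (h x)) \<le> q f)"

definition form_invariant :: "'a measure \<Rightarrow> (('a \<Rightarrow> real) \<Rightarrow> ennreal) \<Rightarrow> 'a set \<Rightarrow> bool" where
  "form_invariant M q A \<longleftrightarrow>
     A \<in> sets M \<and> (\<forall>f \<in> L2_functions M. q (\<lambda>x. indicator A x * f x) \<le> q f)"

definition irreducible_form :: "'a measure \<Rightarrow> (('a \<Rightarrow> real) \<Rightarrow> ennreal) \<Rightarrow> bool" where
  "irreducible_form M q \<longleftrightarrow>
     (\<forall>A. form_invariant M q A \<longrightarrow> emeasure M A = 0 \<or> emeasure M (space M - A) = 0)"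

definition form_Cauchy :: "(('a \<Rightarrow> real) \<Rightarrow> ennreal) \<Rightarrow> (nat \<Rightarrow> 'a \<Rightarrow> real) \<Rightarrow> bool" where
  "form_Cauchy q u \<longleftrightarrow> (\<forall>e>0. \<exists>N. \<forall>m\<ge>N. \<forall>n\<ge>N. q (\<lambda>x. u m x - u n x) < e)"

definition approximates_L0 ::
    "'a measure \<Rightarrow> (('a \<Rightarrow> real) \<Rightarrow> ennreal) \<Rightarrow> (nat \<Rightarrow> 'a \<Rightarrow> real) \<Rightarrow> ('a \<Rightarrow> real) \<Rightarrow> bool" where
  "approximates_L0 M q u f \<longleftrightarrow>
     (\<forall>n. u n \<in> form_domain (L2_functions M) q) \<and> form_Cauchy q u \<and>
     tendsto_locally_in_measure M u f"

text \<open>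
  The definite description relies on the limit being independent of the approximating sequence,
  which holds for closed forms satisfying the first Beurling-Deny criterion.
\<close>

definition extended_form ::
    "'a measure \<Rightarrow> (('a \<Rightarrow> real) \<Rightarrow> ennreal) \<Rightarrow> ('a \<Rightarrow> real) \<Rightarrow> ennreal" where
  "extended_form M q f =
     (if \<exists>u. approximates_L0 M q u f
      then THE l. \<exists>u. approximates_L0 M q u f \<and> (\<lambda>n. q (u n)) \<longlonglongrightarrow> l
      else \<infinity>)"

definition approximates_Lplus ::
    "'a measure \<Rightarrow> (('a \<Rightarrow> real) \<Rightarrow> ennreal) \<Rightarrow> (nat \<Rightarrow> 'a \<Rightarrow> real) \<Rightarrow> ('a \<Rightarrow> ennreal) \<Rightarrow> bool" where
  "approximates_Lplus M q u f \<longleftrightarrow>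
     (\<forall>n. u n \<in> form_domain (L0_functions M) (extended_form M q) \<and> (AE x in M. u n x \<ge> 0)) \<and>
     form_Cauchy (extended_form M q) u \<and>
     tendsto_locally_in_measure M (\<lambda>n x. ennreal (u n x)) f"

text \<open>
  For \<open>f\<close> taking the value \<open>\<infinity>\<close>, the limit of \<open>q\<^sub>e (u n)\<close> does depend on the approximating sequence
  \<open>u\<close>: if \<open>u\<close> tends to \<open>\<infinity>\<close> with \<open>q\<^sub>e (u n)\<close> tending to \<open>0\<close>, then adding a fixed nonnegative function
  \<open>g\<close> of finite energy gives another such sequence, along which the limit is \<open>q\<^sub>e g\<close>. Lower
  semicontinuity of \<open>q\<^sup>+\<close> forces the smallest of the possible limits, hence the infimum below. For real-valued
  \<open>f\<close> the limit is unique and the infimum is over a singleton.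
\<close>

definition plus_form ::
    "'a measure \<Rightarrow> (('a \<Rightarrow> real) \<Rightarrow> ennreal) \<Rightarrow> ('a \<Rightarrow> ennreal) \<Rightarrow> ennreal" where
  "plus_form M q f =
     (if \<exists>u. approximates_Lplus M q u f
      then Inf {l. \<exists>u. approximates_Lplus M q u f \<and> (\<lambda>n. extended_form M q (u n)) \<longlonglongrightarrow> l}
      else \<infinity>)"

definition subcritical :: "'a measure \<Rightarrow> (('a \<Rightarrow> real) \<Rightarrow> ennreal) \<Rightarrow> bool" where
  "subcritical M q \<longleftrightarrow>
     (\<exists>w \<in> L0_functions M. strictly_positive M w \<and>
        (\<forall>f \<in> form_domain (L2_functions M) q. (\<integral>\<^sup>+x. ennreal (\<bar>f x\<bar>\<^sup>2 * w x) \<partial>M) \<le> q f))"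

definition kernel_spanned_by_positive :: "'a measure \<Rightarrow> (('a \<Rightarrow> real) \<Rightarrow> ennreal) \<Rightarrow> bool" where
  "kernel_spanned_by_positive M q \<longleftrightarrow>
     (\<exists>h \<in> L0_functions M. strictly_positive M h \<and>
        form_kernel (L0_functions M) (extended_form M q) =
          {f \<in> L0_functions M. \<exists>c::real. AE x in M. f x = c * h x})"

definition plus_kernel_zero_infinity :: "'a measure \<Rightarrow> (('a \<Rightarrow> real) \<Rightarrow> ennreal) \<Rightarrow> bool" where
  "plus_kernel_zero_infinity M q \<longleftrightarrow>
     form_kernel (Lplus_functions M) (plus_form M q) =
       {f \<in> Lplus_functions M. (AE x in M. f x = 0) \<or> (AE x in M. f x = \<infinity>)}"

end

theory Submission
  imports Defs "HOL-Library.Function_Algebras"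
begin

text \<open>
  A diagonal argument identifies \<open>ker q\<^sup>+\<close> with the null limits: the a.e. limits in \<open>[0, \<infinity>]\<close> of sequences
  \<open>f\<^sub>n \<ge> 0\<close> in \<open>D(q)\<close> with \<open>q(f\<^sub>n) \<longlonglongrightarrow> 0\<close>. Every null limit \<open>f\<close> satisfies \<open>q(g \<and> f) \<le> q(g)\<close>, so
  \<open>{f > 0}\<close> and \<open>{f = \<infinity>}\<close> are invariant. By irreducibility a nonzero null limit is a.e. strictly positive
  and is either a.e. finite or a.e. infinite, and if there is one, then \<open>\<infinity>\<close> is one. A finite one spans \<open>ker q\<^sub>e\<close>.

  If \<open>\<infinity>\<close> is not a null limit, then the infimum of \<open>q\<close> on \<open>{v. \<rho> \<le> v}\<close> is positive for each strictly positive
  \<open>\<rho> \<in> D(q)\<close>, and a minimizing sequence yields a nonzero positive functional bounded with respect to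
  \<open>q\<^sup>1\<^sup>/\<^sup>2\<close>. Solving \<open>(L + 1) \<phi> = l\<close>, with \<open>l\<close> this functional and \<open>L\<close> the generator of \<open>q\<close>, turns it into
  a strictly positive function \<open>\<phi>\<close> with \<open>\<bar>\<langle>\<phi>, f\<rangle>\<bar> \<le> C q(f)\<^sup>1\<^sup>/\<^sup>2\<close>. The solutions \<open>u\<^sub>\<alpha>\<close> of \<open>(L + \<alpha>) u = \<phi>\<close> then
  increase to an a.e. finite function \<open>h\<close> as \<open>\<alpha> \<rightarrow> 0\<close>, which is excessive and has the Hardy weight \<open>\<phi> / (8 h)\<close>.
\<close>

section \<open>Semi-inner products\<close>

text \<open>Two questions decide the trichotomy: whether \<infinity> is a null limit, and whether
  there is a nonzero real-valued one, which implies the former. (i) is "no" to the former, (ii) is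
  "yes" to the latter, (iii) is what remains. An excessive \<open>h\<close> separates (ii) from
  (iii): if functions \<open>u n\<close> of vanishing energy tend to \<infinity>, their minima with
  \<open>h\<close> have vanishing energy too and tend to \<open>h\<close>, so \<open>h\<close> is
  itself a null limit. The recurring obstacle is that a.e. convergence comes without convergence in
  L2. Limits are therefore taken after cutting off at a fixed function of the domain: the minima are
  dominated, so lower semicontinuity applies. The domain need not be complete for the square root of
  \<open>q\<close>, so minimization leaves only a functional \<open>l\<close>, whereas a Hardy
  weight needs a density. The solution \<phi> is one: its inner product with \<open>f\<close> is
  \<open>l f\<close> minus the form of \<phi> and \<open>f\<close>, and both terms are bounded by
  the square root of \<open>q f\<close>. Testing the equation for u with u itself bounds the
  integral of \<phi> u uniformly in \<alpha>, which is what keeps the limit \<open>h\<close>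
  finite.\<close>

instantiation "fun" :: (type, real_vector) real_vector
begin

definition "scaleR c f = (\<lambda>x. c *\<^sub>R f x)"

instance
  by standard (simp_all add: scaleR_fun_def fun_eq_iff scaleR_right_distrib scaleR_left_distrib)

end

lemma scaleR_fun_apply [simp]: "(c *\<^sub>R f) x = c *\<^sub>R f x"
  by (simp add: scaleR_fun_def)

text \<open>Subtracting the linear part leaves an additive function that vanishes at 1, hence on the
  integers. It is thus 1-periodic and bounded, and a bounded additive function is zero.\<close>

lemma bounded_additive_eq_scale:
  fixes c :: "real \<Rightarrow> real"
  assumes add: "\<And>s t. c (s + t) = c s + c t"
    and bdd: "\<And>t. \<bar>t\<bar> \<le> 1 \<Longrightarrow> \<bar>c t\<bar> \<le> K"
  shows "c t = t * c 1"
proof -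
  define d where "d = (\<lambda>t. c t - t * c 1)"
  have d_add: "d (s + t) = d s + d t" for s t
    by (simp add: d_def add algebra_simps)
  have d1: "d 1 = 0" by (simp add: d_def)
  have d0: "d 0 = 0" using d_add[of 0 0] by simp
  have d_neg: "d (- t) = - d t" for t using d_add[of t "-t"] d0 by simp
  have d_nat: "d (real n * t) = real n * d t" for n t
    by (induction n) (simp_all add: d0 d_add distrib_right)
  have d_of_nat: "d (real n) = 0" for n using d_nat[of n 1] d1 by simp
  have d_int: "d (of_int k) = 0" for k :: int
    by (cases k rule: int_cases2) (simp_all add: d_of_nat d_neg)
  have d_frac: "d t = d (frac t)" for t
    using d_add[of "of_int \<lfloor>t\<rfloor>" "frac t"] by (simp add: d_int frac_def)
  have d_bdd: "\<bar>d t\<bar> \<le> K + \<bar>c 1\<bar>" for t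
  proof -
    have f: "0 \<le> frac t" "frac t < 1" by (simp_all add: frac_lt_1)
    have "\<bar>c (frac t)\<bar> \<le> K" using f by (intro bdd) simp
    moreover have "\<bar>frac t * c 1\<bar> \<le> 1 * \<bar>c 1\<bar>"
      unfolding abs_mult using f by (intro mult_right_mono) auto
    ultimately show ?thesis unfolding d_frac[of t] by (simp add: d_def)
  qed
  have "d t = 0"
  proof (rule ccontr)
    assume "d t \<noteq> 0"
    then obtain n where "real n * \<bar>d t\<bar> > K + \<bar>c 1\<bar>"
      using reals_Archimedean3[of "\<bar>d t\<bar>"] by auto
    then show False using d_bdd[of "real n * t"] by (simp add: d_nat abs_mult)
  qed
  then show ?thesis by (simp add: d_def)
qed

text \<open>Stands in for dividing by \<open>t\<close> and letting \<open>t\<close> tend to 0. Every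
  first-variation argument below ends with it.\<close>

lemma quadratic_nonneg_imp_nonneg:
  fixes a b :: real
  assumes "b \<ge> 0" "\<And>t. 0 < t \<Longrightarrow> 0 \<le> 2 * t * a + t\<^sup>2 * b"
  shows "0 \<le> a"
proof (rule ccontr)
  assume a: "\<not> 0 \<le> a"
  define t where "t = - a / (b + 1)"
  have t: "t > 0" "a = - t * (b + 1)" using a assms(1) by (simp_all add: t_def field_simps)
  have "2 * t * a + t\<^sup>2 * b = - (t\<^sup>2 * (b + 2))"
    by (subst t(2)) (simp add: power2_eq_square algebra_simps)
  moreover have "t\<^sup>2 * (b + 2) > 0" using t(1) assms(1) by simp
  ultimately show False using assms(2)[OF t(1)] by simp
qed

lemma inverse_Suc_tendsto_0: "(\<lambda>n. 1 / real (Suc n)) \<longlonglongrightarrow> 0"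
  using LIMSEQ_inverse_real_of_nat by (simp add: inverse_eq_divide)

text \<open>Semidefinite on purpose: functions vanishing a.e. and elements of the kernel of
  \<open>q\<close> have zero energy. The carrier is a set because form domains are not types; the
  ambient \<open>real_vector\<close> type supplies \<open>subspace\<close> and
  \<open>convex hull\<close>. The instances are the L2 inner product, the polarized form, the form
  shifted by a multiple of the L2 inner product, and a product of two copies of the form.\<close>

locale semi_inner =
  fixes D :: "'v::real_vector set" and B :: "'v \<Rightarrow> 'v \<Rightarrow> real"
  assumes subspace: "subspace D"
    and sym: "a \<in> D \<Longrightarrow> b \<in> D \<Longrightarrow> B a b = B b a"
    and add_left: "a \<in> D \<Longrightarrow> b \<in> D \<Longrightarrow> c \<in> D \<Longrightarrow> B (a + b) c = B a c + B b c"
    and scale_left: "a \<in> D \<Longrightarrow> b \<in> D \<Longrightarrow> B (r *\<^sub>R a) b = r * B a b"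
    and nonneg: "a \<in> D \<Longrightarrow> 0 \<le> B a a"
begin

lemma D_add [simp]: "a \<in> D \<Longrightarrow> b \<in> D \<Longrightarrow> a + b \<in> D"
  and D_scale [simp]: "a \<in> D \<Longrightarrow> r *\<^sub>R a \<in> D"
  and D_diff [simp]: "a \<in> D \<Longrightarrow> b \<in> D \<Longrightarrow> a - b \<in> D"
  and D_zero [simp]: "0 \<in> D"
  and D_minus [simp]: "a \<in> D \<Longrightarrow> - a \<in> D"
  using subspace by (auto intro: subspace_add subspace_scale subspace_diff subspace_0 subspace_neg)

lemma add_right: "a \<in> D \<Longrightarrow> b \<in> D \<Longrightarrow> c \<in> D \<Longrightarrow> B c (a + b) = B c a + B c b"
  using add_left[of a b c] by (simp add: sym)

lemma scale_right: "a \<in> D \<Longrightarrow> b \<in> D \<Longrightarrow> B b (r *\<^sub>R a) = r * B b a"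
  using scale_left[of a b r] by (simp add: sym)

lemma minus_left: "a \<in> D \<Longrightarrow> b \<in> D \<Longrightarrow> B (- a) b = - B a b"
  using scale_left[of a b "-1"] by simp

lemma minus_right: "a \<in> D \<Longrightarrow> b \<in> D \<Longrightarrow> B b (- a) = - B b a"
  using scale_right[of a b "-1"] by simp

lemma diff_left: "a \<in> D \<Longrightarrow> b \<in> D \<Longrightarrow> c \<in> D \<Longrightarrow> B (a - b) c = B a c - B b c"
  using add_left[of a "-b" c] by (simp add: minus_left)

lemma diff_right: "a \<in> D \<Longrightarrow> b \<in> D \<Longrightarrow> c \<in> D \<Longrightarrow> B c (a - b) = B c a - B c b"
  using add_right[of a "-b" c] by (simp add: minus_right)

lemma zero_left [simp]: "a \<in> D \<Longrightarrow> B 0 a = 0"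
  using scale_left[of a a 0] by simp

lemma zero_right [simp]: "a \<in> D \<Longrightarrow> B a 0 = 0"
  using scale_right[of a a 0] by simp

lemmas bilinear = add_left add_right diff_left diff_right scale_left scale_right minus_left minus_right

lemma energy_add: "a \<in> D \<Longrightarrow> b \<in> D \<Longrightarrow> B (a + b) (a + b) = B a a + 2 * B a b + B b b"
  by (simp add: bilinear sym[of b a])

lemma energy_diff: "a \<in> D \<Longrightarrow> b \<in> D \<Longrightarrow> B (a - b) (a - b) = B a a - 2 * B a b + B b b"
  by (simp add: bilinear sym[of b a])

lemma energy_scale: "a \<in> D \<Longrightarrow> B (r *\<^sub>R a) (r *\<^sub>R a) = r\<^sup>2 * B a a"
  by (simp add: bilinear power2_eq_square)

lemma energy_commute: "a \<in> D \<Longrightarrow> b \<in> D \<Longrightarrow> B (a - b) (a - b) = B (b - a) (b - a)"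
  by (simp add: energy_diff sym)

definition seminorm :: "'v \<Rightarrow> real" where
  "seminorm a = sqrt (B a a)"

lemma seminorm_nonneg: "a \<in> D \<Longrightarrow> 0 \<le> seminorm a"
  by (simp add: seminorm_def nonneg)

lemma seminorm_sq: "a \<in> D \<Longrightarrow> (seminorm a)\<^sup>2 = B a a"
  by (simp add: seminorm_def nonneg)

lemma Cauchy_Schwarz:
  assumes "a \<in> D" "b \<in> D"
  shows "\<bar>B a b\<bar> \<le> seminorm a * seminorm b"
proof -
  have quad: "0 \<le> B a a + 2 * t * B a b + t\<^sup>2 * B b b" for t
    using nonneg[of "a + t *\<^sub>R b"] assms by (simp add: energy_add scale_left scale_right power2_eq_square mult.assoc)
  have sq: "(B a b)\<^sup>2 \<le> B a a * B b b"
  proof (cases "B b b = 0")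
    case True
    have "B a b = 0"
    proof (rule ccontr)
      assume ne: "B a b \<noteq> 0"
      have "0 \<le> B a a + 2 * (- (B a a + 1) / B a b) * B a b"
        using quad[of "- (B a a + 1) / B a b"] True by simp
      also have "\<dots> = - B a a - 2" using ne by simp
      finally show False using nonneg[OF assms(1)] by simp
    qed
    then show ?thesis using True by simp
  next
    case False
    then have pos: "B b b > 0" using nonneg[OF assms(2)] by simp
    have "0 \<le> B a a + 2 * (- B a b / B b b) * B a b + (- B a b / B b b)\<^sup>2 * B b b" by (rule quad)
    also have "\<dots> = B a a - (B a b)\<^sup>2 / B b b" using pos by (simp add: field_simps power2_eq_square)
    finally show ?thesis using pos by (simp add: field_simps)
  qed
  have "\<bar>B a b\<bar> = sqrt ((B a b)\<^sup>2)" by simp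
  also have "\<dots> \<le> sqrt (B a a * B b b)" using sq by (rule real_sqrt_le_mono)
  finally show ?thesis by (simp add: seminorm_def real_sqrt_mult)
qed

lemma seminorm_add:
  assumes "a \<in> D" "b \<in> D"
  shows "seminorm (a + b) \<le> seminorm a + seminorm b"
proof -
  have "(seminorm (a + b))\<^sup>2 \<le> (seminorm a + seminorm b)\<^sup>2"
    using assms Cauchy_Schwarz[OF assms]
    by (simp add: seminorm_sq energy_add power2_sum)
  then show ?thesis using assms by (simp add: abs_le_square_iff[symmetric] seminorm_nonneg)
qed

lemma seminorm_scale: "a \<in> D \<Longrightarrow> seminorm (r *\<^sub>R a) = \<bar>r\<bar> * seminorm a"
  by (simp add: seminorm_def energy_scale real_sqrt_mult)

lemma seminorm_minus: "a \<in> D \<Longrightarrow> seminorm (- a) = seminorm a"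
  using seminorm_scale[of a "-1"] by simp

lemma seminorm_diff:
  assumes "a \<in> D" "b \<in> D"
  shows "seminorm (a - b) \<le> seminorm a + seminorm b"
  using seminorm_add[of a "-b"] assms by (simp add: seminorm_minus)

lemma seminorm_commute: "a \<in> D \<Longrightarrow> b \<in> D \<Longrightarrow> seminorm (a - b) = seminorm (b - a)"
  by (simp add: seminorm_def energy_commute)

lemma seminorm_triangle: "a \<in> D \<Longrightarrow> b \<in> D \<Longrightarrow> c \<in> D \<Longrightarrow> seminorm (a - c) \<le> seminorm (a - b) + seminorm (b - c)"
  using seminorm_add[of "a - b" "b - c"] by simp

lemma seminorm_abs_diff:
  assumes "a \<in> D" "b \<in> D"
  shows "\<bar>seminorm a - seminorm b\<bar> \<le> seminorm (a - b)"
  using seminorm_add[of b "a - b"] seminorm_add[of a "b - a"] assms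
  by (simp add: seminorm_commute[of a b])

lemma seminorm_le_iff: "a \<in> D \<Longrightarrow> 0 \<le> r \<Longrightarrow> seminorm a \<le> r \<longleftrightarrow> B a a \<le> r\<^sup>2"
  unfolding seminorm_def using real_sqrt_le_iff[of "B a a" "r\<^sup>2"] by simp

definition Cauchy_seq :: "(nat \<Rightarrow> 'v) \<Rightarrow> bool" where
  "Cauchy_seq u \<longleftrightarrow> (\<forall>e>0. \<exists>N. \<forall>m\<ge>N. \<forall>n\<ge>N. seminorm (u m - u n) < e)"

lemma Cauchy_seq_energy:
  assumes "Cauchy_seq u" "\<And>n. u n \<in> D"
  shows "Cauchy (\<lambda>n. seminorm (u n))"
proof (rule CauchyI)
  fix e :: real assume "e > 0"
  then obtain N where N: "\<forall>m\<ge>N. \<forall>n\<ge>N. seminorm (u m - u n) < e"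
    using assms(1) by (auto simp: Cauchy_seq_def)
  show "\<exists>M. \<forall>m\<ge>M. \<forall>n\<ge>M. norm (seminorm (u m) - seminorm (u n)) < e"
    using N le_less_trans[OF seminorm_abs_diff[OF assms(2) assms(2)]] by (intro exI[of _ N]) simp
qed

lemma Cauchy_seq_bounded:
  assumes "Cauchy_seq u" "\<And>n. u n \<in> D"
  obtains K where "\<And>n. seminorm (u n) \<le> K" "K \<ge> 0"
proof -
  have "Bseq (\<lambda>n. seminorm (u n))" using Cauchy_seq_energy[OF assms] by (rule Cauchy_Bseq)
  then obtain K where "K > 0" "\<And>n. norm (seminorm (u n)) \<le> K" by (auto simp: Bseq_def)
  then show ?thesis using that[of K] by (force simp: abs_le_iff)
qed

lemma Cauchy_seq_of_energy_bound:
  assumes v: "\<And>n. v n \<in> D" and bd: "\<And>m n. m \<le> n \<Longrightarrow> B (v m - v n) (v m - v n) \<le> r m"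
    and r: "r \<longlonglongrightarrow> 0"
  shows "Cauchy_seq v"
  unfolding Cauchy_seq_def
proof (intro allI impI)
  fix e :: real assume e: "e > 0"
  then obtain N where N: "\<And>m. m \<ge> N \<Longrightarrow> r m < e\<^sup>2"
    using order_tendstoD(2)[OF r, of "e\<^sup>2"] by (auto simp: eventually_sequentially)
  have small: "seminorm (v m - v n) < e" if "N \<le> m" "m \<le> n" for m n
  proof -
    have "sqrt (B (v m - v n) (v m - v n)) < sqrt (e\<^sup>2)"
      using bd[OF that(2)] N[OF that(1)] by (intro real_sqrt_less_mono) simp
    then show ?thesis using e by (simp add: seminorm_def)
  qed
  show "\<exists>N. \<forall>m\<ge>N. \<forall>n\<ge>N. seminorm (v m - v n) < e"
  proof (intro exI[of _ N] allI impI)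
    fix m n assume "N \<le> m" "N \<le> n"
    then show "seminorm (v m - v n) < e"
      using small[of m n] small[of n m] seminorm_commute[OF v v, of m n] by (cases "m \<le> n") auto
  qed
qed

lemma convex_seminorm_ball: "convex {v \<in> D. seminorm (v - a) \<le> r}" if "a \<in> D"
proof (rule convexI)
  fix x y and s t :: real
  assume x: "x \<in> {v \<in> D. seminorm (v - a) \<le> r}" and y: "y \<in> {v \<in> D. seminorm (v - a) \<le> r}"
    and st: "0 \<le> s" "0 \<le> t" "s + t = 1"
  have "s *\<^sub>R x + t *\<^sub>R y - a = s *\<^sub>R (x - a) + t *\<^sub>R (y - a)"
    using st by (simp add: algebra_simps flip: scaleR_left_distrib)
  then have "seminorm (s *\<^sub>R x + t *\<^sub>R y - a) \<le> s * seminorm (x - a) + t * seminorm (y - a)"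
    using x y st that seminorm_add[of "s *\<^sub>R (x - a)" "t *\<^sub>R (y - a)"] by (simp add: seminorm_scale)
  also have "\<dots> \<le> s * r + t * r" using x y st by (intro add_mono mult_left_mono) auto
  also have "\<dots> = r" using st by (simp flip: distrib_right)
  finally show "s *\<^sub>R x + t *\<^sub>R y \<in> {v \<in> D. seminorm (v - a) \<le> r}" using x y by simp
qed

text \<open>Seminorm balls are convex. In this way energy bounds and convergence, which hold
  uniformly on tails of a sequence, pass to convex combinations of these tails.\<close>

lemma hull_seminorm_ball:
  assumes "v \<in> convex hull S" "a \<in> D" "S \<subseteq> D" "\<And>s. s \<in> S \<Longrightarrow> seminorm (s - a) \<le> r"
  shows "v \<in> D" "seminorm (v - a) \<le> r"
proof -
  have "convex hull S \<subseteq> {v \<in> D. seminorm (v - a) \<le> r}"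
    using assms by (intro hull_minimal convex_seminorm_ball) auto
  then show "v \<in> D" "seminorm (v - a) \<le> r" using assms(1) by auto
qed

text \<open>Choose almost minimal elements of the convex hulls of the tails and use the parallelogram identity.\<close>

lemma Cauchy_convex_combinations:
  assumes u: "\<And>n. u n \<in> D" and bdd: "\<And>n. seminorm (u n) \<le> K"
  obtains v where "\<And>n. v n \<in> convex hull (u ` {n..})" "Cauchy_seq v"
proof -
  define H where "H n = convex hull (u ` {n::nat..})" for n
  have HD: "x \<in> D" "seminorm x \<le> K" if "x \<in> H n" for x n
    using hull_seminorm_ball[of x "u ` {n..}" 0 K] that u bdd by (auto simp: H_def)
  have H_mono: "H n \<subseteq> H m" if "m \<le> n" for m n
    unfolding H_def using that by (intro hull_mono image_mono) auto
  define I where "I n = Inf ((\<lambda>x. B x x) ` H n)" for n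
  have bb: "bdd_below ((\<lambda>x. B x x) ` H n)" for n
    using HD(1) nonneg by (intro bdd_belowI[of _ 0]) auto
  have ne: "H n \<noteq> {}" for n unfolding H_def by simp
  have I_le: "I n \<le> B x x" if "x \<in> H n" for n x
    unfolding I_def using bb that by (intro cInf_lower) auto
  have K: "0 \<le> K" using bdd[of 0] seminorm_nonneg[OF u[of 0]] by simp
  have IK: "I n \<le> K\<^sup>2" for n
    using ne[of n] I_le[of _ n] HD K by (force simp: seminorm_le_iff intro: order_trans)
  have I_mono: "incseq I"
    unfolding incseq_def I_def
    by (intro allI impI cInf_superset_mono image_mono H_mono) (simp_all add: ne bb)
  obtain L where L: "I \<longlonglongrightarrow> L" using incseq_convergent[OF I_mono] IK by blast
  have "\<exists>x\<in>H n. B x x < I n + 1 / real (Suc n)" for n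
  proof -
    have "Inf ((\<lambda>x. B x x) ` H n) < I n + 1 / real (Suc n)" unfolding I_def by simp
    then show ?thesis using cInf_lessD[of "(\<lambda>x. B x x) ` H n"] ne by blast
  qed
  then obtain v where v: "\<And>n. v n \<in> H n" "\<And>n. B (v n) (v n) < I n + 1 / real (Suc n)" by metis
  have vD: "v n \<in> D" for n using HD v by blast
  \<comment> \<open>The midpoint of \<open>v m\<close> and \<open>v n\<close> lies in the larger
    hull \<open>H m\<close>, so its energy is at least \<open>I m\<close>. As \<open>I\<close>
    increases to the finite limit \<open>L\<close>, the error tends to 0.\<close>
  have est: "B (v m - v n) (v m - v n) \<le> 2 * (L - I m) + 4 * (1 / real (Suc m))" if "m \<le> n" for m n
  proof -
    let ?w = "(1/2) *\<^sub>R v m + (1/2) *\<^sub>R v n"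
    have "?w \<in> H m"
      using v(1)[of m] v(1)[of n] H_mono[OF that] unfolding H_def
      by (intro convexD[OF convex_convex_hull]) auto
    then have "I m \<le> B ?w ?w" by (rule I_le)
    also have "\<dots> = (B (v m) (v m) + B (v n) (v n)) / 2 - B (v m - v n) (v m - v n) / 4"
      using vD by (simp add: energy_add energy_diff energy_scale bilinear sym[of "v n" "v m"] field_simps power2_eq_square)
    finally have "B (v m - v n) (v m - v n) \<le> 2 * (B (v m) (v m) + B (v n) (v n)) - 4 * I m" by (simp add: field_simps)
    also have "\<dots> \<le> 2 * (I m + 1 / real (Suc m) + (I n + 1 / real (Suc m))) - 4 * I m"
    proof -
      have "1 / real (Suc n) \<le> 1 / real (Suc m)" using that by (simp add: field_simps)
      then show ?thesis using v(2)[of m] v(2)[of n] by simp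
    qed
    finally show ?thesis using incseq_le[OF I_mono L, of n] by (simp add: algebra_simps)
  qed
  have "(\<lambda>m. 2 * (L - I m) + 4 * (1 / real (Suc m))) \<longlonglongrightarrow> 2 * (L - L) + 4 * 0"
    by (intro tendsto_intros L inverse_Suc_tendsto_0)
  then have "Cauchy_seq v" using Cauchy_seq_of_energy_bound[OF vD est] by simp
  then show ?thesis using that v(1) unfolding H_def by blast
qed

text \<open>Midpoints stay in \<open>C\<close>, so the parallelogram identity makes a minimizing
  sequence Cauchy. Completeness is not part of the setting, hence the conclusion offers a sequence
  and no minimizer. It serves twice: on the whole domain with a linear term, to solve equations, and
  on a convex set with \<open>l\<close> equal to 0.\<close>

lemma minimizing_sequence:
  assumes CD: "C \<subseteq> D" and ne: "C \<noteq> {}" and conv: "convex C"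
    and l_add: "\<And>a b. a \<in> D \<Longrightarrow> b \<in> D \<Longrightarrow> l (a + b) = l a + l b"
    and l_scale: "\<And>a r. a \<in> D \<Longrightarrow> l (r *\<^sub>R a) = r * l a"
    and bb: "\<And>a. a \<in> C \<Longrightarrow> K \<le> B a a - 2 * l a"
  obtains v I where "\<And>n. v n \<in> C" "Cauchy_seq v" "(\<lambda>n. B (v n) (v n) - 2 * l (v n)) \<longlonglongrightarrow> I"
    "\<And>a. a \<in> C \<Longrightarrow> I \<le> B a a - 2 * l a"
proof -
  define J where "J a = B a a - 2 * l a" for a
  define I where "I = Inf (J ` C)"
  have bb': "bdd_below (J ` C)" using bb by (intro bdd_belowI[of _ K]) (auto simp: J_def)
  have I_le: "I \<le> J x" if "x \<in> C" for x unfolding I_def using bb' that by (intro cInf_lower) auto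
  have "\<exists>x\<in>C. J x < I + 1 / real (Suc n)" for n
  proof -
    have "Inf (J ` C) < I + 1 / real (Suc n)" unfolding I_def by simp
    then show ?thesis using cInf_lessD[of "J ` C"] ne by blast
  qed
  then obtain v where v: "\<And>n. v n \<in> C" "\<And>n. J (v n) < I + 1 / real (Suc n)" by metis
  have vD: "v n \<in> D" for n using CD v by blast
  have est: "B (v m - v n) (v m - v n) \<le> 2 / real (Suc m) + 2 / real (Suc n)" for m n
  proof -
    let ?w = "(1/2) *\<^sub>R v m + (1/2) *\<^sub>R v n"
    have "?w \<in> C" using v(1) by (intro convexD[OF conv]) auto
    then have "I \<le> J ?w" by (rule I_le)
    also have "\<dots> = (J (v m) + J (v n)) / 2 - B (v m - v n) (v m - v n) / 4"
      using vD by (simp add: J_def l_add l_scale energy_add energy_diff energy_scale bilinear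
          sym[of "v n" "v m"] field_simps power2_eq_square)
    finally have "B (v m - v n) (v m - v n) \<le> 2 * (J (v m) + J (v n)) - 4 * I" by argo
    then show ?thesis using v(2)[of m] v(2)[of n] by simp
  qed
  have "Cauchy_seq v"
  proof (rule Cauchy_seq_of_energy_bound[OF vD])
    show "B (v m - v n) (v m - v n) \<le> 4 * (1 / real (Suc m))" if "m \<le> n" for m n
    proof -
      have "2 / real (Suc n) \<le> 2 / real (Suc m)" using that by (intro divide_left_mono) auto
      then show ?thesis using est[of m n] by simp
    qed
    show "(\<lambda>m. 4 * (1 / real (Suc m))) \<longlonglongrightarrow> 0"
      by (intro tendsto_mult_right_zero inverse_Suc_tendsto_0)
  qed
  moreover have "(\<lambda>n. J (v n)) \<longlonglongrightarrow> I"
  proof (rule tendsto_sandwich)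
    show "\<forall>\<^sub>F n in sequentially. I \<le> J (v n)" using I_le v(1) by simp
    show "\<forall>\<^sub>F n in sequentially. J (v n) \<le> I + 1 / real (Suc n)" using v(2) by (simp add: less_imp_le)
    show "(\<lambda>n. I + 1 / real (Suc n)) \<longlonglongrightarrow> I"
      using tendsto_add[OF tendsto_const inverse_Suc_tendsto_0, of I] by simp
  qed simp
  ultimately show ?thesis using that[of v I] v(1) I_le unfolding J_def by blast
qed

lemma tendsto_energy_zero_iff:
  assumes "\<And>n. u n \<in> D"
  shows "(\<lambda>n. seminorm (u n)) \<longlonglongrightarrow> 0 \<longleftrightarrow> (\<lambda>n. B (u n) (u n)) \<longlonglongrightarrow> 0"
proof
  assume "(\<lambda>n. seminorm (u n)) \<longlonglongrightarrow> 0"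
  then have "(\<lambda>n. (seminorm (u n))\<^sup>2) \<longlonglongrightarrow> 0\<^sup>2" by (intro tendsto_power)
  then show "(\<lambda>n. B (u n) (u n)) \<longlonglongrightarrow> 0" using assms by (simp add: seminorm_sq)
next
  assume "(\<lambda>n. B (u n) (u n)) \<longlonglongrightarrow> 0"
  then show "(\<lambda>n. seminorm (u n)) \<longlonglongrightarrow> 0"
    using tendsto_real_sqrt[of "\<lambda>n. B (u n) (u n)" 0] by (simp add: seminorm_def)
qed

lemma energy_null_mono:
  assumes "\<And>n. v n \<in> D" "\<And>n. B (v n) (v n) \<le> c n" "c \<longlonglongrightarrow> 0"
  shows "(\<lambda>n. B (v n) (v n)) \<longlonglongrightarrow> 0"
  by (rule Lim_null_comparison[OF always_eventually[OF allI] assms(3)])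
    (use assms(1,2) nonneg in simp)

end

text \<open>Jordan--von Neumann: homogeneity of the form replaces the continuity needed for the
  real linearity of the polarization.\<close>

lemma semi_inner_of_parallelogram:
  fixes E :: "'v::real_vector \<Rightarrow> real"
  assumes D: "subspace D"
    and E_nonneg: "\<And>a. a \<in> D \<Longrightarrow> 0 \<le> E a"
    and E_scale: "\<And>a r. a \<in> D \<Longrightarrow> E (r *\<^sub>R a) = r\<^sup>2 * E a"
    and par: "\<And>a b. a \<in> D \<Longrightarrow> b \<in> D \<Longrightarrow> E (a + b) + E (a - b) = 2 * E a + 2 * E b"
  shows "semi_inner D (\<lambda>a b. (E (a + b) - E (a - b)) / 4)"
    and "a \<in> D \<Longrightarrow> (E (a + a) - E (a - a)) / 4 = E a"
proof -
  define B where "B a b = (E (a + b) - E (a - b)) / 4" for a b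
  have cl: "a + b \<in> D" "a - b \<in> D" "r *\<^sub>R a \<in> D" "- a \<in> D" "0 \<in> D" if "a \<in> D" "b \<in> D" for a b r
    using D that by (auto intro: subspace_add subspace_diff subspace_scale subspace_neg subspace_0)
  have E_neg: "E (- a) = E a" if "a \<in> D" for a using E_scale[of a "-1"] that by simp
  have E0: "E 0 = 0" using E_scale[of 0 0] D by (simp add: subspace_0)
  have sym: "B a b = B b a" if "a \<in> D" "b \<in> D" for a b
    using E_neg[of "a - b"] cl[OF that] by (simp add: B_def add.commute)
  have diag: "B a a = E a" if "a \<in> D" for a
    using E_scale[of a 2] that by (simp add: B_def E0 flip: scaleR_2)
  have half: "B (a + b) c + B (a - b) c = 2 * B a c" if "a \<in> D" "b \<in> D" "c \<in> D" for a b c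
  proof -
    have eqs: "(a + c) + b = (a + b) + c" "(a + c) - b = (a - b) + c"
      "(a - c) + b = (a + b) - c" "(a - c) - b = (a - b) - c" by simp_all
    have "E (a + b + c) + E (a - b + c) = 2 * E (a + c) + 2 * E b"
      and "E (a + b - c) + E (a - b - c) = 2 * E (a - c) + 2 * E b"
      using par[of "a + c" b] par[of "a - c" b] that unfolding eqs by (simp_all add: cl)
    then show ?thesis unfolding B_def by argo
  qed
  have B0: "B 0 c = 0" if "c \<in> D" for c using E_neg[OF that] by (simp add: B_def)
  have dbl: "B (2 *\<^sub>R a) c = 2 * B a c" if "a \<in> D" "c \<in> D" for a c
    using half[of a a c] that B0 by (simp add: scaleR_2)
  have add: "B (a + b) c = B a c + B b c" if "a \<in> D" "b \<in> D" "c \<in> D" for a b c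
  proof -
    let ?x = "(1/2) *\<^sub>R (a + b)" and ?y = "(1/2) *\<^sub>R (a - b)"
    have xy: "?x \<in> D" "?y \<in> D" using that by (auto intro!: cl)
    have e: "?x + ?y = a" "?x - ?y = b"
      by (simp_all add: algebra_simps flip: scaleR_2 scaleR_left_distrib)
    have "B a c + B b c = 2 * B ?x c" using half[OF xy that(3)] e by simp
    also have "\<dots> = B (2 *\<^sub>R ?x) c" using dbl[OF xy(1) that(3)] by simp
    finally show ?thesis by simp
  qed
  have scale: "B (r *\<^sub>R a) c = r * B a c" if "a \<in> D" "c \<in> D" for a c r
  proof -
    \<comment> \<open>Both energies in the polarization are nonnegative and, by the parallelogram
      identity, add up to at most \<open>2 * E a + 2 * E c\<close>. Boundedness on a neighbourhood
      of 0 is all that an additive function needs to be linear.\<close>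
    have bd: "\<bar>B (t *\<^sub>R a) c\<bar> \<le> E a + E c" if t: "\<bar>t\<bar> \<le> 1" for t
    proof -
      have ta: "t *\<^sub>R a \<in> D" using cl \<open>a \<in> D\<close> by blast
      have "t\<^sup>2 \<le> 1" using t by (simp add: abs_square_le_1)
      then have "t\<^sup>2 * E a \<le> E a" using mult_right_mono[of "t\<^sup>2" 1 "E a"] E_nonneg[OF \<open>a \<in> D\<close>] by simp
      moreover have "0 \<le> E (t *\<^sub>R a + c)" "0 \<le> E (t *\<^sub>R a - c)" using E_nonneg cl ta \<open>c \<in> D\<close> by blast+
      ultimately show ?thesis using par[OF ta \<open>c \<in> D\<close>] E_scale[OF \<open>a \<in> D\<close>, of t] E_nonneg[OF \<open>a \<in> D\<close>] E_nonneg[OF \<open>c \<in> D\<close>]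
        unfolding B_def by (simp add: abs_le_iff; linarith)
    qed
    have "B (r *\<^sub>R a) c = r * B (1 *\<^sub>R a) c"
      using that bd by (intro bounded_additive_eq_scale[where c = "\<lambda>t. B (t *\<^sub>R a) c"])
        (simp_all add: scaleR_left_distrib add cl)
    then show ?thesis by simp
  qed
  show "semi_inner D (\<lambda>a b. (E (a + b) - E (a - b)) / 4)"
    using D sym add scale diag E_nonneg unfolding B_def[symmetric] by unfold_locales (auto simp: B_def[symmetric])
  show "(E (a + a) - E (a - a)) / 4 = E a" if "a \<in> D" using diag[OF that] by (simp add: B_def)
qed

section \<open>Closed positivity-preserving forms\<close>

definition L2_inner :: "'a measure \<Rightarrow> ('a \<Rightarrow> real) \<Rightarrow> ('a \<Rightarrow> real) \<Rightarrow> real" where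
  "L2_inner M f g = (\<integral>x. f x * g x \<partial>M)"

lemma L2_measurable [measurable_dest]: "f \<in> L2_functions M \<Longrightarrow> f \<in> borel_measurable M"
  and L2_integrable: "f \<in> L2_functions M \<Longrightarrow> integrable M (\<lambda>x. (f x)\<^sup>2)"
  by (simp_all add: L2_functions_def)

lemma L2_mult_integrable:
  assumes "f \<in> L2_functions M" "g \<in> L2_functions M"
  shows "integrable M (\<lambda>x. f x * g x)"
proof (rule Bochner_Integration.integrable_bound)
  show "integrable M (\<lambda>x. (f x)\<^sup>2 + (g x)\<^sup>2)" using assms by (simp add: L2_integrable)
  show "(\<lambda>x. f x * g x) \<in> borel_measurable M" using assms[THEN L2_measurable] by simp
  have "\<bar>a * b\<bar> \<le> a\<^sup>2 + b\<^sup>2" for a b :: real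
    using zero_le_power2[of "\<bar>a\<bar> - \<bar>b\<bar>"] mult_nonneg_nonneg[of "\<bar>a\<bar>" "\<bar>b\<bar>"]
    unfolding power2_diff abs_mult power2_abs by linarith
  then show "AE x in M. norm (f x * g x) \<le> norm ((f x)\<^sup>2 + (g x)\<^sup>2)" by simp
qed

lemma L2_dominated:
  assumes "g \<in> L2_functions M" "f \<in> borel_measurable M" "AE x in M. \<bar>f x\<bar> \<le> g x"
  shows "f \<in> L2_functions M"
proof -
  have "integrable M (\<lambda>x. (f x)\<^sup>2)"
  proof (rule Bochner_Integration.integrable_bound)
    show "integrable M (\<lambda>x. (g x)\<^sup>2)" using assms by (simp add: L2_integrable)
    show "AE x in M. norm ((f x)\<^sup>2) \<le> norm ((g x)\<^sup>2)"
      using assms(3) by eventually_elim (auto simp: abs_le_square_iff[symmetric])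
  qed (use assms in simp)
  then show ?thesis using assms by (simp add: L2_functions_def)
qed

lemma subspace_L2: "subspace (L2_functions M)"
  unfolding subspace_def
proof (intro conjI ballI allI)
  show "0 \<in> L2_functions M" by (simp add: L2_functions_def zero_fun_def)
  show "f + g \<in> L2_functions M" if "f \<in> L2_functions M" "g \<in> L2_functions M" for f g
  proof -
    have "integrable M (\<lambda>x. (f x)\<^sup>2 + (g x)\<^sup>2 + 2 * (f x * g x))"
      using that by (intro Bochner_Integration.integrable_add integrable_mult_right L2_mult_integrable L2_integrable)
    then show ?thesis
      using that by (auto simp: L2_functions_def power2_sum plus_fun_def mult.assoc intro!: borel_measurable_add)
  qed
  show "c *\<^sub>R f \<in> L2_functions M" if "f \<in> L2_functions M" for c f
    using that by (auto simp: L2_functions_def power_mult_distrib scaleR_fun_def intro!: borel_measurable_times)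
qed

interpretation L2: semi_inner "L2_functions M" "L2_inner M"
  rewrites "semi_inner.seminorm (L2_inner M) = L2_norm M" for M :: "'a measure"
proof -
  show L: "semi_inner (L2_functions M) (L2_inner M)"
    by unfold_locales
      (simp_all add: subspace_L2 L2_inner_def mult.commute distrib_left L2_mult_integrable mult.left_commute)
  show "semi_inner.seminorm (L2_inner M) = L2_norm M"
    by (simp add: fun_eq_iff semi_inner.seminorm_def[OF L] L2_norm_def L2_inner_def power2_eq_square)
qed

lemma L2_norm_eq_0_AE:
  assumes "f \<in> L2_functions M" "L2_norm M f = 0"
  shows "AE x in M. f x = 0"
  using assms integral_nonneg_eq_0_iff_AE[OF L2_integrable[OF assms(1)]] by (simp add: L2_norm_def)

lemma L2_norm_cong_AE:
  assumes "f \<in> borel_measurable M" "g \<in> borel_measurable M" "AE x in M. f x = g x"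
  shows "L2_norm M f = L2_norm M g"
  unfolding L2_norm_def using assms by (intro arg_cong[where f=sqrt] integral_cong_AE) auto

lemma L2_limit_unique:
  assumes "\<And>n. u n \<in> L2_functions M" "f \<in> L2_functions M" "g \<in> L2_functions M"
    and "(\<lambda>n. L2_norm M (u n - f)) \<longlonglongrightarrow> 0" "(\<lambda>n. L2_norm M (u n - g)) \<longlonglongrightarrow> 0"
  shows "AE x in M. f x = g x"
proof -
  have "L2_norm M (f - g) \<le> 0"
  proof (rule LIMSEQ_le_const)
    show "(\<lambda>n. L2_norm M (u n - f) + L2_norm M (u n - g)) \<longlonglongrightarrow> 0"
      using tendsto_add[OF assms(4,5)] by simp
    show "\<exists>N. \<forall>n\<ge>N. L2_norm M (f - g) \<le> L2_norm M (u n - f) + L2_norm M (u n - g)"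
      using L2.seminorm_triangle[OF assms(2,1,3)] L2.seminorm_commute[OF assms(2,1)] by simp
  qed
  then have "L2_norm M (f - g) = 0" using L2.seminorm_nonneg[of "f - g" M] assms by simp
  then show ?thesis using L2_norm_eq_0_AE[of "f - g" M] assms by simp
qed

lemma L2_dominated_convergence:
  assumes g: "g \<in> L2_functions M" and u: "\<And>n. u n \<in> borel_measurable M" and f: "f \<in> borel_measurable M"
    and lim: "AE x in M. (\<lambda>n. u n x) \<longlonglongrightarrow> f x" and bd: "\<And>n. AE x in M. \<bar>u n x\<bar> \<le> g x"
  shows "u n \<in> L2_functions M" "f \<in> L2_functions M" "(\<lambda>n. L2_norm M (u n - f)) \<longlonglongrightarrow> 0"
proof -
  note [measurable] = u f L2_measurable[OF g]
  have bd': "AE x in M. \<forall>n. \<bar>u n x\<bar> \<le> g x" using bd by (simp add: AE_all_countable)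
  have fg: "AE x in M. \<bar>f x\<bar> \<le> g x" using lim bd'
  proof eventually_elim
    case (elim x)
    show ?case by (rule LIMSEQ_le_const2[OF tendsto_rabs[OF elim(1)]]) (use elim(2) in auto)
  qed
  show "u n \<in> L2_functions M" for n using L2_dominated[OF g u bd] .
  show "f \<in> L2_functions M" using L2_dominated[OF g f fg] .
  have "(\<lambda>n. \<integral>x. ((u n - f) x)\<^sup>2 \<partial>M) \<longlonglongrightarrow> (\<integral>x. 0 \<partial>M)"
  proof (rule integral_dominated_convergence[where w = "\<lambda>x. 4 * (g x)\<^sup>2"])
    show "integrable M (\<lambda>x. 4 * (g x)\<^sup>2)" using L2_integrable[OF g] by simp
    show "AE x in M. (\<lambda>n. ((u n - f) x)\<^sup>2) \<longlonglongrightarrow> 0" using lim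
    proof eventually_elim
      case (elim x)
      have "(\<lambda>n. (u n x - f x)\<^sup>2) \<longlonglongrightarrow> (f x - f x)\<^sup>2" by (intro tendsto_intros elim)
      then show ?case by simp
    qed
    show "AE x in M. norm (((u n - f) x)\<^sup>2) \<le> 4 * (g x)\<^sup>2" for n using bd' fg
    proof eventually_elim
      case (elim x)
      have "\<bar>u n x - f x\<bar> \<le> 2 * g x" using elim(1)[rule_format, of n] elim(2) by linarith
      then have "\<bar>u n x - f x\<bar>\<^sup>2 \<le> (2 * g x)\<^sup>2" by (intro power_mono) auto
      then show ?case by (simp add: power_mult_distrib)
    qed
  qed simp_all
  then show "(\<lambda>n. L2_norm M (u n - f)) \<longlonglongrightarrow> 0"
    unfolding L2_norm_def using tendsto_real_sqrt by fastforce
qed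

lemma L2_norm_tendsto:
  assumes "\<And>n. u n \<in> L2_functions M" "f \<in> L2_functions M" "(\<lambda>n. L2_norm M (u n - f)) \<longlonglongrightarrow> 0"
  shows "(\<lambda>n. L2_inner M (u n) (u n)) \<longlonglongrightarrow> L2_inner M f f"
proof -
  have "(\<lambda>n. L2_norm M (u n)) \<longlonglongrightarrow> L2_norm M f"
  proof (rule LIM_zero_cancel, rule Lim_null_comparison[OF _ assms(3)])
    show "\<forall>\<^sub>F n in sequentially. norm (L2_norm M (u n) - L2_norm M f) \<le> L2_norm M (u n - f)"
      using L2.seminorm_abs_diff[OF assms(1,2)] by simp
  qed
  then have "(\<lambda>n. (L2_norm M (u n))\<^sup>2) \<longlonglongrightarrow> (L2_norm M f)\<^sup>2" by (rule tendsto_power)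
  then show ?thesis using assms by (simp add: L2.seminorm_sq)
qed

locale positivity_preserving_form =
  fixes M :: "'a measure" and q :: "('a \<Rightarrow> real) \<Rightarrow> ennreal"
  assumes quadratic: "quadratic_form_L2 M q"
    and closed: "closed_form M q"
    and Beurling_Deny: "first_Beurling_Deny M q"
begin

abbreviation "D \<equiv> form_domain (L2_functions M) q"

text \<open>Meaningful on \<open>D\<close> only, where sum and difference have finite energy;
  elsewhere \<open>enn2real\<close> turns infinite values into 0.\<close>

definition B :: "('a \<Rightarrow> real) \<Rightarrow> ('a \<Rightarrow> real) \<Rightarrow> real" where
  "B f g = (enn2real (q (f + g)) - enn2real (q (f - g))) / 4"

lemma D_L2 [simp]: "f \<in> D \<Longrightarrow> f \<in> L2_functions M"
  by (simp add: form_domain_def)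

lemma D_measurable [measurable_dest]: "f \<in> D \<Longrightarrow> f \<in> borel_measurable M"
  by (simp add: L2_measurable)

lemma q_cong: "f \<in> L2_functions M \<Longrightarrow> g \<in> L2_functions M \<Longrightarrow> AE x in M. f x = g x \<Longrightarrow> q f = q g"
  using quadratic unfolding quadratic_form_L2_def by blast

lemma q_scale: "f \<in> L2_functions M \<Longrightarrow> q (c *\<^sub>R f) = ennreal (c\<^sup>2) * q f"
  using quadratic unfolding quadratic_form_L2_def scaleR_fun_def real_scaleR_def by blast

lemma q_parallelogram:
  "f \<in> L2_functions M \<Longrightarrow> g \<in> L2_functions M \<Longrightarrow> q (f + g) + q (f - g) = 2 * q f + 2 * q g"
  using quadratic unfolding quadratic_form_L2_def plus_fun_def fun_diff_def by blast

lemma subspace_D: "subspace D"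
  unfolding subspace_def
proof (intro conjI ballI allI)
  show "0 \<in> D" using q_scale[of 0 0] by (simp add: form_domain_def del: D_L2)
  show "f + g \<in> D" if "f \<in> D" "g \<in> D" for f g
  proof -
    have "q (f + g) \<le> q (f + g) + q (f - g)" by simp
    also have "\<dots> = 2 * q f + 2 * q g" using that by (intro q_parallelogram) simp_all
    also have "\<dots> < \<infinity>" using that by (auto simp: form_domain_def ennreal_mult_less_top simp del: D_L2)
    finally show ?thesis using that by (simp add: form_domain_def del: D_L2)
  qed
  show "c *\<^sub>R f \<in> D" if "f \<in> D" for c f
    using that by (simp add: form_domain_def q_scale ennreal_mult_less_top del: D_L2)
qed

sublocale form: semi_inner D B
proof -
  have fin: "q f < \<infinity>" if "f \<in> D" for f using that by (simp add: form_domain_def del: D_L2)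
  have "enn2real (q (f + g)) + enn2real (q (f - g)) = 2 * enn2real (q f) + 2 * enn2real (q g)"
    if "f \<in> D" "g \<in> D" for f g
  proof -
    have "enn2real (q (f + g) + q (f - g)) = enn2real (2 * q f + 2 * q g)"
      using q_parallelogram[of f g] that by simp
    then show ?thesis
      using fin[of f] fin[of g] fin[of "f + g"] fin[of "f - g"] that subspace_D
      by (simp add: enn2real_plus enn2real_mult ennreal_mult_less_top subspace_add subspace_diff)
  qed
  then show "semi_inner D B"
    unfolding B_def[abs_def] using subspace_D
    by (intro semi_inner_of_parallelogram(1)[where E = "\<lambda>f. enn2real (q f)"]) (simp_all add: q_scale enn2real_mult)
qed

lemma q_eq: "f \<in> D \<Longrightarrow> q f = ennreal (B f f)"
proof -
  assume f: "f \<in> D"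
  have "B f f = enn2real (q (2 *\<^sub>R f)) / 4 - enn2real (q (0 *\<^sub>R f)) / 4"
    by (simp add: B_def scaleR_2 diff_divide_distrib)
  also have "\<dots> = enn2real (q f)" using f by (simp only: q_scale D_L2) (simp add: enn2real_mult)
  finally show ?thesis using f by (simp add: form_domain_def del: D_L2)
qed

lemma D_I: "f \<in> L2_functions M \<Longrightarrow> q f \<le> ennreal c \<Longrightarrow> f \<in> D"
  by (auto simp: form_domain_def simp del: D_L2 intro: le_less_trans)

lemma D_cong:
  assumes "f \<in> D" "g \<in> borel_measurable M" "AE x in M. f x = g x"
  shows "g \<in> D"
proof -
  have "g \<in> L2_functions M"
    using assms by (intro L2_dominated[of "\<lambda>x. \<bar>f x\<bar>" M g])
      (auto simp: L2_functions_def form_domain_def simp del: D_L2)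
  then show ?thesis using q_cong[of f g] assms by (simp add: form_domain_def del: D_L2)
qed

lemma B_cong:
  assumes "f \<in> D" "g \<in> borel_measurable M" "AE x in M. f x = g x" "h \<in> D"
  shows "B f h = B g h" "B h f = B h g"
proof -
  have g: "g \<in> D" using D_cong[OF assms(1-3)] .
  have "q (f + h) = q (g + h)" "q (f - h) = q (g - h)"
    using assms g by (auto intro!: q_cong)
  then show *: "B f h = B g h" by (simp add: B_def)
  then show "B h f = B h g" using assms g by (simp add: form.sym)
qed

lemma energy_cong:
  assumes "f \<in> D" "g \<in> borel_measurable M" "AE x in M. f x = g x"
  shows "B f f = B g g"
  using B_cong[OF assms] D_cong[OF assms] assms(1) by simp

lemma abs_D:
  assumes "f \<in> D"
  shows "(\<lambda>x. \<bar>f x\<bar>) \<in> D" "B (\<lambda>x. \<bar>f x\<bar>) (\<lambda>x. \<bar>f x\<bar>) \<le> B f f"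
proof -
  have le: "q (\<lambda>x. \<bar>f x\<bar>) \<le> q f" using Beurling_Deny assms by (simp add: first_Beurling_Deny_def)
  then show *: "(\<lambda>x. \<bar>f x\<bar>) \<in> D"
    using assms by (auto simp: form_domain_def L2_functions_def simp del: D_L2)
  show "B (\<lambda>x. \<bar>f x\<bar>) (\<lambda>x. \<bar>f x\<bar>) \<le> B f f"
    using le q_eq[OF *] q_eq[OF assms] form.nonneg[OF assms] by simp
qed

declare D_measurable [simp]

lemma min_D:
  assumes "f \<in> D" "g \<in> D"
  shows "(\<lambda>x. min (f x) (g x)) \<in> D"
proof -
  have "(\<lambda>x. min (f x) (g x)) = (1/2) *\<^sub>R (f + g - (\<lambda>x. \<bar>(f - g) x\<bar>))"
    by (auto simp: fun_eq_iff min_def)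
  then show ?thesis using assms abs_D(1)[of "f - g"] by simp
qed

lemma max_D:
  assumes "f \<in> D" "g \<in> D"
  shows "(\<lambda>x. max (f x) (g x)) \<in> D"
proof -
  have "(\<lambda>x. max (f x) (g x)) = (1/2) *\<^sub>R (f + g + (\<lambda>x. \<bar>(f - g) x\<bar>))"
    by (auto simp: fun_eq_iff max_def)
  then show ?thesis using assms abs_D(1)[of "f - g"] by simp
qed

text \<open>Minimum and maximum are half of \<open>f + g\<close> minus and plus the absolute value
  of \<open>f - g\<close>. By the parallelogram identity their energies add up to half the energies
  of \<open>f + g\<close> and of that absolute value, and the Beurling-Deny criterion replaces the
  latter by the energy of \<open>f - g\<close>.\<close>

lemma energy_min_max:
  assumes "f \<in> D" "g \<in> D"
  shows "B (\<lambda>x. min (f x) (g x)) (\<lambda>x. min (f x) (g x)) + B (\<lambda>x. max (f x) (g x)) (\<lambda>x. max (f x) (g x))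
    \<le> B f f + B g g"
proof -
  let ?a = "\<lambda>x. \<bar>(f - g) x\<bar>"
  have a: "?a \<in> D" "B ?a ?a \<le> B (f - g) (f - g)" using abs_D[of "f - g"] assms by auto
  have mi: "(\<lambda>x. min (f x) (g x)) = (1/2) *\<^sub>R ((f + g) - ?a)"
    and ma: "(\<lambda>x. max (f x) (g x)) = (1/2) *\<^sub>R ((f + g) + ?a)"
    by (auto simp: fun_eq_iff min_def max_def)
  have "B ((1/2) *\<^sub>R ((f + g) - ?a)) ((1/2) *\<^sub>R ((f + g) - ?a)) + B ((1/2) *\<^sub>R ((f + g) + ?a)) ((1/2) *\<^sub>R ((f + g) + ?a))
      = (B (f + g) (f + g) + B ?a ?a) / 2"
    using assms a(1) form.energy_diff[of "f + g" ?a] form.energy_add[of "f + g" ?a]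
    by (simp only: form.energy_scale form.D_add form.D_diff) (simp add: field_simps power2_eq_square)
  also have "\<dots> \<le> B f f + B g g"
    using a(2) form.energy_add[OF assms] form.energy_diff[OF assms] by simp
  finally show ?thesis unfolding mi ma .
qed

lemma seminorm_min:
  assumes "f \<in> D" "g \<in> D"
  shows "form.seminorm (\<lambda>x. min (f x) (g x)) \<le> form.seminorm f + form.seminorm g"
proof -
  let ?a = "\<lambda>x. \<bar>(f - g) x\<bar>"
  have a: "?a \<in> D" "B ?a ?a \<le> B (f - g) (f - g)" using abs_D[of "f - g"] assms by auto
  have mi: "(\<lambda>x. min (f x) (g x)) = (1/2) *\<^sub>R ((f + g) - ?a)"
    by (auto simp: fun_eq_iff min_def)
  have "form.seminorm ((f + g) - ?a) \<le> form.seminorm (f + g) + form.seminorm ?a"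
    using assms a by (intro form.seminorm_diff) auto
  also have "form.seminorm ?a \<le> form.seminorm (f - g)" using a by (simp add: form.seminorm_def)
  also have "form.seminorm (f + g) \<le> form.seminorm f + form.seminorm g" using assms by (rule form.seminorm_add)
  also have "form.seminorm (f - g) \<le> form.seminorm f + form.seminorm g" using assms by (rule form.seminorm_diff)
  finally show ?thesis unfolding mi using assms a by (simp only: form.seminorm_scale form.D_add form.D_diff) simp
qed

text \<open>For disjoint supports the absolute value of \<open>f - g\<close> is
  \<open>f + g\<close>, so the Beurling-Deny criterion compares the energies of \<open>f + g\<close>
  and \<open>f - g\<close>, which differ by \<open>4 * B f g\<close>.\<close>

lemma disjoint_B_nonpos:
  assumes "f \<in> D" "g \<in> D" "AE x in M. f x \<ge> 0 \<and> g x \<ge> 0 \<and> min (f x) (g x) = 0"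
  shows "B f g \<le> 0"
proof -
  let ?a = "\<lambda>x. \<bar>(f - g) x\<bar>"
  have "AE x in M. ?a x = (f + g) x" using assms(3) by eventually_elim (auto simp: min_def split: if_splits)
  then have "B ?a ?a = B (f + g) (f + g)"
    using assms abs_D[of "f - g"] by (intro energy_cong) (auto simp: D_measurable[OF form.D_add])
  then have "B (f + g) (f + g) \<le> B (f - g) (f - g)" using abs_D(2)[of "f - g"] assms by simp
  then show ?thesis using assms by (simp add: form.energy_add form.energy_diff)
qed

lemma complete:
  assumes u: "\<And>n. u n \<in> D" and c: "form.Cauchy_seq u" "L2.Cauchy_seq M u"
  obtains f where "f \<in> D" "(\<lambda>n. form.seminorm (u n - f)) \<longlonglongrightarrow> 0" "(\<lambda>n. L2_norm M (u n - f)) \<longlonglongrightarrow> 0"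
proof -
  have fn: "form_norm M q f = form.seminorm f + L2_norm M f" if "f \<in> D" for f
    using q_eq[OF that] form.nonneg[OF that] by (simp add: form_norm_def form.seminorm_def)
  have "\<exists>N. \<forall>m\<ge>N. \<forall>n\<ge>N. form_norm M q (u m - u n) < e" if e: "e > 0" for e
  proof -
    obtain N1 where N1: "\<forall>m\<ge>N1. \<forall>n\<ge>N1. form.seminorm (u m - u n) < e/2"
      using c(1) e unfolding form.Cauchy_seq_def by (meson half_gt_zero)
    obtain N2 where N2: "\<forall>m\<ge>N2. \<forall>n\<ge>N2. L2_norm M (u m - u n) < e/2"
      using c(2) e unfolding L2.Cauchy_seq_def by (meson half_gt_zero)
    show ?thesis
    proof (intro exI[of _ "max N1 N2"] allI impI)
      fix m n assume "max N1 N2 \<le> m" "max N1 N2 \<le> n"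
      then have "form.seminorm (u m - u n) < e/2" "L2_norm M (u m - u n) < e/2" using N1 N2 by auto
      then show "form_norm M q (u m - u n) < e" using u by (simp add: fn)
    qed
  qed
  then obtain f where f: "f \<in> D" "(\<lambda>n. form_norm M q (u n - f)) \<longlonglongrightarrow> 0"
    using closed[unfolded closed_form_def, rule_format, of u] u by (auto simp: fun_diff_def)
  have lim: "(\<lambda>n. form.seminorm (u n - f) + L2_norm M (u n - f)) \<longlonglongrightarrow> 0"
    using f u by (simp add: fn)
  have nn: "0 \<le> form.seminorm (u n - f)" "0 \<le> L2_norm M (u n - f)" for n
    using u f by (auto intro!: form.seminorm_nonneg L2.seminorm_nonneg)
  show ?thesis
    using nn by (intro that[OF f(1)] Lim_null_comparison[OF _ lim]) auto
qed

text \<open>Convex combinations of the tails are Cauchy for the form norm, so closedness applies to them.\<close>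

lemma lower_semicontinuous:
  assumes u: "\<And>n. u n \<in> D" and f: "f \<in> L2_functions M" and lim: "(\<lambda>n. L2_norm M (u n - f)) \<longlonglongrightarrow> 0"
    and bd: "\<And>n. B (u n) (u n) \<le> c n" and c: "c \<longlonglongrightarrow> C"
  shows "f \<in> D" "B f f \<le> C"
proof -
  have C0: "C \<ge> 0"
    using c bd form.nonneg[OF u] by (intro LIMSEQ_le_const[OF c]) (meson order_trans)
  obtain K where K: "\<And>n. c n \<le> K" "K > 0"
  proof -
    have "Bseq c" using c by (intro Cauchy_Bseq LIMSEQ_imp_Cauchy)
    then obtain K where "K > 0" "\<And>n. norm (c n) \<le> K" by (auto simp: Bseq_def)
    then show ?thesis using that[of K] by (auto simp: abs_le_iff)
  qed
  have "form.seminorm (u n) \<le> sqrt K" for n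
    using order_trans[OF bd K(1)] by (simp add: form.seminorm_def)
  then obtain v where v: "\<And>n. v n \<in> convex hull (u ` {n..})" "form.Cauchy_seq v"
    using form.Cauchy_convex_combinations[of u "sqrt K", OF u] by blast
  have vD: "v n \<in> D" for n
    using form.hull_seminorm_ball(1)[OF v(1)[of n], of 0 "sqrt K"] u \<open>\<And>n. form.seminorm (u n) \<le> sqrt K\<close> by auto
  have v_L2: "\<exists>N. \<forall>n\<ge>N. L2_norm M (v n - f) \<le> e" if e: "e > 0" for e
  proof -
    obtain N where N: "\<And>n. n \<ge> N \<Longrightarrow> L2_norm M (u n - f) < e"
      using order_tendstoD(2)[OF lim e] by (auto simp: eventually_sequentially)
    have "L2_norm M (v n - f) \<le> e" if "n \<ge> N" for n
      using v(1)[of n] f u N that by (intro L2.hull_seminorm_ball(2)[of "v n" "u ` {n..}" f]) (auto intro: less_imp_le)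
    then show ?thesis by blast
  qed
  have v_lim: "(\<lambda>n. L2_norm M (v n - f)) \<longlonglongrightarrow> 0"
  proof (rule LIMSEQ_I)
    fix r :: real assume "r > 0"
    then obtain N where "\<forall>n\<ge>N. L2_norm M (v n - f) \<le> r/2" using v_L2[of "r/2"] by auto
    then show "\<exists>N. \<forall>n\<ge>N. norm (L2_norm M (v n - f) - 0) < r"
      using \<open>r > 0\<close> L2.seminorm_nonneg[of "v _ - f" M] vD f by (intro exI[of _ N]) fastforce
  qed
  have "L2.Cauchy_seq M v" unfolding L2.Cauchy_seq_def
  proof (intro allI impI)
    fix e :: real assume "e > 0"
    then obtain N where N: "\<forall>n\<ge>N. L2_norm M (v n - f) \<le> e/3" using v_L2[of "e/3"] by auto
    show "\<exists>N. \<forall>m\<ge>N. \<forall>n\<ge>N. L2_norm M (v m - v n) < e"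
    proof (intro exI[of _ N] allI impI)
      fix m n assume "N \<le> m" "N \<le> n"
      then have "L2_norm M (v m - f) \<le> e/3" "L2_norm M (f - v n) \<le> e/3"
        using N L2.seminorm_commute[of "v n" M f] vD f by auto
      then show "L2_norm M (v m - v n) < e"
        using L2.seminorm_triangle[of "v m" M f "v n"] vD f \<open>e > 0\<close> by simp
    qed
  qed
  then obtain f' where f': "f' \<in> D" "(\<lambda>n. form.seminorm (v n - f')) \<longlonglongrightarrow> 0" "(\<lambda>n. L2_norm M (v n - f')) \<longlonglongrightarrow> 0"
    using complete[OF vD v(2)] by blast
  have ae: "AE x in M. f' x = f x"
    using vD f' f v_lim by (intro L2_limit_unique[of v M f' f]) auto
  show fD: "f \<in> D" using D_cong[OF f'(1) L2_measurable[OF f] ae] .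
  have eq: "B f f = B f' f'" using energy_cong[OF f'(1) L2_measurable[OF f] ae] by simp
  show "B f f \<le> C"
  proof (rule dense_ge)
    fix K assume K: "C < K"
    then have K0: "K > 0" using C0 by simp
    obtain N where N: "\<And>n. n \<ge> N \<Longrightarrow> c n < K"
      using order_tendstoD(2)[OF c K] by (auto simp: eventually_sequentially)
    \<comment> \<open>The hull of a late tail only sees late energies, which are below
      \<open>K\<close>. This gives the sharp constant \<open>C\<close> instead of the supremum of
      \<open>c\<close>.\<close>
    have vK: "form.seminorm (v n) \<le> sqrt K" if "n \<ge> N" for n
    proof -
      have "form.seminorm (u k - 0) \<le> sqrt K" if "k \<ge> n" for k
        using bd[of k] N[of k] that \<open>n \<ge> N\<close> by (simp add: form.seminorm_def)
      then show ?thesis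
        using form.hull_seminorm_ball(2)[OF v(1)[of n], of 0 "sqrt K"] u by auto
    qed
    have "form.seminorm f' \<le> sqrt K"
    proof (rule LIMSEQ_le_const)
      show "(\<lambda>n. form.seminorm (v n - f') + sqrt K) \<longlonglongrightarrow> sqrt K"
        using tendsto_add[OF f'(2) tendsto_const[of "sqrt K"]] by simp
      show "\<exists>N. \<forall>n\<ge>N. form.seminorm f' \<le> form.seminorm (v n - f') + sqrt K"
      proof (intro exI[of _ N] allI impI)
        fix n assume "n \<ge> N"
        then show "form.seminorm f' \<le> form.seminorm (v n - f') + sqrt K"
          using vK[of n] form.seminorm_triangle[of f' "v n" 0] form.seminorm_commute[of f' "v n"] vD f' by simp
      qed
    qed
    then show "B f f \<le> K" using eq K0 by (simp add: form.seminorm_def)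
  qed
qed

text \<open>The form in which lower semicontinuity is applied to truncations. The bound
  \<open>c n\<close> varies with \<open>n\<close> because the energy of a truncation is often
  controlled only up to an error that tends to 0.\<close>

lemma dominated_limit:
  assumes u: "\<And>n. u n \<in> D" and g: "g \<in> L2_functions M" and f: "f \<in> borel_measurable M"
    and lim: "AE x in M. (\<lambda>n. u n x) \<longlonglongrightarrow> f x" and dom: "\<And>n. AE x in M. \<bar>u n x\<bar> \<le> g x"
    and bd: "\<And>n. B (u n) (u n) \<le> c n" and c: "c \<longlonglongrightarrow> C"
  shows "f \<in> D" "B f f \<le> C"
  using lower_semicontinuous[OF u L2_dominated_convergence(2,3)[OF g D_measurable[OF u] f lim dom] bd c]
  by blast+

text \<open>Apply lower semicontinuity to \<open>f + t *\<^sub>R u n\<close> with small \<open>t\<close> of either sign.\<close>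

lemma weak_null:
  assumes u: "\<And>n. u n \<in> D" and f: "f \<in> D" and lim: "(\<lambda>n. L2_norm M (u n)) \<longlonglongrightarrow> 0"
    and bd: "\<And>n. B (u n) (u n) \<le> K"
  shows "(\<lambda>n. B f (u n)) \<longlonglongrightarrow> 0"
proof -
  have K: "K \<ge> 0" using bd[of 0] form.nonneg[OF u[of 0]] by linarith
  have low: "\<forall>\<^sub>F n in sequentially. - e < B f (u n)"
    if e: "e > 0" and u: "\<And>n. u n \<in> D" and lim: "(\<lambda>n. L2_norm M (u n)) \<longlonglongrightarrow> 0"
    and bd: "\<And>n. B (u n) (u n) \<le> K" for u and e :: real
  proof (rule ccontr)
    assume "\<not> (\<forall>\<^sub>F n in sequentially. - e < B f (u n))"
    then have "\<exists>\<^sub>F n in sequentially. B f (u n) \<le> - e" by (simp add: not_eventually not_less)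
    then have inf: "infinite {n. B f (u n) \<le> - e}" by (simp add: frequently_cofinite flip: cofinite_eq_sequentially)
    define r where "r = enumerate {n. B f (u n) \<le> - e}"
    have r: "strict_mono r" "\<And>n. B f (u (r n)) \<le> - e"
      using strict_mono_enumerate[OF inf] enumerate_in_set[OF inf] by (auto simp: r_def)
    \<comment> \<open>Small enough that the gain \<open>2 * t * e\<close> from the linear term beats
      the quadratic term, which is at most \<open>t\<^sup>2 * K\<close>.\<close>
    define t where "t = e / (K + 1)"
    have t: "t > 0" "t * K < e" using e K by (auto simp: t_def field_simps)
    let ?w = "\<lambda>n. f + t *\<^sub>R u (r n)"
    have "(\<lambda>n. t * L2_norm M (u (r n))) \<longlonglongrightarrow> t * 0"
      using LIMSEQ_subseq_LIMSEQ[OF lim r(1)] by (intro tendsto_intros) (simp add: o_def)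
    then have L: "(\<lambda>n. L2_norm M (?w n - f)) \<longlonglongrightarrow> 0"
      using u t(1) by (simp add: L2.seminorm_scale)
    have W: "B (?w n) (?w n) \<le> B f f - 2 * t * e + t\<^sup>2 * K" for n
    proof -
      have "B (?w n) (?w n) = B f f + 2 * t * B f (u (r n)) + t\<^sup>2 * B (u (r n)) (u (r n))"
        using u f by (simp add: form.energy_add form.scale_left form.scale_right power2_eq_square mult.assoc)
      also have "\<dots> \<le> B f f + 2 * t * (- e) + t\<^sup>2 * K"
        using t r(2) bd by (intro add_mono mult_left_mono) auto
      finally show ?thesis by simp
    qed
    have "B f f \<le> B f f - 2 * t * e + t\<^sup>2 * K"
      using u f by (intro lower_semicontinuous(2)[OF _ _ L W tendsto_const]) auto
    then have "2 * e \<le> t * K" using t(1) by (simp add: power2_eq_square mult.assoc mult.left_commute[of 2])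
    then show False using t e by simp
  qed
  show ?thesis
  proof (rule tendstoI)
    fix e :: real assume e: "e > 0"
    have "\<forall>\<^sub>F n in sequentially. - e < B f (- u n)"
    proof (rule low[OF e])
      show "(\<lambda>n. L2_norm M (- u n)) \<longlonglongrightarrow> 0" using lim u by (simp add: L2.seminorm_minus)
      show "B (- u n) (- u n) \<le> K" for n using bd u by (simp add: form.minus_left form.minus_right)
    qed (use u in simp)
    with low[OF e u lim bd] show "\<forall>\<^sub>F n in sequentially. dist (B f (u n)) 0 < e"
      by eventually_elim (use u f in \<open>auto simp: form.minus_right abs_less_iff\<close>)
  qed
qed

end

section \<open>The extended form\<close>

context positivity_preserving_form
begin

lemma energy_positive_part:
  assumes "f \<in> D"
  shows "(\<lambda>x. max (f x) 0) \<in> D" "B (\<lambda>x. max (f x) 0) (\<lambda>x. max (f x) 0) \<le> B f f"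
proof -
  have 0: "(\<lambda>x. 0::real) \<in> D" using form.D_zero by (simp add: zero_fun_def)
  have "B (\<lambda>x. 0) (\<lambda>x. 0) = 0" using form.zero_left[OF 0] by (simp add: zero_fun_def)
  then show "(\<lambda>x. max (f x) 0) \<in> D" "B (\<lambda>x. max (f x) 0) (\<lambda>x. max (f x) 0) \<le> B f f"
    using max_D[OF assms 0] energy_min_max[OF assms 0] form.nonneg[OF min_D[OF assms 0]] by auto
qed

lemma positive_negative_parts:
  assumes "f \<in> D"
  obtains p m where "p \<in> D" "m \<in> D" "\<And>x. p x = max (f x) 0" "\<And>x. m x = max (- f x) 0" "f = p - m"
proof -
  have p: "(\<lambda>x. max (f x) 0) \<in> D" by (rule energy_positive_part(1)[OF assms])
  have m: "(\<lambda>x. max ((- f) x) 0) \<in> D" by (rule energy_positive_part(1)[OF form.D_minus[OF assms]])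
  have "f = (\<lambda>x. max (f x) 0) - (\<lambda>x. max ((- f) x) 0)" by (auto simp: fun_eq_iff)
  then show ?thesis using that[OF p m] by simp
qed

text \<open>The core of the well-definedness of the extended form. The \<open>w n\<close> need not
  converge in L2, so they are cut off at a fixed \<open>w m\<close>: the minima are dominated by
  \<open>w m\<close>, hence tend to 0 in L2 and, having bounded energy, weakly with respect to the
  form. The inequality for minimum and maximum converts this into smallness of the energy of
  \<open>w m\<close> itself.\<close>

lemma Cauchy_null_nonneg:
  assumes w: "\<And>n. w n \<in> D" and nn: "\<And>n. AE x in M. 0 \<le> w n x" and C: "form.Cauchy_seq w"
    and lim: "AE x in M. (\<lambda>n. w n x) \<longlonglongrightarrow> 0"
  shows "(\<lambda>n. form.seminorm (w n)) \<longlonglongrightarrow> 0"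
proof -
  obtain K where K: "\<And>n. form.seminorm (w n) \<le> K" "K \<ge> 0"
    using form.Cauchy_seq_bounded[OF C w] by blast
  have key: "B (w m) (w m) \<le> 5 * e * K"
    if e: "e > 0" and N: "\<forall>n\<ge>N. form.seminorm (w n - w m) < e" for e N m
  proof -
    define g where "g n = (\<lambda>x. min (w n x) (w m x))" for n
    have gD: "g n \<in> D" for n unfolding g_def using w by (intro min_D)
    have g_semi: "form.seminorm (g n) \<le> 2 * K" for n
      using seminorm_min[OF w[of n] w[of m]] K(1)[of n] K(1)[of m] unfolding g_def by linarith
    have g_bd: "B (g n) (g n) \<le> (2 * K)\<^sup>2" for n
      using g_semi[of n] gD K(2) by (simp add: form.seminorm_le_iff)
    have "(\<lambda>n. L2_norm M (g n - (\<lambda>x. 0))) \<longlonglongrightarrow> 0"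
    proof (rule L2_dominated_convergence(3)[of "\<lambda>x. w m x"])
      show "AE x in M. (\<lambda>n. g n x) \<longlonglongrightarrow> 0" using lim nn[of m]
      proof eventually_elim
        case (elim x)
        show ?case using tendsto_min[OF elim(1) tendsto_const[of "w m x"]] elim(2) by (simp add: g_def)
      qed
      show "AE x in M. \<bar>g n x\<bar> \<le> w m x" for n
        using nn[of m] nn[of n] by eventually_elim (auto simp: g_def)
    qed (use w gD in auto)
    moreover have "g n - (\<lambda>x. 0) = g n" for n by (simp add: fun_eq_iff)
    ultimately have g_lim: "(\<lambda>n. L2_norm M (g n)) \<longlonglongrightarrow> 0" by simp
    have weak: "(\<lambda>n. B (w m) (g n)) \<longlonglongrightarrow> 0" by (rule weak_null[OF gD w g_lim g_bd])
    \<comment> \<open>The maximum is \<open>w n + w m - g n\<close>. Expanding its energy and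
      dropping that of \<open>g n\<close>, the inequality for minimum and maximum bounds
      \<open>B (w n) (w m)\<close> by \<open>B ?d (g n) + 2 * B (w m) (g n)\<close>. The first term
      is at most \<open>2 * e * K\<close>; replacing \<open>w n\<close> by \<open>w m\<close> on the
      left costs another \<open>e * K\<close>.\<close>
    have est: "B (w m) (w m) \<le> 3 * (e * K) + 2 * B (w m) (g n)" if "n \<ge> N" for n
    proof -
      let ?d = "w n - w m"
      have d: "?d \<in> D" "form.seminorm ?d \<le> e" using w N that by (auto intro: less_imp_le)
      have mx: "(\<lambda>x. max (w n x) (w m x)) = w n + w m - g n"
        by (auto simp: g_def fun_eq_iff max_def min_def)
      have "B (g n) (g n) + B (w n + w m - g n) (w n + w m - g n) \<le> B (w n) (w n) + B (w m) (w m)"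
        using energy_min_max[OF w[of n] w[of m]] unfolding g_def[symmetric] mx .
      moreover have "B (w n + w m - g n) (w n + w m - g n)
          = B (w n) (w n) + 2 * B (w n) (w m) + B (w m) (w m) - 2 * B ?d (g n) - 4 * B (w m) (g n) + B (g n) (g n)"
        using w gD by (simp add: form.energy_diff[of "w n + w m" "g n"] form.energy_add[of "w n" "w m"]
            form.add_left[of "w n" "w m" "g n"] form.diff_left[of "w n" "w m" "g n"])
      moreover have "B (w m) (w m) = B (w n) (w m) - B ?d (w m)" using w by (simp add: form.diff_left)
      moreover have "B ?d (g n) \<le> e * (2 * K)"
        using form.Cauchy_Schwarz[OF d(1) gD[of n]] mult_mono[OF d(2) g_semi[of n]]
          form.seminorm_nonneg[OF gD[of n]] e by linarith
      moreover have "- B ?d (w m) \<le> e * K"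
        using form.Cauchy_Schwarz[OF d(1) w[of m]] mult_mono[OF d(2) K(1)[of m]]
          form.seminorm_nonneg[OF w[of m]] e by linarith
      ultimately show ?thesis using form.nonneg[OF gD[of n]] by linarith
    qed
    have "B (w m) (w m) \<le> 3 * (e * K) + 2 * 0"
    proof (rule LIMSEQ_le_const)
      show "(\<lambda>n. 3 * (e * K) + 2 * B (w m) (g n)) \<longlonglongrightarrow> 3 * (e * K) + 2 * 0"
        by (intro tendsto_intros weak)
    qed (use est in blast)
    also have "\<dots> \<le> 5 * e * K" using e K(2) by simp
    finally show ?thesis .
  qed
  have "(\<lambda>n. B (w n) (w n)) \<longlonglongrightarrow> 0"
  proof (rule LIMSEQ_I)
    fix r :: real assume r: "r > 0"
    define e where "e = r / (5 * K + 1)"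
    have e: "e > 0" "5 * e * K < r" using r K(2) by (simp_all add: e_def field_simps)
    obtain N where N: "\<forall>m\<ge>N. \<forall>n\<ge>N. form.seminorm (w m - w n) < e"
      using C e unfolding form.Cauchy_seq_def by blast
    show "\<exists>N. \<forall>n\<ge>N. norm (B (w n) (w n) - 0) < r"
    proof (intro exI[of _ N] allI impI)
      fix m assume "N \<le> m"
      then have "B (w m) (w m) \<le> 5 * e * K" using N by (intro key[OF e(1), of N]) auto
      then show "norm (B (w m) (w m) - 0) < r" using e(2) form.nonneg[OF w[of m]] by simp
    qed
  qed
  then show ?thesis using form.tendsto_energy_zero_iff[OF w] by simp
qed

text \<open>The signed case reduces to the nonnegative one: positive and negative parts need not be
  Cauchy, but simultaneous convex combinations of them are.\<close>

lemma Cauchy_null: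
  assumes w: "\<And>n. w n \<in> D" and C: "form.Cauchy_seq w" and lim: "AE x in M. (\<lambda>n. w n x) \<longlonglongrightarrow> 0"
  shows "(\<lambda>n. form.seminorm (w n)) \<longlonglongrightarrow> 0"
proof -
  define p where "p n = (\<lambda>x. max (w n x) 0)" for n
  define m where "m n = (\<lambda>x. max ((- w n) x) 0)" for n
  obtain K where K: "\<And>n. form.seminorm (w n) \<le> K" "K \<ge> 0"
    using form.Cauchy_seq_bounded[OF C w] by blast
  have pm: "p n \<in> D" "m n \<in> D" "B (p n) (p n) \<le> K\<^sup>2" "B (m n) (m n) \<le> K\<^sup>2" for n
  proof -
    have "B (w n) (w n) \<le> K\<^sup>2" using K w by (simp add: form.seminorm_le_iff[symmetric])
    then show "p n \<in> D" "m n \<in> D" "B (p n) (p n) \<le> K\<^sup>2" "B (m n) (m n) \<le> K\<^sup>2"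
      using energy_positive_part[of "w n"] energy_positive_part[of "- w n"] w
      by (auto simp: p_def m_def form.minus_left form.minus_right)
  qed
  have w_eq: "w n = p n - m n" for n by (auto simp: p_def m_def fun_eq_iff)
  \<comment> \<open>In the product space the same convex weights act on both parts, so that the
    difference of the two combinations is a convex combination of the \<open>w n\<close>.\<close>
  define P where "P a b = B (fst a) (fst b) + B (snd a) (snd b)" for a b
  interpret pair: semi_inner "D \<times> D" P
  proof
    show "subspace (D \<times> D)"
      using subspace_D unfolding subspace_def by (auto simp: zero_prod_def)
    show "P a b = P b a" if "a \<in> D \<times> D" "b \<in> D \<times> D" for a b
      using that unfolding P_def by (auto simp: form.sym)
    show "P (a + b) c = P a c + P b c" if "a \<in> D \<times> D" "b \<in> D \<times> D" "c \<in> D \<times> D" for a b c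
      using that unfolding P_def by (auto simp: form.add_left)
    show "P (r *\<^sub>R a) b = r * P a b" if "a \<in> D \<times> D" "b \<in> D \<times> D" for a b r
      using that unfolding P_def by (auto simp: form.scale_left algebra_simps)
    show "0 \<le> P a a" if "a \<in> D \<times> D" for a
      using that form.nonneg unfolding P_def by auto
  qed
  have "pair.seminorm (p n, m n) \<le> sqrt (2 * K\<^sup>2)" for n
    using pm[of n] by (simp add: pair.seminorm_def P_def)
  then obtain z where z: "\<And>n. z n \<in> convex hull ((\<lambda>n. (p n, m n)) ` {n..})" "pair.Cauchy_seq z"
    using pair.Cauchy_convex_combinations[of "\<lambda>n. (p n, m n)" "sqrt (2 * K\<^sup>2)"] pm by auto
  have zD: "fst (z n) \<in> D" "snd (z n) \<in> D" for n
  proof -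
    have "convex hull ((\<lambda>n. (p n, m n)) ` {n..}) \<subseteq> D \<times> D"
      using pm subspace_imp_convex[OF pair.subspace] by (intro hull_minimal) auto
    then show "fst (z n) \<in> D" "snd (z n) \<in> D" using z(1)[of n] by auto
  qed
  have fst_le: "form.seminorm (fst a) \<le> pair.seminorm a" "form.seminorm (snd a) \<le> pair.seminorm a"
    if "a \<in> D \<times> D" for a
    using that form.nonneg by (auto simp: form.seminorm_def pair.seminorm_def P_def)
  have C1: "form.Cauchy_seq (\<lambda>n. fst (z n))" and C2: "form.Cauchy_seq (\<lambda>n. snd (z n))"
    using z(2) fst_le[of "z i - z j" for i j] zD unfolding form.Cauchy_seq_def pair.Cauchy_seq_def
    by (simp_all add: mem_Times_iff) (meson le_less_trans)+
  \<comment> \<open>Applied to evaluation at a point, which is linear: pointwise limits survive the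
    passage to the hulls of the tails, as do signs in \<open>hull_nonneg\<close>.\<close>
  have hull_lim: "(\<lambda>n. \<phi> (z n)) \<longlonglongrightarrow> 0"
    if \<phi>: "linear \<phi>" and l: "(\<lambda>n. \<phi> (p n, m n)) \<longlonglongrightarrow> 0" for \<phi> :: "('a \<Rightarrow> real) \<times> ('a \<Rightarrow> real) \<Rightarrow> real"
  proof (rule LIMSEQ_I)
    fix r :: real assume r: "r > 0"
    obtain N where N: "\<And>n. n \<ge> N \<Longrightarrow> \<bar>\<phi> (p n, m n)\<bar> < r / 2"
      using LIMSEQ_D[OF l, of "r/2"] r by auto
    have "\<bar>\<phi> (z n)\<bar> < r" if "n \<ge> N" for n
    proof -
      have "\<phi> (p k, m k) \<in> {- r / 2 .. r / 2}" if "k \<ge> n" for k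
        using N[of k] that \<open>n \<ge> N\<close> by auto
      then have "convex hull ((\<lambda>n. (p n, m n)) ` {n..}) \<subseteq> \<phi> -` {- r / 2 .. r / 2}"
        by (intro hull_minimal convex_linear_vimage \<phi> convex_real_interval) blast
      then have "\<phi> (z n) \<in> {- r / 2 .. r / 2}" using z(1)[of n] by blast
      then show ?thesis using r by auto
    qed
    then show "\<exists>N. \<forall>n\<ge>N. norm (\<phi> (z n) - 0) < r" by auto
  qed
  have hull_nonneg: "0 \<le> \<phi> (z n)"
    if \<phi>: "linear \<phi>" and l: "\<And>n. 0 \<le> \<phi> (p n, m n)" for \<phi> :: "('a \<Rightarrow> real) \<times> ('a \<Rightarrow> real) \<Rightarrow> real" and n
  proof -
    have "convex hull ((\<lambda>n. (p n, m n)) ` {n..}) \<subseteq> \<phi> -` {0..}"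
      using l by (intro hull_minimal convex_linear_vimage \<phi>) auto
    then show ?thesis using z(1)[of n] by blast
  qed
  have lin: "linear (\<lambda>a. fst a x)" "linear (\<lambda>a. snd a x)" for x :: 'a
    by (auto intro!: linearI)
  have f0: "(\<lambda>n. form.seminorm (fst (z n))) \<longlonglongrightarrow> 0"
  proof (rule Cauchy_null_nonneg[OF zD(1) _ C1])
    show "AE x in M. 0 \<le> fst (z n) x" for n
      using hull_nonneg[OF lin(1)] by (simp add: p_def)
    show "AE x in M. (\<lambda>n. fst (z n) x) \<longlonglongrightarrow> 0" using lim
    proof eventually_elim
      case (elim x)
      show ?case using tendsto_max[OF elim tendsto_const[of 0]] by (intro hull_lim[OF lin(1)]) (simp add: p_def)
    qed
  qed
  have s0: "(\<lambda>n. form.seminorm (snd (z n))) \<longlonglongrightarrow> 0"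
  proof (rule Cauchy_null_nonneg[OF zD(2) _ C2])
    show "AE x in M. 0 \<le> snd (z n) x" for n
      using hull_nonneg[OF lin(2)] by (simp add: m_def)
    show "AE x in M. (\<lambda>n. snd (z n) x) \<longlonglongrightarrow> 0" using lim
    proof eventually_elim
      case (elim x)
      show ?case using tendsto_max[OF tendsto_minus[OF elim] tendsto_const[of 0]]
        by (intro hull_lim[OF lin(2)]) (simp add: m_def)
    qed
  qed
  show ?thesis
  proof (rule LIMSEQ_I)
    fix r :: real assume r: "r > 0"
    obtain N where N: "\<forall>m\<ge>N. \<forall>n\<ge>N. form.seminorm (w m - w n) < r/2"
      using C r unfolding form.Cauchy_seq_def by (meson half_gt_zero)
    obtain N1 where N1: "\<And>n. n \<ge> N1 \<Longrightarrow> form.seminorm (fst (z n)) < r/4"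
      using order_tendstoD(2)[OF f0, of "r/4"] r by (auto simp: eventually_sequentially)
    obtain N2 where N2: "\<And>n. n \<ge> N2 \<Longrightarrow> form.seminorm (snd (z n)) < r/4"
      using order_tendstoD(2)[OF s0, of "r/4"] r by (auto simp: eventually_sequentially)
    show "\<exists>N. \<forall>n\<ge>N. norm (form.seminorm (w n) - 0) < r"
    proof (intro exI[of _ "max N (max N1 N2)"] allI impI)
      fix n assume n: "max N (max N1 N2) \<le> n"
      \<comment> \<open>The preimage of a ball around \<open>w n\<close> under the difference map.
        It is convex and contains every pair with index at least \<open>n\<close>, hence also
        \<open>z n\<close>; so \<open>w n\<close> is close to a difference whose two terms have
        small energy.\<close>
      let ?S = "(\<lambda>a. fst a - snd a) -` {v \<in> D. form.seminorm (v - w n) \<le> r/2}"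
      have "convex hull ((\<lambda>n. (p n, m n)) ` {n..}) \<subseteq> ?S"
      proof (rule hull_minimal)
        show "(\<lambda>n. (p n, m n)) ` {n..} \<subseteq> ?S"
        proof safe
          fix k assume "k \<ge> n"
          then have "form.seminorm (w k - w n) \<le> r/2" using N n by (simp add: less_imp_le)
          then show "(p k, m k) \<in> ?S" using w[of k] by (simp add: w_eq[of k])
        qed
        show "convex ?S"
          using w by (intro convex_linear_vimage form.convex_seminorm_ball linear_compose_sub linear_fst linear_snd)
      qed
      from subsetD[OF this z(1)[of n]]
      have "form.seminorm (fst (z n) - snd (z n) - w n) \<le> r/2" by simp
      moreover have "form.seminorm (w n) \<le> form.seminorm (w n - (fst (z n) - snd (z n))) + form.seminorm (fst (z n) - snd (z n))"
        using form.seminorm_add[of "w n - (fst (z n) - snd (z n))" "fst (z n) - snd (z n)"] w zD by simp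
      moreover have "form.seminorm (w n - (fst (z n) - snd (z n))) = form.seminorm (fst (z n) - snd (z n) - w n)"
        using w zD by (intro form.seminorm_commute) auto
      moreover have "form.seminorm (fst (z n) - snd (z n)) \<le> form.seminorm (fst (z n)) + form.seminorm (snd (z n))"
        using zD by (intro form.seminorm_diff)
      moreover have "form.seminorm (fst (z n)) < r/4" "form.seminorm (snd (z n)) < r/4" using N1 N2 n by auto
      ultimately show "norm (form.seminorm (w n) - 0) < r" using form.seminorm_nonneg[OF w[of n]] by simp
    qed
  qed
qed

text \<open>Local convergence in measure provides a.e. convergence along a subsequence only. The
  seminorms of a Cauchy sequence converge, so a subsequence determines their limit.\<close>

lemma Cauchy_null_subseq:
  assumes w: "\<And>n. w n \<in> D" and C: "form.Cauchy_seq w" and s: "strict_mono s"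
    and lim: "AE x in M. (\<lambda>n. w (s n) x) \<longlonglongrightarrow> 0"
  shows "(\<lambda>n. form.seminorm (w n)) \<longlonglongrightarrow> 0"
proof -
  have "form.Cauchy_seq (\<lambda>n. w (s n))"
    using C seq_suble[OF s] unfolding form.Cauchy_seq_def by (meson order_trans)
  then have "(\<lambda>n. form.seminorm (w (s n))) \<longlonglongrightarrow> 0" using Cauchy_null[OF w _ lim] by blast
  moreover obtain L where L: "(\<lambda>n. form.seminorm (w n)) \<longlonglongrightarrow> L"
    using form.Cauchy_seq_energy[OF C w] Cauchy_convergent_iff convergent_def by blast
  moreover have "(\<lambda>n. form.seminorm (w (s n))) \<longlonglongrightarrow> L"
    using LIMSEQ_subseq_LIMSEQ[OF L s] by (simp add: o_def)
  ultimately show ?thesis using LIMSEQ_unique by blast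
qed

lemma form_Cauchy_iff:
  assumes "\<And>n. u n \<in> D"
  shows "form_Cauchy q u \<longleftrightarrow> form.Cauchy_seq u"
proof -
  have q: "q (\<lambda>x. u m x - u n x) = ennreal ((form.seminorm (u m - u n))\<^sup>2)" for m n
  proof -
    have "(\<lambda>x. u m x - u n x) = u m - u n" by (simp add: fun_eq_iff)
    then show ?thesis using q_eq[of "u m - u n"] assms by (simp add: form.seminorm_sq)
  qed
  have nn: "0 \<le> form.seminorm (u m - u n)" for m n using assms by (simp add: form.seminorm_nonneg)
  show ?thesis
  proof
    assume C: "form_Cauchy q u"
    show "form.Cauchy_seq u" unfolding form.Cauchy_seq_def
    proof (intro allI impI)
      fix e :: real assume "e > 0"
      then obtain N where "\<forall>m\<ge>N. \<forall>n\<ge>N. q (\<lambda>x. u m x - u n x) < ennreal (e\<^sup>2)"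
        using C unfolding form_Cauchy_def by (metis ennreal_less_zero_iff zero_less_power)
      then show "\<exists>N. \<forall>m\<ge>N. \<forall>n\<ge>N. form.seminorm (u m - u n) < e"
        using \<open>e > 0\<close> by (intro exI[of _ N]) (auto simp: q ennreal_less_iff intro: power2_less_imp_less)
    qed
  next
    assume C: "form.Cauchy_seq u"
    show "form_Cauchy q u" unfolding form_Cauchy_def
    proof (intro allI impI)
      fix e :: ennreal assume "e > 0"
      then obtain r where r: "r > 0" "ennreal r < e"
        by (metis ennreal_less_zero_iff dense ennreal_cases less_top_ennreal order_less_trans top.not_eq_extremum)
      then obtain N where N: "\<forall>m\<ge>N. \<forall>n\<ge>N. form.seminorm (u m - u n) < sqrt r"
        using C unfolding form.Cauchy_seq_def by (meson real_sqrt_gt_zero)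
      show "\<exists>N. \<forall>m\<ge>N. \<forall>n\<ge>N. q (\<lambda>x. u m x - u n x) < e"
      proof (intro exI[of _ N] allI impI)
        fix m n assume "N \<le> m" "N \<le> n"
        then have "(form.seminorm (u m - u n))\<^sup>2 < (sqrt r)\<^sup>2"
          using N nn by (intro power_strict_mono) auto
        then have "ennreal ((form.seminorm (u m - u n))\<^sup>2) < ennreal r" using r by (simp add: ennreal_less_iff)
        then show "q (\<lambda>x. u m x - u n x) < e" using r by (simp add: q)
      qed
    qed
  qed
qed

end

section \<open>Local convergence in measure versus a.e. convergence of subsequences\<close>

lemma tendsto_locally_in_measure_AE:
  assumes "AE x in M. (\<lambda>n. u n x) \<longlonglongrightarrow> f x"
  shows "tendsto_locally_in_measure M u f"
  unfolding tendsto_locally_in_measure_def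
proof (intro allI impI exI[of _ id] conjI)
  fix r :: "nat \<Rightarrow> nat" assume r: "strict_mono r"
  show "AE x in M. (\<lambda>n. u (r (id n)) x) \<longlonglongrightarrow> f x" using assms
  proof eventually_elim
    case (elim x)
    show ?case using LIMSEQ_subseq_LIMSEQ[OF elim r] by (simp add: o_def)
  qed
qed (simp add: strict_mono_id)

lemma tendsto_locally_in_measure_subseq:
  assumes "tendsto_locally_in_measure M u f"
  obtains s where "strict_mono s" "AE x in M. (\<lambda>n. u (s n) x) \<longlonglongrightarrow> f x"
  using assms[unfolded tendsto_locally_in_measure_def, rule_format, of id] by (auto simp: strict_mono_id)

lemma tendsto_locally_in_measure_subseq2:
  assumes "tendsto_locally_in_measure M u f" "tendsto_locally_in_measure M v g"
  obtains s where "strict_mono s" "AE x in M. (\<lambda>n. u (s n) x) \<longlonglongrightarrow> f x" "AE x in M. (\<lambda>n. v (s n) x) \<longlonglongrightarrow> g x"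
proof -
  obtain s where s: "strict_mono s" "AE x in M. (\<lambda>n. u (s n) x) \<longlonglongrightarrow> f x"
    using tendsto_locally_in_measure_subseq[OF assms(1)] .
  obtain t where t: "strict_mono t" "AE x in M. (\<lambda>n. v (s (t n)) x) \<longlonglongrightarrow> g x"
    using assms(2) s(1) unfolding tendsto_locally_in_measure_def by blast
  show ?thesis
  proof (rule that[of "s \<circ> t"])
    show "strict_mono (s \<circ> t)" using s t by (simp add: strict_mono_o)
    show "AE x in M. (\<lambda>n. u ((s \<circ> t) n) x) \<longlonglongrightarrow> f x" using s(2)
    proof eventually_elim
      case (elim x)
      show ?case using LIMSEQ_subseq_LIMSEQ[OF elim t(1)] by (simp add: o_def)
    qed
    show "AE x in M. (\<lambda>n. v ((s \<circ> t) n) x) \<longlonglongrightarrow> g x" using t by simp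
  qed
qed

context positivity_preserving_form
begin

lemma approximates_L0_D:
  assumes "approximates_L0 M q u f"
  shows "u n \<in> D" "form.Cauchy_seq u" "tendsto_locally_in_measure M u f"
  using assms form_Cauchy_iff[of u] unfolding approximates_L0_def by auto

lemma approximates_L0_I:
  assumes "\<And>n. u n \<in> D" "form.Cauchy_seq u" "AE x in M. (\<lambda>n. u n x) \<longlonglongrightarrow> f x"
  shows "approximates_L0 M q u f"
  using assms form_Cauchy_iff[of u] unfolding approximates_L0_def by (auto intro: tendsto_locally_in_measure_AE)

lemma approximates_L0_diff_null:
  assumes u: "approximates_L0 M q u f" and v: "approximates_L0 M q v f"
  shows "(\<lambda>n. form.seminorm (u n - v n)) \<longlonglongrightarrow> 0"
proof -
  note uD = approximates_L0_D[OF u] and vD = approximates_L0_D[OF v]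
  obtain s where s: "strict_mono s" "AE x in M. (\<lambda>n. u (s n) x) \<longlonglongrightarrow> f x" "AE x in M. (\<lambda>n. v (s n) x) \<longlonglongrightarrow> f x"
    using tendsto_locally_in_measure_subseq2[OF uD(3) vD(3)] .
  show ?thesis
  proof (rule Cauchy_null_subseq[OF _ _ s(1)])
    show "u n - v n \<in> D" for n using uD vD by simp
    show "AE x in M. (\<lambda>n. (u (s n) - v (s n)) x) \<longlonglongrightarrow> 0" using s(2,3)
    proof eventually_elim
      case (elim x)
      show ?case using tendsto_diff[OF elim] by simp
    qed
    show "form.Cauchy_seq (\<lambda>n. u n - v n)" unfolding form.Cauchy_seq_def
    proof (intro allI impI)
      fix e :: real assume e: "e > 0"
      obtain N1 where N1: "\<forall>m\<ge>N1. \<forall>n\<ge>N1. form.seminorm (u m - u n) < e/2"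
        using uD(2) e unfolding form.Cauchy_seq_def by (meson half_gt_zero)
      obtain N2 where N2: "\<forall>m\<ge>N2. \<forall>n\<ge>N2. form.seminorm (v m - v n) < e/2"
        using vD(2) e unfolding form.Cauchy_seq_def by (meson half_gt_zero)
      show "\<exists>N. \<forall>m\<ge>N. \<forall>n\<ge>N. form.seminorm (u m - v m - (u n - v n)) < e"
      proof (intro exI[of _ "max N1 N2"] allI impI)
        fix m n assume mn: "max N1 N2 \<le> m" "max N1 N2 \<le> n"
        have "u m - v m - (u n - v n) = (u m - u n) - (v m - v n)" by simp
        then have "form.seminorm (u m - v m - (u n - v n)) \<le> form.seminorm (u m - u n) + form.seminorm (v m - v n)"
          using uD vD form.seminorm_diff[of "u m - u n" "v m - v n"] by (simp only: form.D_diff)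
        also have "\<dots> < e" using N1[rule_format, of m n] N2[rule_format, of m n] mn by simp
        finally show "form.seminorm (u m - v m - (u n - v n)) < e" .
      qed
    qed
  qed
qed

text \<open>Supplies the uniqueness that the definite description in \<open>extended_form\<close>
  relies on: two approximating sequences differ by a sequence of vanishing energy, so their energies
  have the same limit.\<close>

lemma extended_form_tendsto:
  assumes u: "approximates_L0 M q u f"
  shows "(\<lambda>n. q (u n)) \<longlonglongrightarrow> extended_form M q f" "extended_form M q f < \<infinity>"
proof -
  have q: "q (v n) = ennreal ((form.seminorm (v n))\<^sup>2)" if "approximates_L0 M q v f" for v n
    using q_eq[OF approximates_L0_D(1)[OF that]] approximates_L0_D(1)[OF that] by (simp add: form.seminorm_sq)
  obtain L where L: "(\<lambda>n. form.seminorm (u n)) \<longlonglongrightarrow> L"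
    using form.Cauchy_seq_energy[OF approximates_L0_D(2)[OF u] approximates_L0_D(1)[OF u]]
      Cauchy_convergent_iff convergent_def by blast
  have lim: "(\<lambda>n. q (v n)) \<longlonglongrightarrow> ennreal (L\<^sup>2)" if v: "approximates_L0 M q v f" for v
  proof -
    have "(\<lambda>n. form.seminorm (v n)) \<longlonglongrightarrow> L"
    proof (rule Lim_transform2[OF L], rule Lim_null_comparison[OF _ approximates_L0_diff_null[OF u v]])
      show "\<forall>\<^sub>F n in sequentially. norm (form.seminorm (u n) - form.seminorm (v n)) \<le> form.seminorm (u n - v n)"
        using form.seminorm_abs_diff[OF approximates_L0_D(1)[OF u] approximates_L0_D(1)[OF v]] by simp
    qed
    then show ?thesis unfolding q[OF v] by (intro tendsto_intros)
  qed
  have "extended_form M q f = ennreal (L\<^sup>2)"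
    unfolding extended_form_def using u lim by (auto intro!: the_equality dest: LIMSEQ_unique)
  then show "(\<lambda>n. q (u n)) \<longlonglongrightarrow> extended_form M q f" "extended_form M q f < \<infinity>" using lim[OF u] by auto
qed

lemma extended_form_eq:
  assumes "f \<in> D"
  shows "extended_form M q f = q f"
proof -
  have "approximates_L0 M q (\<lambda>n. f) f"
    using assms by (intro approximates_L0_I) (auto simp: form.Cauchy_seq_def form.seminorm_def)
  from LIMSEQ_unique[OF extended_form_tendsto(1)[OF this] tendsto_const] show ?thesis .
qed

lemma Cauchy_seq_null:
  assumes "\<And>n. u n \<in> D" "(\<lambda>n. B (u n) (u n)) \<longlonglongrightarrow> 0"
  shows "form.Cauchy_seq u"
  unfolding form.Cauchy_seq_def
proof (intro allI impI)
  fix e :: real assume "e > 0"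
  moreover have "(\<lambda>n. form.seminorm (u n)) \<longlonglongrightarrow> 0" using assms form.tendsto_energy_zero_iff by blast
  ultimately obtain N where N: "\<And>n. n \<ge> N \<Longrightarrow> form.seminorm (u n) < e / 2"
    using order_tendstoD(2)[of _ 0 sequentially "e/2"] by (auto simp: eventually_sequentially)
  show "\<exists>N. \<forall>m\<ge>N. \<forall>n\<ge>N. form.seminorm (u m - u n) < e"
    using N form.seminorm_diff[OF assms(1) assms(1)] by (intro exI[of _ N] allI impI) (smt (verit) field_sum_of_halves)
qed

text \<open>A sequence of vanishing energy is automatically Cauchy, and a subsequence of an
  approximating sequence converges a.e. This gives access to the kernel without the definite
  description.\<close>

lemma extended_form_zero_iff:
  "extended_form M q f = 0 \<longleftrightarrow>
    (\<exists>u. (\<forall>n. u n \<in> D) \<and> (\<lambda>n. B (u n) (u n)) \<longlonglongrightarrow> 0 \<and> (AE x in M. (\<lambda>n. u n x) \<longlonglongrightarrow> f x))"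
proof
  assume 0: "extended_form M q f = 0"
  then obtain u where u: "approximates_L0 M q u f"
    by (auto simp: extended_form_def split: if_splits)
  obtain s where s: "strict_mono s" "AE x in M. (\<lambda>n. u (s n) x) \<longlonglongrightarrow> f x"
    using tendsto_locally_in_measure_subseq[OF approximates_L0_D(3)[OF u]] .
  have "(\<lambda>n. ennreal (B (u n) (u n))) \<longlonglongrightarrow> ennreal 0"
    using extended_form_tendsto(1)[OF u] 0 approximates_L0_D(1)[OF u] by (simp add: q_eq)
  then have "(\<lambda>n. B (u n) (u n)) \<longlonglongrightarrow> 0"
    using approximates_L0_D(1)[OF u] by (subst (asm) tendsto_ennreal_iff) (auto simp: form.nonneg)
  from LIMSEQ_subseq_LIMSEQ[OF this s(1)] have "(\<lambda>n. B (u (s n)) (u (s n))) \<longlonglongrightarrow> 0"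
    by (simp add: o_def)
  then show "\<exists>u. (\<forall>n. u n \<in> D) \<and> (\<lambda>n. B (u n) (u n)) \<longlonglongrightarrow> 0 \<and> (AE x in M. (\<lambda>n. u n x) \<longlonglongrightarrow> f x)"
    using s(2) approximates_L0_D(1)[OF u] by (intro exI[of _ "\<lambda>n. u (s n)"] conjI) auto
next
  assume "\<exists>u. (\<forall>n. u n \<in> D) \<and> (\<lambda>n. B (u n) (u n)) \<longlonglongrightarrow> 0 \<and> (AE x in M. (\<lambda>n. u n x) \<longlonglongrightarrow> f x)"
  then obtain u where u: "\<And>n. u n \<in> D" "(\<lambda>n. B (u n) (u n)) \<longlonglongrightarrow> 0" "AE x in M. (\<lambda>n. u n x) \<longlonglongrightarrow> f x" by blast
  have "(\<lambda>n. q (u n)) \<longlonglongrightarrow> extended_form M q f"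
    using extended_form_tendsto(1)[OF approximates_L0_I[OF u(1) Cauchy_seq_null[OF u(1,2)] u(3)]] .
  moreover have "(\<lambda>n. q (u n)) \<longlonglongrightarrow> ennreal 0"
    using u(1) tendsto_ennrealI[OF u(2)] by (simp add: q_eq)
  ultimately show "extended_form M q f = 0" using LIMSEQ_unique by fastforce
qed

text \<open>Nonnegativity is asked for at every point, not just a.e., so that truncations and minima
  can be computed pointwise. Nothing is lost: absolute values have no larger energy and the same
  limit.\<close>

definition null_limit :: "('a \<Rightarrow> ennreal) \<Rightarrow> bool" where
  "null_limit f \<longleftrightarrow> f \<in> Lplus_functions M \<and> (\<exists>u. (\<forall>n. u n \<in> D) \<and> (\<forall>n x. 0 \<le> u n x) \<and>
     (\<lambda>n. B (u n) (u n)) \<longlonglongrightarrow> 0 \<and> (AE x in M. (\<lambda>n. ennreal (u n x)) \<longlonglongrightarrow> f x))"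

lemma null_limit_imp_plus_form:
  assumes "null_limit f"
  shows "plus_form M q f = 0"
proof -
  obtain u where u: "\<And>n. u n \<in> D" "\<And>n x. 0 \<le> u n x" "(\<lambda>n. B (u n) (u n)) \<longlonglongrightarrow> 0"
    "AE x in M. (\<lambda>n. ennreal (u n x)) \<longlonglongrightarrow> f x"
    using assms unfolding null_limit_def by blast
  have "form_Cauchy (extended_form M q) u"
  proof -
    have "extended_form M q (\<lambda>x. u m x - u n x) = q (\<lambda>x. u m x - u n x)" for m n
    proof -
      have "(\<lambda>x. u m x - u n x) = u m - u n" by (simp add: fun_eq_iff)
      then show ?thesis using u extended_form_eq[of "u m - u n"] by simp
    qed
    then show ?thesis using Cauchy_seq_null[OF u(1,3)] form_Cauchy_iff[OF u(1)] by (simp add: form_Cauchy_def)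
  qed
  moreover have "u n \<in> form_domain (L0_functions M) (extended_form M q)" for n
    using u(1)[of n] extended_form_eq[of "u n"] q_eq[of "u n"] unfolding form_domain_def by simp
  ultimately have ap: "approximates_Lplus M q u f"
    using u unfolding approximates_Lplus_def by (auto intro!: tendsto_locally_in_measure_AE)
  have "(\<lambda>n. extended_form M q (u n)) \<longlonglongrightarrow> 0"
    using u(1) tendsto_ennrealI[OF u(3)] by (simp add: q_eq extended_form_eq)
  then have "0 \<in> {l. \<exists>u. approximates_Lplus M q u f \<and> (\<lambda>n. extended_form M q (u n)) \<longlonglongrightarrow> l}" using ap by blast
  then have "Inf {l. \<exists>u. approximates_Lplus M q u f \<and> (\<lambda>n. extended_form M q (u n)) \<longlonglongrightarrow> l} \<le> 0" by (rule Inf_lower)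
  then show ?thesis unfolding plus_form_def using ap by auto
qed

end

text \<open>A homeomorphism of [0, \<infinity>] onto [0, 1] that sends \<infinity> to 0. It turns
  convergence in [0, \<infinity>] into convergence of bounded reals, to which L1 methods
  apply.\<close>

definition bounded_transform :: "ennreal \<Rightarrow> real" where
  "bounded_transform x = enn2real (inverse (1 + x))"

lemma inverse_1_plus_lt_top: "inverse (1 + x :: ennreal) < top"
  using ennreal_inverse_eq_top_iff[of "1 + x"] by (auto simp: less_top[symmetric])

lemma bounded_transform_bounds: "0 \<le> bounded_transform x" "bounded_transform x \<le> 1"
proof -
  have "inverse (1 + x) \<le> 1"
  proof (cases x)
    case (real r)
    then have "1 + x = ennreal (1 + r)" by simp
    then show ?thesis using real by (simp add: inverse_ennreal inverse_le_1_iff del: ennreal_plus)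
  qed simp
  then show "bounded_transform x \<le> 1" unfolding bounded_transform_def by (intro enn2real_leI) auto
qed (simp add: bounded_transform_def)

lemma bounded_transform_measurable [measurable]: "bounded_transform \<in> borel_measurable borel"
  unfolding bounded_transform_def by measurable

lemma tendsto_inverse_ennreal:
  fixes f :: "nat \<Rightarrow> ennreal"
  assumes "f \<longlonglongrightarrow> l"
  shows "(\<lambda>n. inverse (f n)) \<longlonglongrightarrow> inverse l"
  using continuous_on_tendsto_compose[OF continuous_on_inverse_ennreal[OF continuous_on_id] assms, of UNIV] by simp

lemma tendsto_bounded_transform_iff:
  fixes f :: "nat \<Rightarrow> ennreal"
  shows "(\<lambda>n. bounded_transform (f n)) \<longlonglongrightarrow> bounded_transform l \<longleftrightarrow> f \<longlonglongrightarrow> l"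
proof
  assume "f \<longlonglongrightarrow> l"
  then have "(\<lambda>n. inverse (1 + f n)) \<longlonglongrightarrow> inverse (1 + l)"
    by (intro tendsto_inverse_ennreal tendsto_add tendsto_const)
  then show "(\<lambda>n. bounded_transform (f n)) \<longlonglongrightarrow> bounded_transform l"
    unfolding bounded_transform_def using inverse_1_plus_lt_top[of l]
    by (intro tendsto_enn2real) simp_all
next
  assume "(\<lambda>n. bounded_transform (f n)) \<longlonglongrightarrow> bounded_transform l"
  then have "(\<lambda>n. ennreal (bounded_transform (f n))) \<longlonglongrightarrow> ennreal (bounded_transform l)" by (rule tendsto_ennrealI)
  then have "(\<lambda>n. inverse (1 + f n)) \<longlonglongrightarrow> inverse (1 + l)"
    by (simp add: bounded_transform_def inverse_1_plus_lt_top)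
  then have "(\<lambda>n. inverse (inverse (1 + f n))) \<longlonglongrightarrow> inverse (inverse (1 + l))" by (rule tendsto_inverse_ennreal)
  moreover have "inverse (inverse x) = x" for x :: ennreal
    by (cases x; cases "x = 0") (auto simp: inverse_ennreal)
  ultimately have "(\<lambda>n. 1 + f n) \<longlonglongrightarrow> 1 + l" by simp
  then have "(\<lambda>n. (1 + f n) - 1) \<longlonglongrightarrow> (1 + l) - 1" by (intro tendsto_diff_ennreal_general tendsto_const) auto
  then show "f \<longlonglongrightarrow> l" by simp
qed

section \<open>Null limits and truncation\<close>

text \<open>This makes diagonal sequences available for local convergence in measure.\<close>

lemma (in sigma_finite_measure) Lplus_metric:
  obtains \<rho> :: "('a \<Rightarrow> ennreal) \<Rightarrow> ('a \<Rightarrow> ennreal) \<Rightarrow> real" where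
    "\<And>f g. 0 \<le> \<rho> f g"
    "\<And>f g h. f \<in> borel_measurable M \<Longrightarrow> g \<in> borel_measurable M \<Longrightarrow> h \<in> borel_measurable M \<Longrightarrow>
      \<rho> f h \<le> \<rho> f g + \<rho> g h"
    "\<And>u f. (\<And>n. u n \<in> borel_measurable M) \<Longrightarrow> f \<in> borel_measurable M \<Longrightarrow>
      (AE x in M. (\<lambda>n. u n x) \<longlonglongrightarrow> f x) \<Longrightarrow> (\<lambda>n. \<rho> (u n) f) \<longlonglongrightarrow> 0"
    "\<And>u f. (\<And>n. u n \<in> borel_measurable M) \<Longrightarrow> f \<in> borel_measurable M \<Longrightarrow>
      (\<lambda>n. \<rho> (u n) f) \<longlonglongrightarrow> 0 \<Longrightarrow> \<exists>s. strict_mono s \<and> (AE x in M. (\<lambda>n. u (s n) x) \<longlonglongrightarrow> f x)"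
proof -
  \<comment> \<open>The weight replaces the \<sigma>-finite measure by a finite one with the same
    null sets; \<rho> is the L1 distance of the bounded transforms for that measure.\<close>
  obtain w :: "'a \<Rightarrow> real" where w [measurable]: "w \<in> borel_measurable M"
    and w_pos: "\<And>x. w x > 0" and w_int: "integrable M w"
    using obtain_positive_integrable_function by metis
  let ?d = "\<lambda>f g x. (bounded_transform (f x) - bounded_transform (g x)) * w x"
  define \<rho> where "\<rho> f g = (\<integral>x. norm (?d f g x) \<partial>M)" for f g
  have d_le: "norm (?d f g x) \<le> w x" for f g x
  proof -
    have "\<bar>bounded_transform (f x) - bounded_transform (g x)\<bar> \<le> 1"
      using bounded_transform_bounds[of "f x"] bounded_transform_bounds[of "g x"] by linarith
    then have "\<bar>bounded_transform (f x) - bounded_transform (g x)\<bar> * w x \<le> 1 * w x"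
      using w_pos[of x] by (intro mult_right_mono) auto
    then show ?thesis using w_pos[of x] by (simp add: abs_mult)
  qed
  have int: "integrable M (?d f g)" if [measurable]: "f \<in> borel_measurable M" "g \<in> borel_measurable M" for f g
    using d_le w_pos by (intro Bochner_Integration.integrable_bound[OF w_int]) (auto simp: less_imp_le)
  show ?thesis
  proof (rule that[of \<rho>])
    show "0 \<le> \<rho> f g" for f g unfolding \<rho>_def by simp
    show "\<rho> f h \<le> \<rho> f g + \<rho> g h"
      if "f \<in> borel_measurable M" "g \<in> borel_measurable M" "h \<in> borel_measurable M" for f g h
    proof -
      have "\<rho> f h \<le> (\<integral>x. norm (?d f g x) + norm (?d g h x) \<partial>M)"
        unfolding \<rho>_def
      proof (rule integral_mono)
        show "norm (?d f h x) \<le> norm (?d f g x) + norm (?d g h x)" for x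
          using norm_triangle_ineq[of "?d f g x" "?d g h x"] by (simp add: algebra_simps)
      qed (use that in \<open>auto intro!: int integrable_norm Bochner_Integration.integrable_add\<close>)
      also have "\<dots> = \<rho> f g + \<rho> g h"
        unfolding \<rho>_def using that by (intro Bochner_Integration.integral_add integrable_norm int)
      finally show ?thesis .
    qed
    show "(\<lambda>n. \<rho> (u n) f) \<longlonglongrightarrow> 0"
      if [measurable]: "\<And>n. u n \<in> borel_measurable M" "f \<in> borel_measurable M"
      and lim: "AE x in M. (\<lambda>n. u n x) \<longlonglongrightarrow> f x" for u f
    proof -
      have "(\<lambda>n. \<integral>x. norm (?d (u n) f x) \<partial>M) \<longlonglongrightarrow> (\<integral>x. 0 \<partial>M)"
      proof (rule integral_dominated_convergence[OF _ _ w_int])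
        show "AE x in M. (\<lambda>n. norm (?d (u n) f x)) \<longlonglongrightarrow> 0" using lim
        proof eventually_elim
          case (elim x)
          have "(\<lambda>n. ?d (u n) f x) \<longlonglongrightarrow> (bounded_transform (f x) - bounded_transform (f x)) * w x"
            using elim by (intro tendsto_intros) (simp add: tendsto_bounded_transform_iff)
          then have "(\<lambda>n. ?d (u n) f x) \<longlonglongrightarrow> 0" by simp
          then show ?case by (rule tendsto_norm_zero)
        qed
        show "AE x in M. norm (norm (?d (u n) f x)) \<le> w x" for n using d_le by simp
      qed simp_all
      then show ?thesis by (simp add: \<rho>_def)
    qed
    show "\<exists>s. strict_mono s \<and> (AE x in M. (\<lambda>n. u (s n) x) \<longlonglongrightarrow> f x)"
      if u: "\<And>n. u n \<in> borel_measurable M" "f \<in> borel_measurable M"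
      and lim: "(\<lambda>n. \<rho> (u n) f) \<longlonglongrightarrow> 0" for u f
    proof -
      obtain s where s: "strict_mono s" "AE x in M. (\<lambda>n. ?d (u (s n)) f x) \<longlonglongrightarrow> 0"
        using tendsto_L1_AE_subseq[OF int[OF u] lim[unfolded \<rho>_def]] by blast
      have "AE x in M. (\<lambda>n. u (s n) x) \<longlonglongrightarrow> f x" using s(2)
      proof eventually_elim
        case (elim x)
        have "(\<lambda>n. ?d (u (s n)) f x / w x) \<longlonglongrightarrow> 0 / w x"
          using w_pos[of x] by (intro tendsto_divide elim tendsto_const) simp
        then have "(\<lambda>n. bounded_transform (u (s n) x) - bounded_transform (f x)) \<longlonglongrightarrow> 0"
          using w_pos[of x] by (simp add: less_imp_neq[symmetric])
        then have "(\<lambda>n. bounded_transform (u (s n) x)) \<longlonglongrightarrow> bounded_transform (f x)" by (rule LIM_zero_cancel)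
        then show ?case by (simp add: tendsto_bounded_transform_iff)
      qed
      then show ?thesis using s(1) by blast
    qed
  qed
qed

locale sigma_finite_form = positivity_preserving_form M q + sigma_finite_measure M
  for M :: "'a measure" and q
begin

text \<open>Three limits are nested in \<open>plus_form\<close>: the infimum, the approximation of
  \<open>f\<close> by functions of finite extended energy, and the approximation of those by
  elements of \<open>D\<close>. The metric \<rho> makes each of them quantitative, so that a single
  element of \<open>D\<close> with small energy can be picked near \<open>f\<close> for every
  tolerance.\<close>

lemma plus_form_zero_iff:
  assumes f: "f \<in> Lplus_functions M"
  shows "plus_form M q f = 0 \<longleftrightarrow> null_limit f"
proof
  assume 0: "plus_form M q f = 0"
  obtain \<rho> where \<rho>_nonneg: "\<And>f g. 0 \<le> \<rho> f g"
    and \<rho>_triangle: "\<And>f g h. f \<in> Lplus_functions M \<Longrightarrow> g \<in> Lplus_functions M \<Longrightarrow> h \<in> Lplus_functions M \<Longrightarrow>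
      (\<rho> f h :: real) \<le> \<rho> f g + \<rho> g h"
    and \<rho>_AE: "\<And>u f. (\<And>n. u n \<in> Lplus_functions M) \<Longrightarrow> f \<in> Lplus_functions M \<Longrightarrow>
      (AE x in M. (\<lambda>n. u n x) \<longlonglongrightarrow> f x) \<Longrightarrow> (\<lambda>n. \<rho> (u n) f) \<longlonglongrightarrow> 0"
    and \<rho>_subseq: "\<And>u f. (\<And>n. u n \<in> Lplus_functions M) \<Longrightarrow> f \<in> Lplus_functions M \<Longrightarrow>
      (\<lambda>n. \<rho> (u n) f) \<longlonglongrightarrow> 0 \<Longrightarrow> \<exists>s. strict_mono s \<and> (AE x in M. (\<lambda>n. u (s n) x) \<longlonglongrightarrow> f x)"
    using Lplus_metric by blast
  have step1: "\<exists>v\<in>L0_functions M. (AE x in M. 0 \<le> v x) \<and> extended_form M q v < ennreal e \<and> \<rho> (\<lambda>x. ennreal (v x)) f < e"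
    if e: "e > 0" for e
  proof -
    have "Inf {l. \<exists>u. approximates_Lplus M q u f \<and> (\<lambda>n. extended_form M q (u n)) \<longlonglongrightarrow> l} < ennreal e"
      using 0 e by (auto simp: plus_form_def split: if_splits)
    then obtain l u where l: "l < ennreal e" and u: "approximates_Lplus M q u f"
      and lim: "(\<lambda>n. extended_form M q (u n)) \<longlonglongrightarrow> l"
      unfolding Inf_less_iff by blast
    obtain s where s: "strict_mono s" "AE x in M. (\<lambda>n. ennreal (u (s n) x)) \<longlonglongrightarrow> f x"
      using u tendsto_locally_in_measure_subseq unfolding approximates_Lplus_def by blast
    have um: "u n \<in> L0_functions M" "AE x in M. 0 \<le> u n x" for n
      using u unfolding approximates_Lplus_def form_domain_def by blast+
    have "(\<lambda>n. \<rho> (\<lambda>x. ennreal (u (s n) x)) f) \<longlonglongrightarrow> 0"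
      using f um s(2) by (intro \<rho>_AE) auto
    then have "\<forall>\<^sub>F n in sequentially. \<rho> (\<lambda>x. ennreal (u (s n) x)) f < e"
      using e by (rule order_tendstoD(2))
    moreover have "\<forall>\<^sub>F n in sequentially. extended_form M q (u (s n)) < ennreal e"
      using LIMSEQ_subseq_LIMSEQ[OF lim s(1)] l by (auto simp: o_def dest: order_tendstoD(2))
    ultimately have "\<forall>\<^sub>F n in sequentially. \<rho> (\<lambda>x. ennreal (u (s n) x)) f < e \<and> extended_form M q (u (s n)) < ennreal e"
      by eventually_elim simp
    then obtain n where "\<rho> (\<lambda>x. ennreal (u (s n) x)) f < e" "extended_form M q (u (s n)) < ennreal e"
      by (auto simp: eventually_sequentially)
    then show ?thesis using um[of "s n"] by blast
  qed
  have step2: "\<exists>w\<in>D. (\<forall>x. 0 \<le> w x) \<and> B w w < e \<and> \<rho> (\<lambda>x. ennreal (w x)) f < 2 * e" if e: "e > 0" for e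
  proof -
    obtain v where v: "v \<in> L0_functions M" "AE x in M. 0 \<le> v x" "extended_form M q v < ennreal e" "\<rho> (\<lambda>x. ennreal (v x)) f < e"
      using step1[OF e] by blast
    then have "extended_form M q v \<noteq> \<infinity>" by auto
    then obtain u where u: "approximates_L0 M q u v" by (auto simp: extended_form_def split: if_splits)
    note uD = approximates_L0_D(1)[OF u]
    obtain s where s: "strict_mono s" "AE x in M. (\<lambda>n. u (s n) x) \<longlonglongrightarrow> v x"
      using tendsto_locally_in_measure_subseq[OF approximates_L0_D(3)[OF u]] .
    let ?w = "\<lambda>n x. \<bar>u (s n) x\<bar>"
    have "(\<lambda>n. \<rho> (\<lambda>x. ennreal (?w n x)) (\<lambda>x. ennreal (v x))) \<longlonglongrightarrow> 0"
    proof (rule \<rho>_AE)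
      show "AE x in M. (\<lambda>n. ennreal (?w n x)) \<longlonglongrightarrow> ennreal (v x)" using s(2) v(2)
      proof eventually_elim
        case (elim x)
        show ?case using tendsto_ennrealI[OF tendsto_rabs[OF elim(1)]] elim(2) by simp
      qed
    qed (use v uD in auto)
    then have "\<forall>\<^sub>F n in sequentially. \<rho> (\<lambda>x. ennreal (?w n x)) (\<lambda>x. ennreal (v x)) < e"
      using e by (rule order_tendstoD(2))
    moreover have "\<forall>\<^sub>F n in sequentially. q (u (s n)) < ennreal e"
      using LIMSEQ_subseq_LIMSEQ[OF extended_form_tendsto(1)[OF u] s(1)] v(3) by (auto simp: o_def dest: order_tendstoD(2))
    ultimately have "\<forall>\<^sub>F n in sequentially. \<rho> (\<lambda>x. ennreal (?w n x)) (\<lambda>x. ennreal (v x)) < e \<and> q (u (s n)) < ennreal e"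
      by eventually_elim simp
    then obtain n where n: "\<rho> (\<lambda>x. ennreal (?w n x)) (\<lambda>x. ennreal (v x)) < e" "q (u (s n)) < ennreal e"
      by (auto simp: eventually_sequentially)
    have "B (u (s n)) (u (s n)) < e" using n(2) uD by (simp add: q_eq ennreal_less_iff form.nonneg)
    then have "B (?w n) (?w n) < e" using abs_D(2)[OF uD[of "s n"]] by simp
    moreover have "\<rho> (\<lambda>x. ennreal (?w n x)) f < 2 * e"
    proof -
      have "\<rho> (\<lambda>x. ennreal (?w n x)) f \<le> \<rho> (\<lambda>x. ennreal (?w n x)) (\<lambda>x. ennreal (v x)) + \<rho> (\<lambda>x. ennreal (v x)) f"
        using v(1) f uD by (intro \<rho>_triangle) auto
      then show ?thesis using n(1) v(4) by simp
    qed
    ultimately show ?thesis using abs_D(1)[OF uD[of "s n"]] by (intro bexI[of _ "?w n"]) auto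
  qed
  have "\<forall>n. \<exists>w. w \<in> D \<and> (\<forall>x. 0 \<le> w x) \<and> B w w < 1 / real (Suc n) \<and>
      \<rho> (\<lambda>x. ennreal (w x)) f < 2 * (1 / real (Suc n))"
    using step2 by (intro allI) (metis zero_less_divide_1_iff of_nat_0_less_iff zero_less_Suc)
  from choice[OF this] obtain w where w: "\<And>n. w n \<in> D" "\<And>n x. 0 \<le> w n x" "\<And>n. B (w n) (w n) < 1 / real (Suc n)"
    "\<And>n. \<rho> (\<lambda>x. ennreal (w n x)) f < 2 * (1 / real (Suc n))" by auto
  have "(\<lambda>n. \<rho> (\<lambda>x. ennreal (w n x)) f) \<longlonglongrightarrow> 0"
  proof (rule Lim_null_comparison[OF always_eventually[OF allI] tendsto_mult_right_zero[OF inverse_Suc_tendsto_0, of 2]])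
    show "norm (\<rho> (\<lambda>x. ennreal (w n x)) f) \<le> 2 * (1 / real (Suc n))" for n
      using less_imp_le[OF w(4)[of n]] \<rho>_nonneg[of "\<lambda>x. ennreal (w n x)" f] by simp
  qed
  then obtain s where s: "strict_mono s" "AE x in M. (\<lambda>n. ennreal (w (s n) x)) \<longlonglongrightarrow> f x"
    using \<rho>_subseq[of "\<lambda>n x. ennreal (w n x)" f] w(1) f by auto
  have "(\<lambda>n. B (w n) (w n)) \<longlonglongrightarrow> 0" by (rule form.energy_null_mono[OF w(1) less_imp_le[OF w(3)] inverse_Suc_tendsto_0])
  from LIMSEQ_subseq_LIMSEQ[OF this s(1)] have "(\<lambda>n. B (w (s n)) (w (s n))) \<longlonglongrightarrow> 0" by (simp add: o_def)
  then show "null_limit f"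
    unfolding null_limit_def using f w(1,2) s(2) by (intro conjI exI[of _ "\<lambda>n. w (s n)"]) auto
qed (rule null_limit_imp_plus_form)

end

section \<open>Truncation at functions with values in [0, \<infinity>]\<close>

context positivity_preserving_form
begin

text \<open>The minimum is finite even where \<open>h x = \<infinity>\<close>, so \<open>enn2real\<close> loses nothing.\<close>

definition trunc :: "('a \<Rightarrow> real) \<Rightarrow> ('a \<Rightarrow> ennreal) \<Rightarrow> 'a \<Rightarrow> real" where
  "trunc g h x = enn2real (min (ennreal (g x)) (h x))"

text \<open>The excessive property for functions that may take the value \<infinity>, as null limits
  do, and tested on nonnegative elements of \<open>D\<close> only. For nonnegative real-valued
  functions it turns out to be equivalent to \<open>excessive\<close>.\<close>

definition supermedian :: "('a \<Rightarrow> ennreal) \<Rightarrow> bool" where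
  "supermedian h \<longleftrightarrow> h \<in> Lplus_functions M \<and>
     (\<forall>g\<in>D. (\<forall>x. 0 \<le> g x) \<longrightarrow> trunc g h \<in> D \<and> B (trunc g h) (trunc g h) \<le> B g g)"

lemma trunc_bounds: "0 \<le> trunc g h x" "0 \<le> g x \<Longrightarrow> trunc g h x \<le> g x"
  unfolding trunc_def by (auto intro!: enn2real_leI)

lemma trunc_real: "0 \<le> g x \<Longrightarrow> 0 \<le> r \<Longrightarrow> h x = ennreal r \<Longrightarrow> trunc g h x = min (g x) r"
  by (simp add: trunc_def min_def)

lemma trunc_measurable [measurable]:
  assumes [measurable]: "g \<in> borel_measurable M" "h \<in> borel_measurable M"
  shows "trunc g h \<in> borel_measurable M"
  unfolding trunc_def[abs_def] by measurable

lemma tendsto_trunc: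
  assumes "(\<lambda>n. h n x) \<longlonglongrightarrow> h' x"
  shows "(\<lambda>n. trunc g (h n) x) \<longlonglongrightarrow> trunc g h' x"
proof -
  have "(\<lambda>n. min (ennreal (g x)) (h n x)) \<longlonglongrightarrow> min (ennreal (g x)) (h' x)"
    by (intro tendsto_min tendsto_const assms)
  also have "min (ennreal (g x)) (h' x) = ennreal (trunc g h' x)"
    by (simp add: trunc_def min_less_iff_disj)
  finally show ?thesis unfolding trunc_def[of g "h _"] by (intro tendsto_enn2real trunc_bounds)
qed

lemma trunc_limit:
  assumes g: "g \<in> D" "\<And>x. 0 \<le> g x" and h: "h \<in> Lplus_functions M"
    and t: "\<And>n. trunc g (h' n) \<in> D" "\<And>n. B (trunc g (h' n)) (trunc g (h' n)) \<le> c n" "c \<longlonglongrightarrow> C"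
    and lim: "AE x in M. (\<lambda>n. h' n x) \<longlonglongrightarrow> h x"
  shows "trunc g h \<in> D" "B (trunc g h) (trunc g h) \<le> C"
proof -
  have 1: "AE x in M. (\<lambda>n. trunc g (h' n) x) \<longlonglongrightarrow> trunc g h x"
    using lim by eventually_elim (rule tendsto_trunc)
  have 2: "AE x in M. \<bar>trunc g (h' n) x\<bar> \<le> g x" for n
    using g(2) trunc_bounds by simp
  show "trunc g h \<in> D" "B (trunc g h) (trunc g h) \<le> C"
    using dominated_limit[OF t(1) D_L2[OF g(1)] trunc_measurable[OF D_measurable[OF g(1)] h] 1 2 t(2,3)] by blast+
qed

lemma supermedian_limit:
  assumes "\<And>n. supermedian (h' n)" "h \<in> Lplus_functions M" "AE x in M. (\<lambda>n. h' n x) \<longlonglongrightarrow> h x"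
  shows "supermedian h"
  unfolding supermedian_def
proof (intro conjI ballI impI assms(2))
  fix g assume g: "g \<in> D" "\<forall>x. 0 \<le> g x"
  have t: "trunc g (h' n) \<in> D" "B (trunc g (h' n)) (trunc g (h' n)) \<le> B g g" for n
    using assms(1)[of n] g unfolding supermedian_def by auto
  show "trunc g h \<in> D" "B (trunc g h) (trunc g h) \<le> B g g"
    using trunc_limit[OF g(1) _ assms(2) t tendsto_const assms(3)] g(2) by blast+
qed

text \<open>Cutting \<open>g\<close> off at \<open>c * h\<close> is \<open>c\<close> times cutting
  \<open>g / c\<close> off at \<open>h\<close>. The limits of large and of small \<open>c\<close>
  yield the zero-one laws below.\<close>

lemma supermedian_scale:
  assumes "supermedian h" "c > 0"
  shows "supermedian (\<lambda>x. ennreal c * h x)"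
  unfolding supermedian_def
proof (intro conjI ballI impI)
  have [measurable]: "h \<in> Lplus_functions M" using assms by (simp add: supermedian_def)
  show "(\<lambda>x. ennreal c * h x) \<in> Lplus_functions M" by measurable
  fix g assume g: "g \<in> D" "\<forall>x. 0 \<le> g x"
  let ?g = "(1 / c) *\<^sub>R g"
  have t: "trunc ?g h \<in> D" "B (trunc ?g h) (trunc ?g h) \<le> B ?g ?g"
    using assms g unfolding supermedian_def by auto
  have eq: "trunc g (\<lambda>x. ennreal c * h x) = c *\<^sub>R trunc ?g h"
  proof
    fix x
    have "ennreal (g x) = ennreal c * ennreal (g x / c)"
      using assms(2) g(2) by (simp flip: ennreal_mult)
    then have "min (ennreal (g x)) (ennreal c * h x) = ennreal c * min (ennreal (g x / c)) (h x)"
      using min_of_mono[of "\<lambda>y. ennreal c * y" "ennreal (g x / c)" "h x"]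
      by (simp add: mono_def mult_left_mono)
    then show "trunc g (\<lambda>x. ennreal c * h x) x = (c *\<^sub>R trunc ?g h) x"
      using assms(2) by (simp add: trunc_def enn2real_mult)
  qed
  show "trunc g (\<lambda>x. ennreal c * h x) \<in> D" unfolding eq using t by simp
  have "B (c *\<^sub>R trunc ?g h) (c *\<^sub>R trunc ?g h) = c\<^sup>2 * B (trunc ?g h) (trunc ?g h)"
    using t by (simp only: form.energy_scale)
  also have "\<dots> \<le> c\<^sup>2 * B ?g ?g" using t by (intro mult_left_mono) auto
  also have "\<dots> = B g g" using g assms(2) by (simp only: form.energy_scale) (simp add: power_divide)
  finally show "B (trunc g (\<lambda>x. ennreal c * h x)) (trunc g (\<lambda>x. ennreal c * h x)) \<le> B g g" unfolding eq .
qed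

text \<open>For \<open>u n\<close> of vanishing energy the seminorm of the minimum of
  \<open>g\<close> and \<open>u n\<close> is at most that of \<open>g\<close> plus that of
  \<open>u n\<close>. The second term disappears in the limit, and lower semicontinuity does the
  rest.\<close>

lemma supermedian_null_limit:
  assumes "null_limit f"
  shows "supermedian f"
proof -
  obtain u where u: "\<And>n. u n \<in> D" "\<And>n x. 0 \<le> u n x" "(\<lambda>n. B (u n) (u n)) \<longlonglongrightarrow> 0"
    "AE x in M. (\<lambda>n. ennreal (u n x)) \<longlonglongrightarrow> f x" and f: "f \<in> Lplus_functions M"
    using assms unfolding null_limit_def by blast
  have u0: "(\<lambda>n. form.seminorm (u n)) \<longlonglongrightarrow> 0" using u form.tendsto_energy_zero_iff by blast
  show ?thesis unfolding supermedian_def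
  proof (intro conjI ballI impI f)
    fix g assume g: "g \<in> D" "\<forall>x. 0 \<le> g x"
    have eq: "trunc g (\<lambda>x. ennreal (u n x)) = (\<lambda>x. min (g x) (u n x))" for n
      using g u by (intro ext trunc_real) auto
    have t: "trunc g (\<lambda>x. ennreal (u n x)) \<in> D" for n unfolding eq using g u by (intro min_D)
    have tb: "B (trunc g (\<lambda>x. ennreal (u n x))) (trunc g (\<lambda>x. ennreal (u n x))) \<le> (form.seminorm g + form.seminorm (u n))\<^sup>2" for n
      using seminorm_min[OF g(1) u(1)[of n]] t[of n] form.seminorm_nonneg[OF g(1)] form.seminorm_nonneg[OF u(1)[of n]]
      by (simp add: form.seminorm_le_iff flip: eq)
    have "(\<lambda>n. (form.seminorm g + form.seminorm (u n))\<^sup>2) \<longlonglongrightarrow> (form.seminorm g + 0)\<^sup>2"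
      by (intro tendsto_intros u0)
    then have tc: "(\<lambda>n. (form.seminorm g + form.seminorm (u n))\<^sup>2) \<longlonglongrightarrow> B g g"
      using g by (simp add: form.seminorm_sq)
    show "trunc g f \<in> D" "B (trunc g f) (trunc g f) \<le> B g g"
      using trunc_limit[OF g(1) _ f t tb tc u(4)] g by blast+
  qed
qed

text \<open>For nonnegative \<open>f\<close> and \<open>g\<close> the functions \<open>R f\<close>
  and \<open>g - R g\<close> have disjoint supports, so their form is nonpositive. Conversely
  \<open>R\<close> maps \<open>R f\<close> plus a positive multiple of \<open>g - R g\<close> to
  \<open>R f\<close> without raising the energy, so the first variation is nonnegative. Hence the
  two are orthogonal; by bilinearity this extends to signed functions, where Pythagoras gives the
  claim.\<close>

lemma invariant_of_nonneg:
  assumes A: "A \<in> sets M"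
    and res: "\<And>f. f \<in> D \<Longrightarrow> (\<forall>x. 0 \<le> f x) \<Longrightarrow> (\<lambda>x. indicator A x * f x) \<in> D \<and>
      B (\<lambda>x. indicator A x * f x) (\<lambda>x. indicator A x * f x) \<le> B f f"
  shows "form_invariant M q A"
proof -
  define R where "R f = (\<lambda>x. indicator A x * f x)" for f :: "'a \<Rightarrow> real"
  have R: "R f \<in> D" "B (R f) (R f) \<le> B f f" if "f \<in> D" "\<forall>x. 0 \<le> f x" for f
    using res[OF that] by (auto simp: R_def)
  have ortho: "B (R f) (g - R g) = 0" if f: "f \<in> D" "\<forall>x. 0 \<le> f x" and g: "g \<in> D" "\<forall>x. 0 \<le> g x" for f g
  proof (rule antisym)
    show "B (R f) (g - R g) \<le> 0"
      using R f g by (intro disjoint_B_nonpos) (auto simp: R_def indicator_def)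
    let ?G = "g - R g"
    have GD: "?G \<in> D" using R g by simp
    show "0 \<le> B (R f) ?G"
    proof (rule quadratic_nonneg_imp_nonneg[OF form.nonneg[OF GD]])
      fix s :: real assume s: "0 < s"
      have F: "R f + s *\<^sub>R ?G \<in> D" "\<forall>x. 0 \<le> (R f + s *\<^sub>R ?G) x"
        using R f g s by (auto simp: R_def indicator_def)
      have "R (R f + s *\<^sub>R ?G) = R f" by (auto simp: R_def indicator_def fun_eq_iff)
      then have "B (R f) (R f) \<le> B (R f + s *\<^sub>R ?G) (R f + s *\<^sub>R ?G)" using R(2)[OF F] by (simp only:)
      also have "\<dots> = B (R f) (R f) + 2 * s * B (R f) ?G + s\<^sup>2 * B ?G ?G"
        using R(1)[OF f] GD by (simp only: form.energy_add form.D_scale form.scale_right form.scale_left mult.assoc power2_eq_square)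
      finally show "0 \<le> 2 * s * B (R f) ?G + s\<^sup>2 * B ?G ?G" by simp
    qed
  qed
  have main: "R f \<in> D \<and> B (R f) (R f) \<le> B f f" if f: "f \<in> D" for f
  proof -
    obtain p m where pmD: "p \<in> D" "m \<in> D" and pm_def: "\<And>x. p x = max (f x) 0" "\<And>x. m x = max (- f x) 0"
      and f_eq: "f = p - m" using positive_negative_parts[OF f] by blast
    have pm: "p \<in> D" "m \<in> D" "\<forall>x. 0 \<le> p x" "\<forall>x. 0 \<le> m x" using pmD pm_def by auto
    have Rf: "R f = R p - R m" unfolding f_eq by (auto simp: R_def fun_eq_iff algebra_simps)
    have RD: "R p \<in> D" "R m \<in> D" using R pm by auto
    then have RfD: "R f \<in> D" unfolding Rf by simp
    have fR: "f - R f = (p - R p) - (m - R m)" unfolding Rf by (simp add: f_eq)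
    have D2: "p - R p \<in> D" "m - R m \<in> D" using RD pm by auto
    have "B (R f) (f - R f) = 0"
      unfolding fR unfolding Rf using RD D2 ortho[OF pm(1,3) pm(1,3)] ortho[OF pm(1,3) pm(2,4)] ortho[OF pm(2,4) pm(1,3)] ortho[OF pm(2,4) pm(2,4)]
      by (simp add: form.diff_right[OF D2] form.diff_left[OF RD])
    then have "B (R f + (f - R f)) (R f + (f - R f)) = B (R f) (R f) + B (f - R f) (f - R f)"
      using RfD f by (simp only: form.energy_add form.D_diff)
    moreover have "0 \<le> B (f - R f) (f - R f)" using RfD f by (simp add: form.nonneg)
    ultimately show ?thesis using RfD by simp
  qed
  have "q (R f) \<le> q f" if f: "f \<in> L2_functions M" for f
  proof (cases "f \<in> D")
    case True
    then show ?thesis using main[OF True] q_eq by (simp add: ennreal_leI)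
  next
    case False
    then have "q f = \<infinity>" using f by (auto simp: form_domain_def less_top[symmetric] simp del: D_L2)
    then show ?thesis by simp
  qed
  then show ?thesis using A by (simp add: form_invariant_def R_def)
qed

end

section \<open>Zero-one laws from irreducibility, and excessive functions\<close>

locale irreducible_positivity_preserving_form = sigma_finite_form +
  assumes dense: "densely_defined M q"
    and irreducible: "irreducible_form M q"
    and nontrivial: "emeasure M (space M) \<noteq> 0"
begin

lemma zero_one:
  assumes P: "{x \<in> space M. P x} \<in> sets M"
    and "\<And>f. f \<in> D \<Longrightarrow> (\<forall>x. 0 \<le> f x) \<Longrightarrow> (\<lambda>x. indicator {x \<in> space M. P x} x * f x) \<in> D \<and>
      B (\<lambda>x. indicator {x \<in> space M. P x} x * f x) (\<lambda>x. indicator {x \<in> space M. P x} x * f x) \<le> B f f"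
  shows "(AE x in M. \<not> P x) \<or> (AE x in M. P x)"
proof -
  let ?A = "{x \<in> space M. P x}"
  have "form_invariant M q ?A" using invariant_of_nonneg[OF assms] .
  then have "emeasure M ?A = 0 \<or> emeasure M (space M - ?A) = 0"
    using irreducible by (simp add: irreducible_form_def)
  moreover have "AE x in M. \<not> P x" if "emeasure M ?A = 0"
    by (rule AE_I[OF _ that P]) auto
  moreover have "AE x in M. P x" if "emeasure M (space M - ?A) = 0"
    by (rule AE_I[OF _ that]) (use P in auto)
  ultimately show ?thesis by blast
qed

text \<open>Truncation at a function with values 0 and \<infinity> is multiplication by an
  indicator, so such a function is supermedian only if the set where it is infinite is
  invariant.\<close>

lemma zero_one_supermedian:
  assumes h: "supermedian h" and P: "\<And>x. h x = (if P x then \<infinity> else 0)"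
  shows "(AE x in M. \<not> P x) \<or> (AE x in M. P x)"
proof (rule zero_one)
  have [measurable]: "h \<in> Lplus_functions M" using h by (simp add: supermedian_def)
  have "{x \<in> space M. P x} = {x \<in> space M. h x = \<infinity>}" using P by auto
  then show [measurable]: "{x \<in> space M. P x} \<in> sets M" by simp
  fix f assume f: "f \<in> D" "\<forall>x. 0 \<le> f x"
  let ?R = "\<lambda>x. indicator {x \<in> space M. P x} x * f x"
  have t: "trunc f h \<in> D" "B (trunc f h) (trunc f h) \<le> B f f" using h f by (auto simp: supermedian_def)
  have eq: "AE x in M. trunc f h x = ?R x" using f by (auto simp: trunc_def P indicator_def min_def)
  have m: "?R \<in> borel_measurable M" using f by measurable
  show "?R \<in> D \<and> B ?R ?R \<le> B f f" using D_cong[OF t(1) m eq] energy_cong[OF t(1) m eq] t(2) by simp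
qed

text \<open>Ever larger multiples of \<open>h\<close> tend to the function that is \<infinity> where
  \<open>h\<close> is positive and 0 elsewhere.\<close>

lemma supermedian_positive:
  assumes h: "supermedian h"
  shows "(AE x in M. h x = 0) \<or> (AE x in M. h x > 0)"
proof -
  have hm [measurable]: "h \<in> Lplus_functions M" using h by (simp add: supermedian_def)
  let ?t = "\<lambda>x. \<infinity> * h x"
  have "supermedian ?t"
  proof (rule supermedian_limit)
    show "supermedian (\<lambda>x. ennreal (real (Suc n)) * h x)" for n by (rule supermedian_scale[OF h]) simp
    have "(\<lambda>n. ennreal (real (Suc n)) * y) \<longlonglongrightarrow> \<infinity> * y" for y :: ennreal
    proof (cases "y = 0")
      case False
      have "(\<lambda>n. ennreal (real (Suc n))) \<longlonglongrightarrow> \<infinity>"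
        using LIMSEQ_Suc[OF of_nat_tendsto_top_ennreal] by (simp add: ennreal_of_nat_eq_real_of_nat del: of_nat_Suc)
      then show ?thesis using False by (intro tendsto_mult_ennreal tendsto_const) auto
    qed simp
    then show "AE x in M. (\<lambda>n. ennreal (real (Suc n)) * h x) \<longlonglongrightarrow> ?t x" by simp
  qed simp
  then have "(AE x in M. \<not> h x > 0) \<or> (AE x in M. h x > 0)"
    by (rule zero_one_supermedian) (auto simp: ennreal_top_mult)
  then show ?thesis by (simp add: not_gr_zero)
qed

text \<open>Ever smaller multiples of \<open>h\<close> tend to the function that is \<infinity>
  where \<open>h\<close> is infinite and 0 elsewhere.\<close>

lemma supermedian_infinite:
  assumes h: "supermedian h"
  shows "(AE x in M. h x < \<infinity>) \<or> (AE x in M. h x = \<infinity>)"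
proof -
  have hm [measurable]: "h \<in> Lplus_functions M" using h by (simp add: supermedian_def)
  let ?t = "\<lambda>x. if h x = \<infinity> then \<infinity> else 0"
  have "supermedian ?t"
  proof (rule supermedian_limit)
    show "supermedian (\<lambda>x. ennreal (1 / real (Suc n)) * h x)" for n by (rule supermedian_scale[OF h]) simp
    have "(\<lambda>n. ennreal (1 / real (Suc n)) * y) \<longlonglongrightarrow> (if y = \<infinity> then \<infinity> else 0)" for y :: ennreal
    proof (cases "y = \<infinity>")
      case False
      have "(\<lambda>n. ennreal (1 / real (Suc n))) \<longlonglongrightarrow> ennreal 0"
        by (intro tendsto_ennrealI inverse_Suc_tendsto_0)
      then have "(\<lambda>n. ennreal (1 / real (Suc n)) * y) \<longlonglongrightarrow> ennreal 0 * y"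
        using False by (intro tendsto_mult_ennreal tendsto_const) auto
      then show ?thesis using False by simp
    next
      case True
      have "ennreal (1 / real (Suc n)) * y = \<infinity>" for n
        using True by (auto simp: ennreal_mult_top)
      then show ?thesis using True by simp
    qed
    then show "AE x in M. (\<lambda>n. ennreal (1 / real (Suc n)) * h x) \<longlonglongrightarrow> ?t x" by simp
  qed simp
  then have "(AE x in M. \<not> h x = \<infinity>) \<or> (AE x in M. h x = \<infinity>)"
    by (rule zero_one_supermedian) simp
  then show ?thesis by (simp add: less_top)
qed

text \<open>For disjointly supported nonnegative functions the form is nonpositive, which extends the
  truncation property from nonnegative to arbitrary functions.\<close>

lemma excessive_iff_supermedian:
  assumes h: "h \<in> L0_functions M" "AE x in M. 0 \<le> h x"
  shows "excessive M q h \<longleftrightarrow> supermedian (\<lambda>x. ennreal (h x))"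
proof
  assume ex: "excessive M q h"
  show "supermedian (\<lambda>x. ennreal (h x))" unfolding supermedian_def
  proof (intro conjI ballI impI)
    show "(\<lambda>x. ennreal (h x)) \<in> Lplus_functions M" using h by simp
    fix g assume g: "g \<in> D" "\<forall>x. 0 \<le> g x"
    let ?m = "\<lambda>x. min (g x) (h x)"
    have eq: "AE x in M. ?m x = trunc g (\<lambda>x. ennreal (h x)) x"
      using h(2) by eventually_elim (simp add: trunc_real g(2))
    have tm: "trunc g (\<lambda>x. ennreal (h x)) \<in> borel_measurable M" using g h by (intro trunc_measurable) auto
    have mL: "?m \<in> L2_functions M"
    proof (rule L2_dominated[OF D_L2[OF g(1)]])
      show "AE x in M. \<bar>?m x\<bar> \<le> g x" using h(2) by eventually_elim (use g(2) in auto)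
    qed (use g h in auto)
    have "q ?m \<le> q g" using ex g by (simp add: excessive_def)
    then have qm: "q ?m \<le> ennreal (B g g)" using g by (simp add: q_eq)
    have mD: "?m \<in> D" using D_I[OF mL qm] .
    show "trunc g (\<lambda>x. ennreal (h x)) \<in> D" using D_cong[OF mD tm eq] .
    show "B (trunc g (\<lambda>x. ennreal (h x))) (trunc g (\<lambda>x. ennreal (h x))) \<le> B g g"
      using energy_cong[OF mD tm eq] qm mD form.nonneg[OF g(1)] by (simp add: q_eq)
  qed
next
  assume s: "supermedian (\<lambda>x. ennreal (h x))"
  have "q (\<lambda>x. min (f x) (h x)) \<le> q f" if f: "f \<in> L2_functions M" for f
  proof (cases "f \<in> D")
    case False
    then have "q f = \<infinity>" using f by (auto simp: form_domain_def less_top[symmetric] simp del: D_L2)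
    then show ?thesis by simp
  next
    case fD: True
    obtain p m where pmD: "p \<in> D" "m \<in> D" and pm_def: "\<And>x. p x = max (f x) 0" "\<And>x. m x = max (- f x) 0"
      and f_eq: "f = p - m" using positive_negative_parts[OF fD] by blast
    have pm: "p \<in> D" "m \<in> D" "\<forall>x. 0 \<le> p x" "\<forall>x. 0 \<le> m x" using pmD pm_def by auto
    define a where "a = trunc p (\<lambda>x. ennreal (h x))"
    have a: "a \<in> D" "B a a \<le> B p p" using s pm by (auto simp: supermedian_def a_def)
    have a_min: "AE x in M. a x = min (p x) (h x)"
      using h(2) by eventually_elim (use pm in \<open>simp add: a_def trunc_real\<close>)
    have eq: "AE x in M. (a - m) x = min (f x) (h x)"
      using h(2) a_min by eventually_elim (auto simp: pm_def min_def max_def)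
    \<comment> \<open>Up to null sets \<open>p - a\<close> lives where \<open>f > h\<close> and
      \<open>m\<close> where \<open>f < 0\<close>. The sign of their form is what is needed to pass
      from \<open>p - m\<close> to \<open>a - m\<close>.\<close>
    have "B (p - a) m \<le> 0"
    proof (rule disjoint_B_nonpos)
      show "AE x in M. 0 \<le> (p - a) x \<and> 0 \<le> m x \<and> min ((p - a) x) (m x) = 0"
        using a_min h(2) by eventually_elim (auto simp: pm_def min_def max_def)
    qed (use a pm in auto)
    then have "B (a - m) (a - m) \<le> B (p - m) (p - m)"
      using a pm by (simp add: form.energy_diff[OF a(1) pm(2)] form.energy_diff[OF pm(1,2)] form.diff_left[of p a m])
    then have "q (a - m) \<le> q f" unfolding f_eq using a pm by (simp add: q_eq ennreal_leI)
    moreover have "q (a - m) = q (\<lambda>x. min (f x) (h x))"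
    proof (rule q_cong[OF D_L2[OF form.D_diff[OF a(1) pm(2)]] _ eq])
      show "(\<lambda>x. min (f x) (h x)) \<in> L2_functions M"
        using D_cong[OF form.D_diff[OF a(1) pm(2)] _ eq] h fD by simp
    qed
    ultimately show ?thesis by simp
  qed
  then show "excessive M q h" using h by (simp add: excessive_def)
qed

end

section \<open>Resolvent equations and the Hardy inequality\<close>

context positivity_preserving_form
begin

definition energy :: "real \<Rightarrow> ('a \<Rightarrow> real) \<Rightarrow> real" where
  "energy \<alpha> f = B f f + \<alpha> * L2_inner M f f"

definition positive_functional :: "(('a \<Rightarrow> real) \<Rightarrow> real) \<Rightarrow> bool" where
  "positive_functional l \<longleftrightarrow> (\<forall>f\<in>D. \<forall>g\<in>D. l (f + g) = l f + l g) \<and> (\<forall>f\<in>D. \<forall>c. l (c *\<^sub>R f) = c * l f) \<and>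
     (\<forall>f\<in>D. (AE x in M. 0 \<le> f x) \<longrightarrow> 0 \<le> l f)"

text \<open>Solutions of \<open>(L + \<alpha>) u = l\<close> in weak form, \<open>L\<close> being the generator of the form.\<close>

definition solution :: "real \<Rightarrow> (('a \<Rightarrow> real) \<Rightarrow> real) \<Rightarrow> ('a \<Rightarrow> real) \<Rightarrow> bool" where
  "solution \<alpha> l u \<longleftrightarrow> u \<in> D \<and> (\<forall>x. 0 \<le> u x) \<and> (\<forall>f\<in>D. B u f + \<alpha> * L2_inner M u f = l f)"

lemma semi_inner_shifted:
  assumes "\<alpha> \<ge> 0"
  shows "semi_inner D (\<lambda>f g. B f g + \<alpha> * L2_inner M f g)"
proof
  show "subspace D" by (rule subspace_D)
  show "B a b + \<alpha> * L2_inner M a b = B b a + \<alpha> * L2_inner M b a" if "a \<in> D" "b \<in> D" for a b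
    using that by (simp add: form.sym L2.sym)
  show "B (a + b) c + \<alpha> * L2_inner M (a + b) c = B a c + \<alpha> * L2_inner M a c + (B b c + \<alpha> * L2_inner M b c)"
    if "a \<in> D" "b \<in> D" "c \<in> D" for a b c
    using that by (simp add: form.add_left L2.add_left algebra_simps)
  show "B (r *\<^sub>R a) b + \<alpha> * L2_inner M (r *\<^sub>R a) b = r * (B a b + \<alpha> * L2_inner M a b)"
    if "a \<in> D" "b \<in> D" for a b r
    using that by (simp add: form.scale_left L2.scale_left algebra_simps)
  show "0 \<le> B a a + \<alpha> * L2_inner M a a" if "a \<in> D" for a
    using that assms by (simp add: form.nonneg L2.nonneg)
qed

lemma energy_nonneg: "f \<in> D \<Longrightarrow> \<alpha> \<ge> 0 \<Longrightarrow> 0 \<le> energy \<alpha> f"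
  by (simp add: energy_def form.nonneg L2.nonneg)

lemma L2_inner_abs: "L2_inner M (\<lambda>x. \<bar>f x\<bar>) (\<lambda>x. \<bar>f x\<bar>) = L2_inner M f f"
  by (simp add: L2_inner_def)

lemma energy_abs: "f \<in> D \<Longrightarrow> energy \<alpha> (\<lambda>x. \<bar>f x\<bar>) \<le> energy \<alpha> f"
  by (simp add: energy_def L2_inner_abs abs_D)

text \<open>Minimizes the shifted energy minus \<open>2 * l\<close>. Positivity of \<alpha> lets the
  shifted energy control the L2 norm, so that closedness provides a minimizer; the weak equation is
  its Euler-Lagrange equation.\<close>

lemma solution_exists:
  assumes \<alpha>: "\<alpha> > 0" and l: "positive_functional l"
    and bd: "\<And>f. f \<in> D \<Longrightarrow> \<bar>l f\<bar> \<le> C * sqrt (energy \<alpha> f)"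
  obtains u where "solution \<alpha> l u"
proof -
  have l_add: "l (f + g) = l f + l g" if "f \<in> D" "g \<in> D" for f g
    using l that by (simp add: positive_functional_def)
  have l_scale: "l (c *\<^sub>R f) = c * l f" if "f \<in> D" for f c
    using l that by (simp add: positive_functional_def)
  have l_diff: "l (f - g) = l f - l g" if "f \<in> D" "g \<in> D" for f g
    using l_add[of f "(-1) *\<^sub>R g"] l_scale[of g "-1"] that by simp
  have l_pos: "0 \<le> l f" if "f \<in> D" "AE x in M. 0 \<le> f x" for f
    using l that by (simp add: positive_functional_def)
  define S where "S f g = B f g + \<alpha> * L2_inner M f g" for f g
  interpret S: semi_inner D S
    unfolding S_def[abs_def] using semi_inner_shifted[of \<alpha>] \<alpha> by simp
  have SE: "S f f = energy \<alpha> f" for f by (simp add: S_def energy_def)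
  define J where "J f = S f f - 2 * l f" for f
  have bd': "\<bar>l f\<bar> \<le> C * S.seminorm f" if "f \<in> D" for f
    using bd[OF that] by (simp add: S.seminorm_def SE)
  have J_ge: "- C\<^sup>2 \<le> S f f - 2 * l f" if f: "f \<in> D" for f
  proof -
    have "0 \<le> (S.seminorm f - C)\<^sup>2" by simp
    moreover have "l f \<le> C * S.seminorm f" using bd'[OF f] by (rule abs_le_D1)
    ultimately show ?thesis using S.seminorm_sq[OF f] unfolding power2_diff by (simp add: mult.commute)
  qed
  have ne: "D \<noteq> {}" using S.D_zero by blast
  obtain v I where "\<And>n. v n \<in> D" "S.Cauchy_seq v" "(\<lambda>n. S (v n) (v n) - 2 * l (v n)) \<longlonglongrightarrow> I"
    "\<And>f. f \<in> D \<Longrightarrow> I \<le> S f f - 2 * l f"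
    by (rule S.minimizing_sequence[OF order_refl ne subspace_imp_convex[OF subspace_D] l_add l_scale J_ge]) (assumption | rule that)+
  note v = this[folded J_def]
  have S_sq: "(S.seminorm f)\<^sup>2 = (form.seminorm f)\<^sup>2 + \<alpha> * (L2_norm M f)\<^sup>2" if "f \<in> D" for f
    using that by (simp add: S.seminorm_sq form.seminorm_sq L2.seminorm_sq S_def)
  have S_form: "form.seminorm f \<le> S.seminorm f" if "f \<in> D" for f
  proof (rule power2_le_imp_le[OF _ S.seminorm_nonneg[OF that]])
    show "(form.seminorm f)\<^sup>2 \<le> (S.seminorm f)\<^sup>2" unfolding S_sq[OF that] using \<alpha> by simp
  qed
  have S_L2: "L2_norm M f \<le> S.seminorm f / sqrt \<alpha>" if "f \<in> D" for f
  proof -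
    have "(sqrt \<alpha> * L2_norm M f)\<^sup>2 \<le> (S.seminorm f)\<^sup>2" unfolding S_sq[OF that] using \<alpha> by (simp add: power_mult_distrib)
    then have "sqrt \<alpha> * L2_norm M f \<le> S.seminorm f" using S.seminorm_nonneg[OF that] by (rule power2_le_imp_le)
    then show ?thesis using \<alpha> by (simp add: field_simps)
  qed
  have "form.Cauchy_seq v" unfolding form.Cauchy_seq_def
    using v(2)[unfolded S.Cauchy_seq_def] S_form[OF form.D_diff[OF v(1) v(1)]] by (meson le_less_trans)
  moreover have "L2.Cauchy_seq M v" unfolding L2.Cauchy_seq_def
  proof (intro allI impI)
    fix e :: real assume "e > 0"
    then obtain N where N: "\<forall>m\<ge>N. \<forall>n\<ge>N. S.seminorm (v m - v n) < e * sqrt \<alpha>"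
      using v(2) \<alpha> unfolding S.Cauchy_seq_def by (meson mult_pos_pos real_sqrt_gt_zero)
    show "\<exists>N. \<forall>m\<ge>N. \<forall>n\<ge>N. L2_norm M (v m - v n) < e"
    proof (intro exI[of _ N] allI impI)
      fix m n assume "N \<le> m" "N \<le> n"
      then have "S.seminorm (v m - v n) / sqrt \<alpha> < e" using N \<alpha> by (simp add: field_simps)
      then show "L2_norm M (v m - v n) < e" using S_L2[OF form.D_diff[OF v(1) v(1)], of m n] by simp
    qed
  qed
  ultimately obtain u0 where u0: "u0 \<in> D" "(\<lambda>n. form.seminorm (v n - u0)) \<longlonglongrightarrow> 0" "(\<lambda>n. L2_norm M (v n - u0)) \<longlonglongrightarrow> 0"
    using complete[of v, OF v(1)] by blast
  have "(\<lambda>n. sqrt ((form.seminorm (v n - u0))\<^sup>2 + \<alpha> * (L2_norm M (v n - u0))\<^sup>2)) \<longlonglongrightarrow> sqrt (0\<^sup>2 + \<alpha> * 0\<^sup>2)"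
    by (intro tendsto_intros u0)
  then have S0: "(\<lambda>n. S.seminorm (v n - u0)) \<longlonglongrightarrow> 0"
    unfolding S_sq[OF form.D_diff[OF v(1) u0(1)], symmetric]
    using S.seminorm_nonneg[OF form.D_diff[OF v(1) u0(1)]] by simp
  have "(\<lambda>n. S.seminorm (v n)) \<longlonglongrightarrow> S.seminorm u0"
  proof (rule LIM_zero_cancel, rule Lim_null_comparison[OF always_eventually[OF allI] S0])
    show "norm (S.seminorm (v n) - S.seminorm u0) \<le> S.seminorm (v n - u0)" for n
      using S.seminorm_abs_diff[OF v(1) u0(1)] by simp
  qed
  then have "(\<lambda>n. (S.seminorm (v n))\<^sup>2) \<longlonglongrightarrow> (S.seminorm u0)\<^sup>2" by (rule tendsto_power)
  then have l1: "(\<lambda>n. S (v n) (v n)) \<longlonglongrightarrow> S u0 u0" using v u0 by (simp add: S.seminorm_sq)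
  have "(\<lambda>n. l (v n) - l u0) \<longlonglongrightarrow> 0"
  proof (rule Lim_null_comparison[OF always_eventually[OF allI] tendsto_mult_right_zero[OF S0, of C]])
    show "norm (l (v n) - l u0) \<le> C * S.seminorm (v n - u0)" for n
      using bd'[OF form.D_diff[OF v(1) u0(1)], of n] unfolding l_diff[OF v(1) u0(1)] by simp
  qed
  then have l2: "(\<lambda>n. l (v n)) \<longlonglongrightarrow> l u0" by (rule LIM_zero_cancel)
  have "(\<lambda>n. J (v n)) \<longlonglongrightarrow> J u0" unfolding J_def by (intro tendsto_intros l1 l2)
  then have Ju0: "J u0 = I" using v(3) LIMSEQ_unique by blast
  \<comment> \<open>The absolute value has no larger energy, and \<open>l\<close> does not decrease
    because it is positive. So this is again a minimizer, now nonnegative everywhere.\<close>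
  define u where "u = (\<lambda>x. \<bar>u0 x\<bar>)"
  have u: "u \<in> D" "\<And>x. 0 \<le> u x" using abs_D(1)[OF u0(1)] by (auto simp: u_def)
  have "0 \<le> l (u - u0)" using u u0 by (intro l_pos) (auto simp: u_def)
  then have "l u0 \<le> l u" using l_diff[OF u(1) u0(1)] by simp
  then have "J u \<le> J u0"
    using energy_abs[OF u0(1), of \<alpha>] unfolding J_def SE u_def by simp
  then have min: "J u \<le> J f" if "f \<in> D" for f using v(4)[OF that] Ju0 by simp
  have "S u f = l f" if f: "f \<in> D" for f
  proof -
    have ineq: "0 \<le> 2 * t * (S u f - l f) + t\<^sup>2 * S f f" for t
    proof -
      have "J (u + t *\<^sub>R f) = J u + 2 * t * (S u f - l f) + t\<^sup>2 * S f f"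
        using u f unfolding J_def
        by (simp add: S.energy_add l_add l_scale S.scale_right S.scale_left power2_eq_square algebra_simps)
      then show ?thesis using min[of "u + t *\<^sub>R f"] u f by simp
    qed
    have "0 \<le> S u f - l f" by (rule quadratic_nonneg_imp_nonneg[OF S.nonneg[OF f] ineq])
    moreover have "0 \<le> - (S u f - l f)"
    proof (rule quadratic_nonneg_imp_nonneg[OF S.nonneg[OF f]])
      show "0 \<le> 2 * t * - (S u f - l f) + t\<^sup>2 * S f f" for t using ineq[of "- t"] by (simp add: algebra_simps)
    qed
    ultimately show ?thesis by simp
  qed
  then have "solution \<alpha> l u" using u unfolding solution_def S_def by auto
  then show ?thesis by (rule that)
qed

text \<open>The inequality comes from \<open>q (f \<and> tu) + q (f \<or> tu) \<le> q f + q (tu)\<close>,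
  where \<open>f \<or> tu = tu + (f - tu)\<^sup>+\<close>.\<close>

lemma energy_split:
  assumes u: "solution \<alpha> l u" and f: "f \<in> D" "\<And>x. 0 \<le> f x" and t: "t \<ge> 0"
  defines "a \<equiv> \<lambda>x. min (f x) (t * u x)"
  shows "a \<in> D" "energy \<alpha> a + energy \<alpha> (f - a) + 2 * t * l (f - a) \<le> energy \<alpha> f"
proof -
  have uD: "u \<in> D" "t *\<^sub>R u \<in> D" and EL: "\<And>f. f \<in> D \<Longrightarrow> B u f + \<alpha> * L2_inner M u f = l f"
    using u by (auto simp: solution_def)
  have a_eq: "a = (\<lambda>x. min (f x) ((t *\<^sub>R u) x))" by (simp add: a_def)
  show aD: "a \<in> D" unfolding a_eq using f uD by (intro min_D)
  define m where "m = (\<lambda>x. max (f x) ((t *\<^sub>R u) x))"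
  have m_eq: "m = t *\<^sub>R u + (f - a)" by (auto simp: m_def a_def fun_eq_iff max_def min_def)
  have mD: "m \<in> D" unfolding m_def using f uD by (intro max_D)
  have 1: "B a a + B m m \<le> B f f + B (t *\<^sub>R u) (t *\<^sub>R u)"
    using energy_min_max[OF f(1) uD(2)] unfolding a_eq m_def .
  \<comment> \<open>Pointwise, minimum and maximum are just a permutation of the two values, so the
    L2 part of the comparison is an equality.\<close>
  have "L2_inner M a a + L2_inner M m m = (\<integral>x. a x * a x + m x * m x \<partial>M)"
    unfolding L2_inner_def using aD mD by (intro Bochner_Integration.integral_add[symmetric] L2_mult_integrable) auto
  also have "\<dots> = (\<integral>x. f x * f x + (t *\<^sub>R u) x * (t *\<^sub>R u) x \<partial>M)"
    by (intro Bochner_Integration.integral_cong) (auto simp: a_def m_def max_def min_def)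
  also have "\<dots> = L2_inner M f f + L2_inner M (t *\<^sub>R u) (t *\<^sub>R u)"
    unfolding L2_inner_def
    by (intro Bochner_Integration.integral_add L2_mult_integrable[OF D_L2[OF f(1)] D_L2[OF f(1)]]
        L2_mult_integrable[OF D_L2[OF uD(2)] D_L2[OF uD(2)]])
  finally have 2: "L2_inner M a a + L2_inner M m m = L2_inner M f f + L2_inner M (t *\<^sub>R u) (t *\<^sub>R u)" .
  have b: "f - a \<in> D" using f aD by simp
  have "B m m = B (t *\<^sub>R u) (t *\<^sub>R u) + 2 * (t * B u (f - a)) + B (f - a) (f - a)"
    unfolding m_eq form.energy_add[OF uD(2) b] form.scale_left[OF uD(1) b] ..
  moreover have "L2_inner M m m = L2_inner M (t *\<^sub>R u) (t *\<^sub>R u) + 2 * (t * L2_inner M u (f - a)) + L2_inner M (f - a) (f - a)"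
    unfolding m_eq L2.energy_add[OF D_L2[OF uD(2)] D_L2[OF b]] L2.scale_left[OF D_L2[OF uD(1)] D_L2[OF b]] ..
  ultimately have m_energy: "energy \<alpha> m = energy \<alpha> (t *\<^sub>R u) + 2 * t * (B u (f - a) + \<alpha> * L2_inner M u (f - a)) + energy \<alpha> (f - a)"
    by (simp add: energy_def algebra_simps)
  have "\<alpha> * (L2_inner M a a + L2_inner M m m) = \<alpha> * (L2_inner M f f + L2_inner M (t *\<^sub>R u) (t *\<^sub>R u))"
    using 2 by (rule arg_cong)
  then have "energy \<alpha> a + energy \<alpha> m \<le> energy \<alpha> f + energy \<alpha> (t *\<^sub>R u)"
    using 1 unfolding energy_def distrib_left by linarith
  then show "energy \<alpha> a + energy \<alpha> (f - a) + 2 * t * l (f - a) \<le> energy \<alpha> f"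
    using m_energy EL[OF b] by simp
qed

lemma positive_functional_nonneg: "positive_functional l \<Longrightarrow> f \<in> D \<Longrightarrow> (AE x in M. 0 \<le> f x) \<Longrightarrow> 0 \<le> l f"
  by (simp add: positive_functional_def)

text \<open>A weak maximum principle: test the difference of the equations with the positive part
  \<open>p\<close> of \<open>u - v\<close>. Its form with \<open>u - v\<close> is nonnegative, so
  \<alpha> times the inner product of \<open>u\<close> and \<open>p\<close> is at most \<beta> times
  that of \<open>v\<close> and \<open>p\<close>. But \<open>v < u\<close> where
  \<open>p > 0\<close>, and \<beta> < \<alpha>; hence \<open>u * p\<close> vanishes a.e., which is
  impossible where \<open>u > v \<ge> 0\<close>.\<close>

lemma solution_antimono:
  assumes u: "solution \<alpha> l u" and v: "solution \<beta> l v" and \<alpha>\<beta>: "0 < \<beta>" "\<beta> < \<alpha>"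
  shows "AE x in M. u x \<le> v x"
proof -
  have uD: "u \<in> D" "\<And>x. 0 \<le> u x" and vD: "v \<in> D" "\<And>x. 0 \<le> v x"
    using u v by (auto simp: solution_def)
  define d where "d = u - v"
  have dD: "d \<in> D" using uD vD by (simp add: d_def)
  obtain p p' where pD: "p \<in> D" "p' \<in> D" and p_def: "\<And>x. p x = max (d x) 0"
    and p'_def: "\<And>x. p' x = max (- d x) 0" and d_eq: "d = p - p'"
    using positive_negative_parts[OF dD] by blast
  have "B p' p \<le> 0" using pD by (intro disjoint_B_nonpos) (auto simp: p_def p'_def min_def max_def)
  then have "0 \<le> B d p"
    using form.diff_left[OF pD pD(1)] form.nonneg[OF pD(1)] unfolding d_eq by simp
  moreover have "B d p = B u p - B v p" unfolding d_def using form.diff_left[OF uD(1) vD(1) pD(1)] .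
  moreover have "B u p + \<alpha> * L2_inner M u p = B v p + \<beta> * L2_inner M v p"
    using u v pD by (simp add: solution_def)
  ultimately have 1: "\<alpha> * L2_inner M u p \<le> \<beta> * L2_inner M v p" by linarith
  have 2: "L2_inner M v p \<le> L2_inner M u p"
    unfolding L2_inner_def using uD vD pD
    by (intro integral_mono L2_mult_integrable[OF D_L2[OF uD(1)] D_L2[OF pD(1)]]
        L2_mult_integrable[OF D_L2[OF vD(1)] D_L2[OF pD(1)]]) (auto simp: p_def d_def max_def intro: mult_right_mono)
  have "\<alpha> * L2_inner M u p \<le> \<beta> * L2_inner M u p" using 1 mult_left_mono[OF 2, of \<beta>] \<alpha>\<beta> by linarith
  then have le0: "L2_inner M u p \<le> 0" using \<alpha>\<beta> mult_right_less_imp_less[of \<beta> "L2_inner M u p" \<alpha>]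
    by (smt (verit) mult_strict_right_mono)
  have nn: "AE x in M. 0 \<le> u x * p x" using uD by (simp add: p_def)
  have "L2_inner M u p = 0" using le0 integral_nonneg_AE[OF nn] by (simp add: L2_inner_def)
  then have "AE x in M. u x * p x = 0"
    using integral_nonneg_eq_0_iff_AE[OF L2_mult_integrable nn] uD pD by (simp add: L2_inner_def)
  then show ?thesis
  proof eventually_elim
    case (elim x)
    show ?case
    proof (rule ccontr)
      assume "\<not> u x \<le> v x"
      then have "p x > 0" "u x > 0" using vD(2)[of x] by (auto simp: p_def d_def)
      then show False using elim by simp
    qed
  qed
qed

end

text \<open>The grid reaches from \<open>1 / 2 ^ K\<close> to \<open>2 ^ K / 2\<close> and so
  eventually catches every positive \<open>r\<close>. The lower bound says that the whole layer from
  \<open>t\<close> to \<open>2 * t\<close> lies below \<open>r\<close>, the upper bound that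
  \<open>t\<close> is still comparable to \<open>r\<close>.\<close>

lemma dyadic_scale:
  fixes r :: real
  assumes "r > 0"
  shows "\<forall>\<^sub>F K in sequentially. \<exists>k<2 * K. 2 * (2 ^ k / 2 ^ K) \<le> r \<and> r < 4 * (2 ^ k / 2 ^ K)"
proof -
  obtain K0 where K0: "max r (2 / r) < 2 ^ K0"
    using real_arch_pow[of 2 "max r (2 / r)"] by auto
  have "\<exists>k<2 * K. 2 * (2 ^ k / 2 ^ K) \<le> r \<and> r < 4 * (2 ^ k / 2 ^ K)" if K: "K \<ge> K0" for K
  proof -
    have "(2::real) ^ K0 \<le> 2 ^ K" using K by (intro power_increasing) auto
    then have rK: "r < 2 ^ K" "2 / r < 2 ^ K" using K0 by linarith+
    then have lo: "2 < r * 2 ^ K" using assms by (simp add: field_simps)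
    define n where "n = (LEAST n. r * 2 ^ K < 2 ^ n)"
    have "r * 2 ^ K < 2 ^ K * 2 ^ K" using rK by simp
    then have ex: "r * 2 ^ K < 2 ^ (2 * K)" by (simp add: mult_2 power_add)
    have n: "r * 2 ^ K < 2 ^ n" "n \<le> 2 * K"
      unfolding n_def using LeastI[of "\<lambda>n. r * 2 ^ K < 2 ^ n", OF ex] Least_le[of "\<lambda>n. r * 2 ^ K < 2 ^ n", OF ex] by auto
    have n2: "n \<ge> 2"
    proof (rule ccontr)
      assume "\<not> n \<ge> 2"
      then have "n = 0 \<or> n = 1" by auto
      then show False using n(1) lo by auto
    qed
    have below: "2 ^ (n - 1) \<le> r * 2 ^ K"
      using not_less_Least[of "n - 1" "\<lambda>n. r * 2 ^ K < 2 ^ n"] n2 unfolding n_def[symmetric] by auto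
    obtain k where k: "n = k + 2" using n2 by (metis add.commute le_Suc_ex)
    have "2 * 2 ^ k \<le> r * 2 ^ K" "r * 2 ^ K < 4 * 2 ^ k" using below n(1) by (simp_all add: k)
    then show ?thesis using n(2) k by (intro exI[of _ k]) (simp add: field_simps)
  qed
  then show ?thesis by (auto simp: eventually_sequentially)
qed

context positivity_preserving_form
begin

text \<open>Summing the split of the energy over dyadic layers \<open>t\<^sub>k u \<le> f \<le> t\<^sub>k\<^sub>+\<^sub>1 u\<close> telescopes; this is a
  discretization of \<open>\<integral> 2 t (f - tu)\<^sup>+ dt = f\<^sup>2 / u\<close>, which costs the factor 8.\<close>

lemma Hardy_inequality:
  assumes u: "solution \<alpha> (\<lambda>f. L2_inner M \<phi> f) u" and \<alpha>: "\<alpha> \<ge> 0"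
    and \<phi>: "\<phi> \<in> L2_functions M" "AE x in M. 0 \<le> \<phi> x" and u_pos: "AE x in M. 0 < u x" and f: "f \<in> D"
  shows "(\<integral>\<^sup>+x. ennreal ((f x)\<^sup>2 * (\<phi> x / (8 * u x))) \<partial>M) \<le> ennreal (energy \<alpha> f)"
proof -
  define g where "g = (\<lambda>x. \<bar>f x\<bar>)"
  have g: "g \<in> D" "\<And>x. 0 \<le> g x" using abs_D(1)[OF f] by (auto simp: g_def)
  have uD: "u \<in> D" "\<And>x. 0 \<le> u x" using u by (auto simp: solution_def)
  define t :: "nat \<Rightarrow> nat \<Rightarrow> real" where "t K k = 2 ^ k / 2 ^ K" for K k
  define F where "F K k = (\<lambda>x. min (g x) (t K k * u x))" for K k
  have t_nn: "0 \<le> t K k" and t_Suc: "t K (Suc k) = 2 * t K k" for K k by (auto simp: t_def)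
  have FD: "F K k \<in> D" for K k unfolding F_def using energy_split(1)[OF u g t_nn] .
  have F_nn: "0 \<le> F K k x" for K k x using g uD t_nn by (simp add: F_def)
  have F_le: "F K k x \<le> F K (Suc k) x" for K k x
  proof -
    have "t K k * u x \<le> t K (Suc k) * u x" using uD(2)[of x] t_nn[of K k] by (intro mult_right_mono) (simp_all add: t_Suc)
    then show ?thesis unfolding F_def by linarith
  qed
  \<comment> \<open>Cutting the next level off at \<open>t K k * u\<close> returns the present
    level, so \<open>energy_split\<close> applies from level to level and the energies
    telescope.\<close>
  have F_step: "(\<lambda>x. min (F K (Suc k) x) (t K k * u x)) = F K k" for K k
  proof
    fix x
    have "0 \<le> t K k * u x" using t_nn uD(2) by simp
    then show "min (F K (Suc k) x) (t K k * u x) = F K k x" unfolding F_def t_Suc by linarith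
  qed
  have l_nn: "0 \<le> L2_inner M \<phi> h" if "h \<in> D" "\<And>x. 0 \<le> h x" for h
    unfolding L2_inner_def using \<phi> that by (intro integral_nonneg_AE) (auto elim!: eventually_mono)
  have tele: "(\<Sum>k<n. 2 * t K k * L2_inner M \<phi> (F K (Suc k) - F K k)) \<le> energy \<alpha> (F K n)" for K n
  proof (induction n)
    case 0
    show ?case using energy_nonneg[OF FD \<alpha>] by simp
  next
    case (Suc n)
    have "energy \<alpha> (F K n) + energy \<alpha> (F K (Suc n) - F K n) + 2 * t K n * L2_inner M \<phi> (F K (Suc n) - F K n)
        \<le> energy \<alpha> (F K (Suc n))"
      using energy_split(2)[OF u FD F_nn t_nn, of K "Suc n" K n] unfolding F_step .
    moreover have "0 \<le> energy \<alpha> (F K (Suc n) - F K n)" using FD by (intro energy_nonneg \<alpha> form.D_diff)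
    ultimately show ?case using Suc unfolding sum.lessThan_Suc by linarith
  qed
  have F_last: "energy \<alpha> (F K n) \<le> energy \<alpha> f" for K n
  proof -
    have "energy \<alpha> (F K n) + energy \<alpha> (g - F K n) + 2 * t K n * L2_inner M \<phi> (g - F K n) \<le> energy \<alpha> g"
      using energy_split(2)[OF u g t_nn, of K n] unfolding F_def .
    moreover have "0 \<le> energy \<alpha> (g - F K n)" using FD g by (intro energy_nonneg \<alpha> form.D_diff)
    moreover have "0 \<le> L2_inner M \<phi> (g - F K n)" using FD g by (intro l_nn form.D_diff) (auto simp: F_def)
    ultimately show ?thesis using energy_abs[OF f, of \<alpha>] t_nn[of K n] unfolding g_def[symmetric]
      by (smt (verit) mult_nonneg_nonneg)
  qed
  define S where "S K x = (\<Sum>k<2 * K. 2 * t K k * (F K (Suc k) x - F K k x))" for K x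
  have S_int: "integrable M (\<lambda>x. \<phi> x * S K x)" "(\<integral>x. \<phi> x * S K x \<partial>M) \<le> energy \<alpha> f" for K
  proof -
    have eq: "\<phi> x * S K x = (\<Sum>k<2 * K. 2 * t K k * (\<phi> x * (F K (Suc k) - F K k) x))" for x
      by (simp add: S_def sum_distrib_left mult.left_commute)
    have int: "integrable M (\<lambda>x. \<phi> x * (F K (Suc k) - F K k) x)" for k
      by (rule L2_mult_integrable[OF \<phi>(1) D_L2[OF form.D_diff[OF FD FD]]])
    show "integrable M (\<lambda>x. \<phi> x * S K x)" unfolding eq using int by (intro Bochner_Integration.integrable_sum integrable_mult_right)
    have "(\<integral>x. \<phi> x * S K x \<partial>M) = (\<Sum>k<2 * K. 2 * t K k * L2_inner M \<phi> (F K (Suc k) - F K k))"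
      unfolding eq L2_inner_def using int by (subst Bochner_Integration.integral_sum) auto
    then show "(\<integral>x. \<phi> x * S K x \<partial>M) \<le> energy \<alpha> f" using tele[of K "2 * K"] F_last[of K "2 * K"] by simp
  qed
  have S_nn: "0 \<le> S K x" for K x
    unfolding S_def using t_nn F_le by (intro sum_nonneg mult_nonneg_nonneg) auto
  have nn_le: "(\<integral>\<^sup>+x. ennreal (\<phi> x * S K x) \<partial>M) \<le> ennreal (energy \<alpha> f)" for K
  proof -
    have "AE x in M. 0 \<le> \<phi> x * S K x" using \<phi>(2) by eventually_elim (simp add: S_nn)
    then have "(\<integral>\<^sup>+x. ennreal (\<phi> x * S K x) \<partial>M) = ennreal (\<integral>x. \<phi> x * S K x \<partial>M)"
      by (rule nn_integral_eq_integral[OF S_int(1)])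
    then show ?thesis using S_int(2) by (simp add: ennreal_leI)
  qed
  have point: "\<forall>\<^sub>F K in sequentially. (f x)\<^sup>2 / (8 * u x) \<le> S K x" if ux: "0 < u x" for x
  proof (cases "g x = 0")
    case True
    then show ?thesis using S_nn by (simp add: g_def)
  next
    case False
    then have gx: "g x > 0" using g(2)[of x] by simp
    define r where "r = g x / u x"
    have r: "r > 0" "g x = r * u x" using gx ux by (auto simp: r_def)
    show ?thesis using dyadic_scale[OF r(1)]
    proof eventually_elim
      case (elim K)
      then obtain k where k: "k < 2 * K" "2 * t K k \<le> r" "r < 4 * t K k" by (auto simp: t_def)
      \<comment> \<open>A single layer suffices: it contributes
        \<open>2 * (t K k)\<^sup>2 * u x\<close>, and \<open>r < 4 * t K k\<close> makes this at
        least \<open>r\<^sup>2 * u x / 8\<close>. Here is the origin of the 8.\<close>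
      have "r\<^sup>2 \<le> (4 * t K k)\<^sup>2" using k r by (intro power_mono) auto
      then have "r\<^sup>2 * u x \<le> 16 * (t K k)\<^sup>2 * u x" using ux by (intro mult_right_mono) (auto simp: power_mult_distrib)
      moreover have "(f x)\<^sup>2 / (8 * u x) = r\<^sup>2 * u x / 8"
      proof -
        have "(f x)\<^sup>2 = (r * u x)\<^sup>2" using r(2) power2_abs[of "f x"] by (simp add: g_def)
        then show ?thesis using ux by (simp add: power_mult_distrib power2_eq_square)
      qed
      moreover have "2 * t K k * u x \<le> r * u x" using k ux by (intro mult_right_mono) auto
      then have "F K (Suc k) x = 2 * t K k * u x" "F K k x = t K k * u x"
        using r(2) ux t_nn[of K k] by (auto simp: F_def t_Suc min_def mult.assoc)
      then have "2 * t K k * (F K (Suc k) x - F K k x) = 2 * (t K k)\<^sup>2 * u x"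
        by (simp add: power2_eq_square algebra_simps)
      moreover have "2 * t K k * (F K (Suc k) x - F K k x) \<le> S K x"
        unfolding S_def using k t_nn F_le by (intro member_le_sum) (auto intro!: mult_nonneg_nonneg)
      ultimately show ?case by linarith
    qed
  qed
  \<comment> \<open>The \<open>K\<close> from which on the pointwise bound holds depends on
    \<open>x\<close>; Fatou's lemma copes with that.\<close>
  have "(\<integral>\<^sup>+x. ennreal ((f x)\<^sup>2 * (\<phi> x / (8 * u x))) \<partial>M) \<le> (\<integral>\<^sup>+x. liminf (\<lambda>K. ennreal (\<phi> x * S K x)) \<partial>M)"
  proof (rule nn_integral_mono_AE)
    show "AE x in M. ennreal ((f x)\<^sup>2 * (\<phi> x / (8 * u x))) \<le> liminf (\<lambda>K. ennreal (\<phi> x * S K x))"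
      using u_pos \<phi>(2)
    proof eventually_elim
      case (elim x)
      have "\<forall>\<^sub>F K in sequentially. ennreal ((f x)\<^sup>2 * (\<phi> x / (8 * u x))) \<le> ennreal (\<phi> x * S K x)"
        using point[OF elim(1)]
      proof eventually_elim
        case (elim K)
        have "\<phi> x * ((f x)\<^sup>2 / (8 * u x)) \<le> \<phi> x * S K x" using elim \<open>0 \<le> \<phi> x\<close> by (intro mult_left_mono)
        then show ?case by (intro ennreal_leI) (simp add: mult.commute)
      qed
      then show ?case by (rule Liminf_bounded)
    qed
  qed
  also have "\<dots> \<le> liminf (\<lambda>K. \<integral>\<^sup>+x. ennreal (\<phi> x * S K x) \<partial>M)"
    using S_int(1) by (intro nn_integral_liminf) auto
  also have "\<dots> \<le> limsup (\<lambda>K. \<integral>\<^sup>+x. ennreal (\<phi> x * S K x) \<partial>M)" by (rule Liminf_le_Limsup) simp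
  also have "\<dots> \<le> ennreal (energy \<alpha> f)" using nn_le by (intro Limsup_bounded) simp
  finally show ?thesis .
qed

end

context irreducible_positivity_preserving_form
begin

text \<open>The minima of \<open>f\<close> and \<open>n * u\<close> tend to \<open>f\<close>
  restricted to the set where \<open>u > 0\<close>. The splitting controls only the energy shifted
  by \<alpha>, but in the limit the two pieces of \<open>f\<close> are orthogonal in L2, so the
  \<alpha>-terms cancel and the restriction is seen to decrease the form itself.\<close>

lemma solution_zero_or_positive:
  assumes u: "solution \<alpha> l u" and l: "positive_functional l" and \<alpha>: "\<alpha> \<ge> 0"
  shows "(AE x in M. u x = 0) \<or> (AE x in M. 0 < u x)"
proof -
  have uD: "u \<in> D" "\<And>x. 0 \<le> u x" using u by (auto simp: solution_def)
  have [measurable]: "u \<in> borel_measurable M" using uD by simp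
  let ?A = "{x \<in> space M. 0 < u x}"
  have "(AE x in M. \<not> 0 < u x) \<or> (AE x in M. 0 < u x)"
  proof (rule zero_one)
    fix f assume f: "f \<in> D" "\<forall>x. 0 \<le> f x"
    have [measurable]: "f \<in> borel_measurable M" using f by simp
    define a where "a n = (\<lambda>x. min (f x) (real n * u x))" for n
    define R where "R = (\<lambda>x. indicator ?A x * f x)"
    have a: "a n \<in> D" "energy \<alpha> (a n) + energy \<alpha> (f - a n) + 2 * real n * l (f - a n) \<le> energy \<alpha> f" for n
      unfolding a_def using energy_split[OF u f(1), of "real n"] f(2) by auto
    have a_nn: "0 \<le> a n x" "a n x \<le> f x" for n x using f uD by (auto simp: a_def)
    have lim: "AE x in M. (\<lambda>n. a n x) \<longlonglongrightarrow> R x"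
    proof (rule AE_I2)
      fix x assume x: "x \<in> space M"
      show "(\<lambda>n. a n x) \<longlonglongrightarrow> R x"
      proof (cases "0 < u x")
        case True
        obtain N where N: "f x < real N * u x" using reals_Archimedean3[OF True] by blast
        have "\<forall>\<^sub>F n in sequentially. a n x = R x"
          unfolding eventually_sequentially
        proof (intro exI[of _ N] allI impI)
          fix n assume "n \<ge> N"
          then have "real N * u x \<le> real n * u x" using True by (intro mult_right_mono) auto
          then have "f x \<le> real n * u x" using N by linarith
          then show "a n x = R x" using True x by (simp add: a_def R_def)
        qed
        then show ?thesis by (rule tendsto_eventually)
      next
        case False
        then have "u x = 0" using uD(2)[of x] by simp
        then show ?thesis using f(2) by (simp add: a_def R_def)
      qed
    qed
    have Rm: "R \<in> borel_measurable M" unfolding R_def by measurable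
    have dom: "AE x in M. \<bar>a n x\<bar> \<le> f x" for n using a_nn by simp
    note L = L2_dominated_convergence[OF D_L2[OF f(1)] D_measurable[OF a(1)] Rm lim dom]
    have l1: "(\<lambda>n. L2_inner M (a n) (a n)) \<longlonglongrightarrow> L2_inner M R R" using L2_norm_tendsto[OF L] .
    have fr: "(f - a n) - (f - R) = - (a n - R)" for n by simp
    have l2: "(\<lambda>n. L2_inner M (f - a n) (f - a n)) \<longlonglongrightarrow> L2_inner M (f - R) (f - R)"
    proof (rule L2_norm_tendsto)
      show "(\<lambda>n. L2_norm M (f - a n - (f - R))) \<longlonglongrightarrow> 0"
        using L(3) unfolding fr L2.seminorm_minus[OF L2.D_diff[OF L(1,2)]] .
    qed (use a L f in auto)
    have ortho: "L2_inner M R (f - R) = 0"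
    proof -
      have "R x * (f - R) x = 0" for x by (simp add: R_def indicator_def)
      then show ?thesis by (simp only: L2_inner_def) simp
    qed
    have fRR: "L2_inner M f f = L2_inner M R R + L2_inner M (f - R) (f - R)"
      using L2.energy_add[OF L(2) L2.D_diff[OF D_L2[OF f(1)] L(2)]] ortho by simp
    \<comment> \<open>Collects the L2 terms left over by the splitting; they cancel in the limit by
      \<open>fRR\<close>.\<close>
    define c where "c n = B f f + \<alpha> * (L2_inner M f f - L2_inner M (a n) (a n) - L2_inner M (f - a n) (f - a n))" for n
    have "c \<longlonglongrightarrow> B f f + \<alpha> * (L2_inner M f f - L2_inner M R R - L2_inner M (f - R) (f - R))"
      unfolding c_def by (intro tendsto_intros l1 l2)
    then have cl: "c \<longlonglongrightarrow> B f f" using fRR by simp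
    have ac: "B (a n) (a n) \<le> c n" for n
    proof -
      have "0 \<le> l (f - a n)" using a_nn by (intro positive_functional_nonneg[OF l form.D_diff[OF f(1) a(1)]]) simp
      then have "0 \<le> 2 * real n * l (f - a n)" by simp
      moreover have "0 \<le> B (f - a n) (f - a n)" using a f by (intro form.nonneg form.D_diff)
      ultimately show ?thesis using a(2)[of n] unfolding energy_def c_def right_diff_distrib by linarith
    qed
    show "(\<lambda>x. indicator ?A x * f x) \<in> D \<and> B (\<lambda>x. indicator ?A x * f x) (\<lambda>x. indicator ?A x * f x) \<le> B f f"
      using dominated_limit[OF a(1) D_L2[OF f(1)] Rm lim dom ac cl] unfolding R_def by blast
  qed measurable
  then show ?thesis
  proof
    assume "AE x in M. \<not> 0 < u x"
    then have "AE x in M. u x = 0" using uD(2) by (auto elim!: eventually_mono simp: not_less intro: antisym)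
    then show ?thesis ..
  qed simp
qed

end

section \<open>The trichotomy\<close>

context positivity_preserving_form
begin

lemma positive_functional_L2_inner:
  assumes "\<phi> \<in> L2_functions M" "AE x in M. 0 \<le> \<phi> x"
  shows "positive_functional (\<lambda>f. L2_inner M \<phi> f)"
  unfolding positive_functional_def
proof (intro conjI ballI allI impI)
  show "L2_inner M \<phi> (f + g) = L2_inner M \<phi> f + L2_inner M \<phi> g" if "f \<in> D" "g \<in> D" for f g
    using L2.add_right[OF D_L2[OF that(1)] D_L2[OF that(2)] assms(1)] .
  show "L2_inner M \<phi> (c *\<^sub>R f) = c * L2_inner M \<phi> f" if "f \<in> D" for f c
    using L2.scale_right[OF D_L2[OF that] assms(1)] .
  show "0 \<le> L2_inner M \<phi> f" if "AE x in M. 0 \<le> f x" for f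
    unfolding L2_inner_def using assms(2) that by (intro integral_nonneg_AE) (auto elim: eventually_elim2)
qed

lemma solution_L2_exists:
  assumes \<alpha>: "\<alpha> > 0" and \<phi>: "\<phi> \<in> L2_functions M" "AE x in M. 0 \<le> \<phi> x"
  obtains u where "solution \<alpha> (\<lambda>f. L2_inner M \<phi> f) u"
proof (rule solution_exists[OF \<alpha> positive_functional_L2_inner[OF \<phi>]])
  fix f assume f: "f \<in> D"
  have "\<bar>L2_inner M \<phi> f\<bar> \<le> L2_norm M \<phi> * L2_norm M f" using L2.Cauchy_Schwarz[OF \<phi>(1) D_L2[OF f]] .
  also have "\<dots> \<le> L2_norm M \<phi> * (sqrt (energy \<alpha> f) / sqrt \<alpha>)"
  proof (rule mult_left_mono)
    have "\<alpha> * (L2_norm M f)\<^sup>2 \<le> energy \<alpha> f"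
      using f form.nonneg[OF f] by (simp add: energy_def L2.seminorm_sq)
    then have "sqrt (\<alpha> * (L2_norm M f)\<^sup>2) \<le> sqrt (energy \<alpha> f)" by (rule real_sqrt_le_mono)
    then have "sqrt \<alpha> * L2_norm M f \<le> sqrt (energy \<alpha> f)"
      using L2.seminorm_nonneg[OF D_L2[OF f]] by (simp add: real_sqrt_mult)
    then show "L2_norm M f \<le> sqrt (energy \<alpha> f) / sqrt \<alpha>" using \<alpha> by (simp add: field_simps)
  qed (simp add: L2.seminorm_nonneg \<phi>)
  finally show "\<bar>L2_inner M \<phi> f\<bar> \<le> L2_norm M \<phi> / sqrt \<alpha> * sqrt (energy \<alpha> f)" by simp
qed

lemma solution_null:
  assumes u: "solution \<alpha> l u" and z: "AE x in M. u x = 0" and f: "f \<in> D"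
  shows "l f = 0"
proof -
  have uD: "u \<in> D" using u by (simp add: solution_def)
  have "AE x in M. u x = (0 :: 'a \<Rightarrow> real) x" using z by simp
  then have "B u f = B 0 f" using uD f by (intro B_cong(1)) auto
  moreover have "L2_inner M u f = 0"
    unfolding L2_inner_def by (rule integral_eq_zero_AE) (use z in eventually_elim, simp)
  moreover have "B u f + \<alpha> * L2_inner M u f = l f" using u f by (simp add: solution_def)
  ultimately show ?thesis using uD f by simp
qed

lemma null_limit_cong:
  assumes "null_limit f" "g \<in> Lplus_functions M" "AE x in M. f x = g x"
  shows "null_limit g"
proof -
  obtain u where u: "\<And>n. u n \<in> D" "\<And>n x. 0 \<le> u n x" "(\<lambda>n. B (u n) (u n)) \<longlonglongrightarrow> 0"
    "AE x in M. (\<lambda>n. ennreal (u n x)) \<longlonglongrightarrow> f x"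
    using assms(1) unfolding null_limit_def by blast
  have "AE x in M. (\<lambda>n. ennreal (u n x)) \<longlonglongrightarrow> g x" using u(4) assms(3) by eventually_elim simp
  then show ?thesis unfolding null_limit_def using u assms(2) by blast
qed

lemma null_limit_zero: "null_limit (\<lambda>x. 0)"
  unfolding null_limit_def by (intro conjI exI[of _ "\<lambda>n. 0"]) auto

text \<open>When energies tend to 0, slowly growing multiples of a subsequence still have vanishing
  energy, while every eventual positive lower bound is driven to \<infinity>.\<close>

lemma null_limit_infinity:
  assumes u: "\<And>n. u n \<in> D" and lim: "(\<lambda>n. B (u n) (u n)) \<longlonglongrightarrow> 0"
    and pos: "AE x in M. \<exists>e>0. \<forall>\<^sub>F n in sequentially. e \<le> u n x"
  shows "null_limit (\<lambda>x. \<infinity>)"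
proof -
  \<comment> \<open>Multiplying by \<open>Suc n\<close> multiplies the energy by its square; the
    cube leaves \<open>1 / real (Suc n)\<close>.\<close>
  have "\<exists>k\<ge>n. B (u k) (u k) < 1 / real (Suc n) ^ 3" for n
  proof -
    have "0 < 1 / real (Suc n) ^ 3" by simp
    from order_tendstoD(2)[OF lim this] show ?thesis
      unfolding eventually_sequentially by (meson nle_le order_trans)
  qed
  then obtain k where k: "\<And>n. k n \<ge> n" "\<And>n. B (u (k n)) (u (k n)) < 1 / real (Suc n) ^ 3" by metis
  define v where "v n = (\<lambda>x. \<bar>(real (Suc n) *\<^sub>R u (k n)) x\<bar>)" for n
  have scaled: "real (Suc n) *\<^sub>R u (k n) \<in> D" for n using u by (intro form.D_scale)
  have v: "v n \<in> D" "\<And>x. 0 \<le> v n x" for n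
    using abs_D(1)[OF scaled] by (auto simp: v_def)
  have Bv: "B (v n) (v n) \<le> 1 / real (Suc n)" for n
  proof -
    have "B (v n) (v n) \<le> (real (Suc n))\<^sup>2 * B (u (k n)) (u (k n))"
      using abs_D(2)[OF scaled, of n] form.energy_scale[OF u] unfolding v_def by metis
    also have "\<dots> \<le> (real (Suc n))\<^sup>2 * (1 / real (Suc n) ^ 3)"
      using k(2)[of n] by (intro mult_left_mono) auto
    also have "\<dots> = 1 / real (Suc n)" by (simp add: power2_eq_square power3_eq_cube)
    finally show ?thesis .
  qed
  have B0: "(\<lambda>n. B (v n) (v n)) \<longlonglongrightarrow> 0" by (rule form.energy_null_mono[OF v(1) Bv inverse_Suc_tendsto_0])
  have "AE x in M. (\<lambda>n. ennreal (v n x)) \<longlonglongrightarrow> \<infinity>" using pos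
  proof eventually_elim
    case (elim x)
    then obtain e N where e: "e > 0" "\<And>n. n \<ge> N \<Longrightarrow> e \<le> u n x"
      by (auto simp: eventually_sequentially)
    have "filterlim (\<lambda>n. v n x) at_top sequentially"
    proof (rule filterlim_at_top_mono)
      show "filterlim (\<lambda>n. e * real n) at_top sequentially"
        using e(1) by (intro filterlim_tendsto_pos_mult_at_top[OF tendsto_const] filterlim_real_sequentially)
      show "\<forall>\<^sub>F n in sequentially. e * real n \<le> v n x"
        unfolding eventually_sequentially
      proof (intro exI[of _ N] allI impI)
        fix n assume "n \<ge> N"
        then have "e \<le> u (k n) x" using k(1)[of n] by (intro e(2)) simp
        then have "real n * e \<le> real (Suc n) * u (k n) x" using e(1) by (intro mult_mono) auto
        then show "e * real n \<le> v n x" by (simp add: v_def mult.commute)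
      qed
    qed
    then show ?case using v(2) by (simp add: ennreal_tendsto_top_eq_at_top)
  qed
  then show ?thesis unfolding null_limit_def using v B0 by (intro conjI exI[of _ v]) auto
qed

lemma tendsto_ennreal_eventually_ge:
  fixes c :: "nat \<Rightarrow> real"
  assumes "(\<lambda>n. ennreal (c n)) \<longlonglongrightarrow> y" "y > 0"
  shows "\<exists>e>0. \<forall>\<^sub>F n in sequentially. e \<le> c n"
proof -
  obtain z where z: "0 < z" "z < y" using assms(2) dense by blast
  then have "z < top" by (meson less_top order_less_le_trans top_greatest)
  then obtain e where e: "z = ennreal e" "e \<ge> 0" by (cases z) auto
  then have "e > 0" using z(1) by (simp add: ennreal_less_zero_iff)
  moreover have "\<forall>\<^sub>F n in sequentially. z < ennreal (c n)" using order_tendstoD(1)[OF assms(1) z(2)] .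
  then have "\<forall>\<^sub>F n in sequentially. e \<le> c n"
    by eventually_elim (use e in \<open>auto simp: ennreal_less_iff\<close>)
  ultimately show ?thesis by blast
qed

text \<open>As \<open>ennreal\<close> maps negative reals to 0, this concerns the positive part of
  \<open>f\<close>; taking positive parts of the approximating functions does not raise their
  energy.\<close>

lemma extended_kernel_positive_part:
  assumes f: "f \<in> L0_functions M" and ker: "extended_form M q f = 0"
  shows "null_limit (\<lambda>x. ennreal (f x))"
proof -
  obtain u where u: "\<And>n. u n \<in> D" "(\<lambda>n. B (u n) (u n)) \<longlonglongrightarrow> 0" "AE x in M. (\<lambda>n. u n x) \<longlonglongrightarrow> f x"
    using ker unfolding extended_form_zero_iff by blast
  let ?v = "\<lambda>n x. max (u n x) 0"
  have v: "?v n \<in> D" "B (?v n) (?v n) \<le> B (u n) (u n)" for n using energy_positive_part[OF u(1)] by auto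
  have "(\<lambda>n. B (?v n) (?v n)) \<longlonglongrightarrow> 0" by (rule form.energy_null_mono[OF v u(2)])
  moreover have "AE x in M. (\<lambda>n. ennreal (?v n x)) \<longlonglongrightarrow> ennreal (f x)" using u(3)
  proof eventually_elim
    case (elim x)
    have "ennreal (max y 0) = ennreal y" for y by (cases "y \<ge> 0") (auto simp: ennreal_neg)
    then show ?case using tendsto_ennrealI[OF elim] by simp
  qed
  ultimately show ?thesis
    unfolding null_limit_def using v(1) f by (intro conjI exI[of _ ?v]) auto
qed

lemma extended_kernel_of_null_limit:
  assumes f: "null_limit (\<lambda>x. ennreal (h x))" and h: "\<And>x. 0 \<le> h x"
  shows "extended_form M q h = 0"
proof -
  obtain u where u: "\<And>n. u n \<in> D" "\<And>n x. 0 \<le> u n x" "(\<lambda>n. B (u n) (u n)) \<longlonglongrightarrow> 0"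
    "AE x in M. (\<lambda>n. ennreal (u n x)) \<longlonglongrightarrow> ennreal (h x)"
    using f unfolding null_limit_def by blast
  have "AE x in M. (\<lambda>n. u n x) \<longlonglongrightarrow> h x" using u(4)
    by eventually_elim (use u(2) h in \<open>subst (asm) tendsto_ennreal_iff, auto\<close>)
  then show ?thesis unfolding extended_form_zero_iff using u by blast
qed

lemma extended_kernel_lincomb:
  assumes "extended_form M q f = 0" "extended_form M q g = 0"
  shows "extended_form M q (\<lambda>x. f x - c * g x) = 0"
proof -
  obtain u where u: "\<And>n. u n \<in> D" "(\<lambda>n. B (u n) (u n)) \<longlonglongrightarrow> 0" "AE x in M. (\<lambda>n. u n x) \<longlonglongrightarrow> f x"
    using assms(1) unfolding extended_form_zero_iff by blast
  obtain v where v: "\<And>n. v n \<in> D" "(\<lambda>n. B (v n) (v n)) \<longlonglongrightarrow> 0" "AE x in M. (\<lambda>n. v n x) \<longlonglongrightarrow> g x"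
    using assms(2) unfolding extended_form_zero_iff by blast
  let ?w = "\<lambda>n. u n - c *\<^sub>R v n"
  have w: "?w n \<in> D" for n using u v by simp
  have "(\<lambda>n. form.seminorm (u n) + \<bar>c\<bar> * form.seminorm (v n)) \<longlonglongrightarrow> 0 + \<bar>c\<bar> * 0"
    using u v form.tendsto_energy_zero_iff by (intro tendsto_intros) blast+
  then have l0: "(\<lambda>n. form.seminorm (u n) + \<bar>c\<bar> * form.seminorm (v n)) \<longlonglongrightarrow> 0" by simp
  have "(\<lambda>n. form.seminorm (?w n)) \<longlonglongrightarrow> 0"
  proof (rule Lim_null_comparison[OF always_eventually[OF allI] l0])
    fix n
    show "norm (form.seminorm (?w n)) \<le> form.seminorm (u n) + \<bar>c\<bar> * form.seminorm (v n)"
      using form.seminorm_diff[OF u(1) form.D_scale[OF v(1)], of n c n] form.seminorm_nonneg[OF w[of n]]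
      unfolding form.seminorm_scale[OF v(1)] by simp
  qed
  then have "(\<lambda>n. B (?w n) (?w n)) \<longlonglongrightarrow> 0" using form.tendsto_energy_zero_iff[of ?w] w by blast
  moreover have "AE x in M. (\<lambda>n. ?w n x) \<longlonglongrightarrow> f x - c * g x" using u(3) v(3)
  proof eventually_elim
    case (elim x)
    have "(\<lambda>n. u n x - c * v n x) \<longlonglongrightarrow> f x - c * g x" by (intro tendsto_intros elim)
    then show ?case by simp
  qed
  ultimately show ?thesis unfolding extended_form_zero_iff using w by (intro exI[of _ ?w] conjI allI)
qed

text \<open>By Fatou's lemma the lower limit of the weighted squares of the approximating functions
  has integral 0, although it is positive wherever \<open>f\<close> is.\<close>

lemma subcritical_imp_null_limit_zero:
  assumes sub: "subcritical M q" and f: "null_limit f"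
  shows "AE x in M. f x = 0"
proof -
  obtain w where w: "w \<in> L0_functions M" "AE x in M. 0 < w x"
    and Hardy: "\<And>g. g \<in> D \<Longrightarrow> (\<integral>\<^sup>+x. ennreal (\<bar>g x\<bar>\<^sup>2 * w x) \<partial>M) \<le> q g"
    using sub unfolding subcritical_def strictly_positive_def by blast
  obtain u where u: "\<And>n. u n \<in> D" "\<And>n x. 0 \<le> u n x" "(\<lambda>n. B (u n) (u n)) \<longlonglongrightarrow> 0"
    "AE x in M. (\<lambda>n. ennreal (u n x)) \<longlonglongrightarrow> f x"
    using f unfolding null_limit_def by blast
  note [measurable] = w(1) D_measurable[OF u(1)]
  let ?F = "\<lambda>n x. ennreal (\<bar>u n x\<bar>\<^sup>2 * w x)"
  have "(\<lambda>n. q (u n)) \<longlonglongrightarrow> 0" using tendsto_ennrealI[OF u(3)] u(1) by (simp add: q_eq)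
  then have "liminf (\<lambda>n. q (u n)) = 0" by (intro lim_imp_Liminf) auto
  then have "(\<integral>\<^sup>+x. liminf (\<lambda>n. ?F n x) \<partial>M) \<le> 0"
    using order_trans[OF nn_integral_liminf[of ?F M] Liminf_mono[of "\<lambda>n. integral\<^sup>N M (?F n)" "\<lambda>n. q (u n)" sequentially]]
      Hardy[OF u(1)] by simp
  then have "AE x in M. liminf (\<lambda>n. ?F n x) = 0"
    by (subst (asm) le_zero_eq, subst (asm) nn_integral_0_iff_AE) auto
  with u(4) w(2) show ?thesis
  proof eventually_elim
    case (elim x)
    show ?case
    proof (rule ccontr)
      assume "f x \<noteq> 0"
      then obtain e where e: "e > 0" "\<forall>\<^sub>F n in sequentially. e \<le> u n x"
        using tendsto_ennreal_eventually_ge[OF elim(1)] by (auto simp: zero_less_iff_neq_zero)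
      have "\<forall>\<^sub>F n in sequentially. ennreal (e\<^sup>2 * w x) \<le> ?F n x" using e(2)
      proof eventually_elim
        case (elim n)
        then have "e\<^sup>2 \<le> \<bar>u n x\<bar>\<^sup>2" using e(1) by (intro power_mono) auto
        then show ?case using \<open>0 < w x\<close> by (intro ennreal_leI mult_right_mono) auto
      qed
      then have "ennreal (e\<^sup>2 * w x) \<le> liminf (\<lambda>n. ?F n x)" by (rule Liminf_bounded)
      then have "e\<^sup>2 * w x \<le> 0" using elim(3) by (simp add: ennreal_eq_0_iff)
      then show False using e(1) elim(2) by (simp add: mult_le_0_iff)
    qed
  qed
qed

end

section \<open>Strictly positive functions, Hardy weights and the three alternatives\<close>

context irreducible_positivity_preserving_form
begin

lemma AE_contradiction: "AE x in M. P x \<Longrightarrow> AE x in M. \<not> P x \<Longrightarrow> False"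
proof -
  assume "AE x in M. P x" "AE x in M. \<not> P x"
  then have "AE x in M. False" by eventually_elim simp
  then have "space M \<in> null_sets M" using AE_iff_null[of M "\<lambda>x. False"] by simp
  then show False using nontrivial by (simp add: null_sets_def)
qed

lemma AE_pos_imp_not_AE_zero:
  fixes f :: "'a \<Rightarrow> real"
  assumes "AE x in M. 0 < f x"
  shows "\<not> (AE x in M. f x = 0)"
proof
  assume "AE x in M. f x = 0"
  then have "AE x in M. \<not> 0 < f x" by eventually_elim simp
  then show False by (rule AE_contradiction[OF assms])
qed

lemma exists_nonzero_in_domain:
  obtains f where "f \<in> D" "\<And>x. 0 \<le> f x" "\<not> (AE x in M. f x = 0)"
proof -
  obtain w :: "'a \<Rightarrow> real" where w: "w \<in> borel_measurable M" "\<And>x. w x > 0" "\<And>x. w x \<le> 1" "integrable M w"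
    using obtain_positive_integrable_function by blast
  have "integrable M (\<lambda>x. (w x)\<^sup>2)"
  proof (rule Bochner_Integration.integrable_bound[OF w(4)])
    have "(w x)\<^sup>2 \<le> w x" for x
      using w(2)[of x] w(3)[of x] by (simp add: power2_eq_square mult_left_le)
    then show "AE x in M. norm ((w x)\<^sup>2) \<le> norm (w x)" using w(2) by (simp add: less_imp_le)
  qed (use w in simp)
  then have wL: "w \<in> L2_functions M" using w(1) by (simp add: L2_functions_def)
  have "L2_norm M w \<noteq> 0"
    using L2_norm_eq_0_AE[OF wL] AE_pos_imp_not_AE_zero[of w] w(2) by auto
  then have "L2_norm M w > 0" using L2.seminorm_nonneg[OF wL] by simp
  then obtain g where g: "g \<in> D" "L2_norm M (\<lambda>x. w x - g x) < L2_norm M w"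
    using dense wL unfolding densely_defined_def by blast
  have "\<not> (AE x in M. g x = 0)"
  proof
    assume "AE x in M. g x = 0"
    then have "L2_norm M (\<lambda>x. w x - g x) = L2_norm M w"
      using w(1) g(1) by (intro L2_norm_cong_AE) auto
    then show False using g(2) by simp
  qed
  then show ?thesis using that[of "\<lambda>x. \<bar>g x\<bar>"] abs_D(1)[OF g(1)] by auto
qed

lemma L2_inner_self_nonzero:
  assumes "f \<in> L2_functions M" "\<not> (AE x in M. f x = 0)"
  shows "L2_inner M f f \<noteq> 0"
  using L2_norm_eq_0_AE[OF assms(1)] L2.seminorm_sq[OF assms(1)] assms(2) by auto

text \<open>Density gives some nonzero nonnegative \<open>f\<close> in the domain. Solving the
  equation with \<alpha> = 1 and right-hand side \<open>f\<close> spreads it over the whole space,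
  by irreducibility.\<close>

lemma exists_positive_in_domain:
  obtains \<rho> where "\<rho> \<in> D" "\<And>x. 0 \<le> \<rho> x" "AE x in M. 0 < \<rho> x"
proof -
  obtain f where f: "f \<in> D" "\<And>x. 0 \<le> f x" "\<not> (AE x in M. f x = 0)" using exists_nonzero_in_domain by blast
  have f0: "AE x in M. 0 \<le> f x" using f(2) by simp
  obtain \<rho> where \<rho>: "solution 1 (\<lambda>h. L2_inner M f h) \<rho>"
    by (rule solution_L2_exists[OF zero_less_one D_L2[OF f(1)] f0])
  have "\<not> (AE x in M. \<rho> x = 0)"
    using solution_null[OF \<rho> _ f(1)] L2_inner_self_nonzero[OF D_L2[OF f(1)] f(3)] by blast
  then have "AE x in M. 0 < \<rho> x"
    using solution_zero_or_positive[OF \<rho> positive_functional_L2_inner[OF D_L2[OF f(1)] f0]] by simp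
  moreover have "\<rho> \<in> D" "\<And>x. 0 \<le> \<rho> x" using \<rho> by (auto simp: solution_def)
  ultimately show ?thesis using that by blast
qed

lemma null_limit_infinity_of_nonzero:
  assumes f: "null_limit f" "\<not> (AE x in M. f x = 0)"
  shows "null_limit (\<lambda>x. \<infinity>)"
proof -
  obtain u where u: "\<And>n. u n \<in> D" "\<And>n x. 0 \<le> u n x" "(\<lambda>n. B (u n) (u n)) \<longlonglongrightarrow> 0"
    "AE x in M. (\<lambda>n. ennreal (u n x)) \<longlonglongrightarrow> f x"
    using f(1) unfolding null_limit_def by blast
  have pos: "AE x in M. 0 < f x" using supermedian_positive[OF supermedian_null_limit[OF f(1)]] f(2) by blast
  have "AE x in M. \<exists>e>0. \<forall>\<^sub>F n in sequentially. e \<le> u n x" using u(4) pos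
    by eventually_elim (rule tendsto_ennreal_eventually_ge)
  then show ?thesis by (rule null_limit_infinity[OF u(1,3)])
qed

text \<open>Minimize the energy over \<open>{v. \<rho> \<le> v}\<close> and put \<open>l f = lim q(v\<^sub>n, f)\<close> along a minimizing sequence. The
  infimum is positive because otherwise multiples of the \<open>v\<^sub>n\<close> would tend to \<open>\<infinity>\<close>.\<close>

lemma bounded_positive_functional:
  assumes "\<not> null_limit (\<lambda>x. \<infinity>)"
  obtains l C f where "positive_functional l" "\<And>f. f \<in> D \<Longrightarrow> \<bar>l f\<bar> \<le> C * form.seminorm f" "f \<in> D" "l f \<noteq> 0"
proof -
  obtain \<rho> where \<rho>: "\<rho> \<in> D" "\<And>x. 0 \<le> \<rho> x" "AE x in M. 0 < \<rho> x" using exists_positive_in_domain by blast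
  define S where "S = {v \<in> D. AE x in M. \<rho> x \<le> v x}"
  have S_sub: "S \<subseteq> D" and S_ne: "S \<noteq> {}" using \<rho> by (auto simp: S_def)
  have S_conv: "convex S"
  proof (rule convexI)
    fix a b and s t :: real assume ab: "a \<in> S" "b \<in> S" and st: "0 \<le> s" "0 \<le> t" "s + t = 1"
    have "AE x in M. \<rho> x \<le> a x" "AE x in M. \<rho> x \<le> b x" using ab by (auto simp: S_def)
    then have "AE x in M. \<rho> x \<le> (s *\<^sub>R a + t *\<^sub>R b) x"
    proof eventually_elim
      case (elim x)
      have "s * \<rho> x + t * \<rho> x \<le> s * a x + t * b x" using elim st by (intro add_mono mult_left_mono)
      then show ?case using st(3) by (simp flip: distrib_right)
    qed
    then show "s *\<^sub>R a + t *\<^sub>R b \<in> S" using ab by (simp add: S_def)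
  qed
  \<comment> \<open>The term \<open>2 * 0\<close> fits the statement to
    \<open>minimizing_sequence\<close> with the zero functional.\<close>
  have ge0: "0 \<le> B a a - 2 * 0" if "a \<in> S" for a using S_sub that form.nonneg by auto
  obtain v I where "\<And>n. v n \<in> S" and C: "form.Cauchy_seq v" and "(\<lambda>n. B (v n) (v n) - 2 * 0) \<longlonglongrightarrow> I"
    and "\<And>a. a \<in> S \<Longrightarrow> I \<le> B a a - 2 * 0"
    by (rule form.minimizing_sequence[OF S_sub S_ne S_conv _ _ ge0]) (auto intro: that)
  then have vS: "\<And>n. v n \<in> S" and lim: "(\<lambda>n. B (v n) (v n)) \<longlonglongrightarrow> I" and I: "\<And>a. a \<in> S \<Longrightarrow> I \<le> B a a"
    by simp_all
  have vD: "v n \<in> D" and v\<rho>: "AE x in M. \<rho> x \<le> v n x" for n using vS[of n] by (auto simp: S_def)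
  have "I \<ge> 0" using LIMSEQ_le_const[OF lim, of 0] form.nonneg[OF vD] by blast
  moreover have "I \<noteq> 0"
  proof
    assume "I = 0"
    have "AE x in M. \<forall>n. \<rho> x \<le> v n x" using v\<rho> by (simp add: AE_all_countable)
    then have "AE x in M. \<exists>e>0. \<forall>\<^sub>F n in sequentially. e \<le> v n x"
      using \<rho>(3) by eventually_elim (auto intro!: always_eventually)
    then have "null_limit (\<lambda>x. \<infinity>)" by (rule null_limit_infinity[OF vD lim[unfolded \<open>I = 0\<close>]])
    then show False using assms by simp
  qed
  ultimately have I_pos: "I > 0" by simp
  obtain K where K: "\<And>n. form.seminorm (v n) \<le> K" "K \<ge> 0" using form.Cauchy_seq_bounded[OF C vD] by blast
  \<comment> \<open>The \<open>v n\<close> are Cauchy for the form alone and may have no limit in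
    \<open>D\<close>; what survives is the functional that such a limit would represent.\<close>
  define l where "l f = lim (\<lambda>n. B (v n) f)" for f
  have l_lim: "(\<lambda>n. B (v n) f) \<longlonglongrightarrow> l f" if f: "f \<in> D" for f
  proof -
    have "Cauchy (\<lambda>n. B (v n) f)"
    proof (rule CauchyI)
      fix e :: real assume e: "e > 0"
      let ?s = "form.seminorm f + 1"
      have s: "?s > 0" using form.seminorm_nonneg[OF f] by simp
      obtain N where N: "\<forall>m\<ge>N. \<forall>n\<ge>N. form.seminorm (v m - v n) < e / ?s"
        using C e s unfolding form.Cauchy_seq_def by (meson divide_pos_pos)
      show "\<exists>N. \<forall>m\<ge>N. \<forall>n\<ge>N. norm (B (v m) f - B (v n) f) < e"
      proof (intro exI[of _ N] allI impI)
        fix m n assume "N \<le> m" "N \<le> n"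
        then have lt: "form.seminorm (v m - v n) < e / ?s" using N by blast
        have "\<bar>B (v m - v n) f\<bar> \<le> form.seminorm (v m - v n) * form.seminorm f"
          using vD f by (intro form.Cauchy_Schwarz form.D_diff)
        also have "\<dots> \<le> form.seminorm (v m - v n) * ?s"
          using form.seminorm_nonneg[OF form.D_diff[OF vD vD]] by (intro mult_left_mono) auto
        also have "\<dots> < e" using lt s by (simp add: field_simps)
        finally show "norm (B (v m) f - B (v n) f) < e" using form.diff_left[OF vD vD f] by simp
      qed
    qed
    then show ?thesis unfolding l_def by (simp add: Cauchy_convergent_iff convergent_LIMSEQ_iff)
  qed
  have l_add: "l (f + g) = l f + l g" if "f \<in> D" "g \<in> D" for f g
  proof (rule LIMSEQ_unique[OF l_lim])
    show "(\<lambda>n. B (v n) (f + g)) \<longlonglongrightarrow> l f + l g"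
      unfolding form.add_right[OF that vD] by (intro tendsto_add l_lim that)
  qed (use that in simp)
  have l_scale: "l (c *\<^sub>R f) = c * l f" if "f \<in> D" for f c
  proof (rule LIMSEQ_unique[OF l_lim])
    show "(\<lambda>n. B (v n) (c *\<^sub>R f)) \<longlonglongrightarrow> c * l f"
      unfolding form.scale_right[OF that vD] by (intro tendsto_mult_left l_lim that)
  qed (use that in simp)
  \<comment> \<open>Adding a nonnegative multiple of \<open>f\<close> keeps \<open>v n\<close> above
    \<rho>, so the limiting energy has a nonnegative first variation in the direction
    \<open>f\<close>.\<close>
  have l_pos: "0 \<le> l f" if f: "f \<in> D" "AE x in M. 0 \<le> f x" for f
  proof (rule quadratic_nonneg_imp_nonneg[OF form.nonneg[OF f(1)]])
    fix s :: real assume s: "0 < s"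
    have "I \<le> I + 2 * (s * l f) + s\<^sup>2 * B f f"
    proof (rule LIMSEQ_le_const)
      show "(\<lambda>n. B (v n) (v n) + 2 * (s * B (v n) f) + s\<^sup>2 * B f f) \<longlonglongrightarrow> I + 2 * (s * l f) + s\<^sup>2 * B f f"
        by (intro tendsto_intros lim l_lim f)
      show "\<exists>N. \<forall>n\<ge>N. I \<le> B (v n) (v n) + 2 * (s * B (v n) f) + s\<^sup>2 * B f f"
      proof (intro exI[of _ 0] allI impI)
        fix n
        have "AE x in M. \<rho> x \<le> (v n + s *\<^sub>R f) x" using v\<rho>[of n] f(2)
        proof eventually_elim
          case (elim x)
          have "0 \<le> s * f x" using s elim(2) by simp
          then show ?case using elim(1) by simp
        qed
        then have "v n + s *\<^sub>R f \<in> S" using vD f by (simp add: S_def)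
        then have "I \<le> B (v n + s *\<^sub>R f) (v n + s *\<^sub>R f)" by (rule I)
        then show "I \<le> B (v n) (v n) + 2 * (s * B (v n) f) + s\<^sup>2 * B f f"
          unfolding form.energy_add[OF vD form.D_scale[OF f(1)]] form.energy_scale[OF f(1)] form.scale_right[OF f(1) vD] .
      qed
    qed
    then show "0 \<le> 2 * s * l f + s\<^sup>2 * B f f" by simp
  qed
  have l_bd: "\<bar>l f\<bar> \<le> K * form.seminorm f" if f: "f \<in> D" for f
  proof (rule LIMSEQ_le_const2[OF tendsto_rabs[OF l_lim[OF f]]])
    have "\<bar>B (v n) f\<bar> \<le> K * form.seminorm f" for n
      using form.Cauchy_Schwarz[OF vD f, of n] mult_right_mono[OF K(1) form.seminorm_nonneg[OF f], of n] by linarith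
    then show "\<exists>N. \<forall>n\<ge>N. \<bar>B (v n) f\<bar> \<le> K * form.seminorm f" by blast
  qed
  \<comment> \<open>This \<open>v m\<close> witnesses that \<open>l\<close> is nonzero: midpoints of
    \<open>v n\<close> and \<open>v m\<close> have energy at least \<open>I\<close>, which bounds
    \<open>l (v m)\<close> from below by a quantity that is positive once
    \<open>B (v m) (v m) < 3 * I\<close>.\<close>
  obtain m where m: "B (v m) (v m) < 2 * I"
    using order_tendstoD(2)[OF lim, of "2 * I"] I_pos by (auto simp: eventually_sequentially)
  have "2 * I - (I + B (v m) (v m)) / 2 \<le> l (v m)"
  proof (rule LIMSEQ_le)
    show "(\<lambda>n. 2 * I - (B (v n) (v n) + B (v m) (v m)) / 2) \<longlonglongrightarrow> 2 * I - (I + B (v m) (v m)) / 2"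
      by (intro tendsto_intros lim) simp
    show "(\<lambda>n. B (v n) (v m)) \<longlonglongrightarrow> l (v m)" by (rule l_lim[OF vD])
    show "\<exists>N. \<forall>n\<ge>N. 2 * I - (B (v n) (v n) + B (v m) (v m)) / 2 \<le> B (v n) (v m)"
    proof (intro exI[of _ 0] allI impI)
      fix n
      let ?w = "(1/2) *\<^sub>R (v n + v m)"
      have "?w = (1/2) *\<^sub>R v n + (1/2) *\<^sub>R v m" by (rule scaleR_add_right)
      then have "?w \<in> S" using convexD[OF S_conv vS vS, of "1/2" "1/2" n m] by simp
      then have "I \<le> B ?w ?w" by (rule I)
      also have "\<dots> = (B (v n) (v n) + 2 * B (v n) (v m) + B (v m) (v m)) / 4"
        unfolding form.energy_scale[OF form.D_add[OF vD vD]] form.energy_add[OF vD vD] by (simp add: power2_eq_square)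
      finally show "2 * I - (B (v n) (v n) + B (v m) (v m)) / 2 \<le> B (v n) (v m)" by (simp add: field_simps)
    qed
  qed
  then have "l (v m) \<noteq> 0" using m I_pos by (auto simp: field_simps)
  moreover have "positive_functional l" using l_add l_scale l_pos by (simp add: positive_functional_def)
  ultimately show ?thesis using that l_bd vD by blast
qed

text \<open>Replaces the abstract functional by integration against a function: the weak equation
  expresses the inner product of \<phi> and \<open>g\<close> as \<open>l g - B \<phi> g\<close>, and
  Cauchy-Schwarz bounds the second term like the first. Strict positivity of \<phi> comes from
  irreducibility and from \<open>l\<close> being nonzero.\<close>

lemma bounded_density:
  assumes "\<not> null_limit (\<lambda>x. \<infinity>)"
  obtains \<phi> C where "\<phi> \<in> D" "\<And>x. 0 \<le> \<phi> x" "AE x in M. 0 < \<phi> x" "C \<ge> 0"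
    "\<And>f. f \<in> D \<Longrightarrow> \<bar>L2_inner M \<phi> f\<bar> \<le> C * form.seminorm f"
proof -
  obtain l C f where l: "positive_functional l" "\<And>f. f \<in> D \<Longrightarrow> \<bar>l f\<bar> \<le> C * form.seminorm f" "f \<in> D" "l f \<noteq> 0"
    by (rule bounded_positive_functional[OF assms]) blast
  have "\<bar>l f\<bar> \<le> \<bar>C\<bar> * sqrt (energy 1 f)" if f: "f \<in> D" for f
  proof -
    have "form.seminorm f \<le> sqrt (energy 1 f)"
      using L2.nonneg[OF D_L2[OF f]] by (simp add: form.seminorm_def energy_def)
    then have "\<bar>C\<bar> * form.seminorm f \<le> \<bar>C\<bar> * sqrt (energy 1 f)" by (rule mult_left_mono) simp
    moreover have "C * form.seminorm f \<le> \<bar>C\<bar> * form.seminorm f"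
      using form.seminorm_nonneg[OF f] by (intro mult_right_mono) auto
    ultimately show ?thesis using l(2)[OF f] by linarith
  qed
  then obtain \<phi> where \<phi>: "solution 1 l \<phi>" using solution_exists[OF zero_less_one l(1)] by blast
  then have \<phi>D: "\<phi> \<in> D" "\<And>x. 0 \<le> \<phi> x" and EL: "\<And>g. g \<in> D \<Longrightarrow> B \<phi> g + 1 * L2_inner M \<phi> g = l g"
    by (auto simp: solution_def)
  have "\<not> (AE x in M. \<phi> x = 0)" using solution_null[OF \<phi> _ l(3)] l(4) by blast
  then have pos: "AE x in M. 0 < \<phi> x" using solution_zero_or_positive[OF \<phi> l(1)] by simp
  have "\<bar>L2_inner M \<phi> g\<bar> \<le> (\<bar>C\<bar> + form.seminorm \<phi>) * form.seminorm g" if g: "g \<in> D" for g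
  proof -
    have "C * form.seminorm g \<le> \<bar>C\<bar> * form.seminorm g"
      using form.seminorm_nonneg[OF g] by (intro mult_right_mono) auto
    then show ?thesis
      using EL[OF g] l(2)[OF g] form.Cauchy_Schwarz[OF \<phi>D(1) g] unfolding distrib_right by linarith
  qed
  then show ?thesis
    using that[OF \<phi>D pos, of "\<bar>C\<bar> + form.seminorm \<phi>"] form.seminorm_nonneg[OF \<phi>D(1)] by simp
qed

lemma subcritical_and_excessive:
  assumes "\<not> null_limit (\<lambda>x. \<infinity>)"
  shows "subcritical M q" "\<exists>h. excessive M q h \<and> \<not> (AE x in M. h x = 0)"
proof -
  obtain \<phi> C where \<phi>: "\<phi> \<in> D" "\<And>x. 0 \<le> \<phi> x" "AE x in M. 0 < \<phi> x" and C: "C \<ge> 0"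
    "\<And>f. f \<in> D \<Longrightarrow> \<bar>L2_inner M \<phi> f\<bar> \<le> C * form.seminorm f"
    by (rule bounded_density[OF assms]) blast
  let ?l = "\<lambda>f. L2_inner M \<phi> f"
  have \<phi>0: "AE x in M. 0 \<le> \<phi> x" using \<phi>(2) by simp
  note pf = positive_functional_L2_inner[OF D_L2[OF \<phi>(1)] \<phi>0]
  define \<alpha> where "\<alpha> n = 1 / real (Suc n)" for n
  have \<alpha>: "\<alpha> n > 0" "\<alpha> (Suc n) < \<alpha> n" for n by (auto simp: \<alpha>_def field_simps)
  have \<alpha>_lim: "\<alpha> \<longlonglongrightarrow> 0"
    unfolding \<alpha>_def by (rule inverse_Suc_tendsto_0)
  have "\<exists>u. solution (\<alpha> n) ?l u" for n
    using solution_L2_exists[OF \<alpha>(1) D_L2[OF \<phi>(1)] \<phi>0] by blast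
  then obtain u where u: "\<And>n. solution (\<alpha> n) ?l (u n)" by metis
  have uD: "u n \<in> D" "\<And>x. 0 \<le> u n x" for n using u[of n] by (auto simp: solution_def)
  note [measurable] = D_measurable[OF uD(1)] D_measurable[OF \<phi>(1)]
  have "\<not> (AE x in M. \<phi> x = 0)" by (rule AE_pos_imp_not_AE_zero[OF \<phi>(3)])
  then have "?l \<phi> \<noteq> 0" using L2_inner_self_nonzero[OF D_L2[OF \<phi>(1)]] by simp
  then have u_pos: "AE x in M. 0 < u n x" for n
    using solution_zero_or_positive[OF u pf less_imp_le[OF \<alpha>(1)]] solution_null[OF u _ \<phi>(1)] by blast
  have u_mono: "AE x in M. \<forall>n. u n x \<le> u (Suc n) x"
    using solution_antimono[OF u u \<alpha>(1) \<alpha>(2)] by (simp add: AE_all_countable)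
  \<comment> \<open>Testing the equation with \<open>u n\<close> itself shows that its energy is at
    most \<open>?l (u n)\<close>, which is at most \<open>C\<close> times the seminorm of
    \<open>u n\<close>. So that seminorm is at most \<open>C\<close>, whatever \<alpha> is.\<close>
  have u_bd: "?l (u n) \<le> C\<^sup>2" for n
  proof -
    have "B (u n) (u n) + \<alpha> n * L2_inner M (u n) (u n) = ?l (u n)" using u[of n] uD by (simp add: solution_def)
    moreover have "0 \<le> \<alpha> n * L2_inner M (u n) (u n)" using \<alpha>(1)[of n] L2.nonneg[OF D_L2[OF uD(1)]] by simp
    ultimately have "(form.seminorm (u n))\<^sup>2 \<le> ?l (u n)" using form.seminorm_sq[OF uD(1)] by simp
    moreover have le: "?l (u n) \<le> C * form.seminorm (u n)" using C(2)[OF uD(1)[of n]] by simp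
    ultimately have "form.seminorm (u n) * form.seminorm (u n) \<le> C * form.seminorm (u n)" by (simp add: power2_eq_square)
    then have "form.seminorm (u n) \<le> C"
      using C(1) form.seminorm_nonneg[OF uD(1)[of n]] by (cases "form.seminorm (u n) = 0") auto
    then have "C * form.seminorm (u n) \<le> C * C" using C(1) by (rule mult_left_mono)
    then show ?thesis using le by (simp add: power2_eq_square)
  qed
  \<comment> \<open>The supremum is formed in [0, \<infinity>]. Fatou's lemma and
    \<open>u_bd\<close> bound the integral of \<phi> times \<open>g\<close>, and since \<phi> is
    a.e. positive, \<open>g\<close> is a.e. finite.\<close>
  define g where "g x = (SUP n. ennreal (u n x))" for x
  have [measurable]: "g \<in> Lplus_functions M" unfolding g_def[abs_def] by measurable
  have u_lim: "AE x in M. (\<lambda>n. ennreal (u n x)) \<longlonglongrightarrow> g x" using u_mono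
  proof eventually_elim
    case (elim x)
    have "incseq (\<lambda>n. ennreal (u n x))" using elim by (intro incseq_SucI ennreal_leI) auto
    then show ?case unfolding g_def by (rule LIMSEQ_SUP)
  qed
  have u_le_g: "ennreal (u n x) \<le> g x" for n x unfolding g_def by (rule SUP_upper) simp
  have "(\<integral>\<^sup>+x. ennreal (\<phi> x) * g x \<partial>M) = (\<integral>\<^sup>+x. liminf (\<lambda>n. ennreal (\<phi> x) * ennreal (u n x)) \<partial>M)"
  proof (rule nn_integral_cong_AE)
    show "AE x in M. ennreal (\<phi> x) * g x = liminf (\<lambda>n. ennreal (\<phi> x) * ennreal (u n x))" using u_lim
    proof eventually_elim
      case (elim x)
      have "(\<lambda>n. ennreal (\<phi> x) * ennreal (u n x)) \<longlonglongrightarrow> ennreal (\<phi> x) * g x"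
        using elim by (intro ennreal_tendsto_cmult) auto
      then show ?case by (intro lim_imp_Liminf[symmetric]) auto
    qed
  qed
  also have "\<dots> \<le> liminf (\<lambda>n. \<integral>\<^sup>+x. ennreal (\<phi> x) * ennreal (u n x) \<partial>M)"
    by (rule nn_integral_liminf) measurable
  also have "\<dots> \<le> limsup (\<lambda>n. \<integral>\<^sup>+x. ennreal (\<phi> x) * ennreal (u n x) \<partial>M)" by (rule Liminf_le_Limsup) simp
  also have "\<dots> \<le> ennreal (C\<^sup>2)"
  proof (rule Limsup_bounded, rule always_eventually, rule allI)
    fix n
    have "(\<integral>\<^sup>+x. ennreal (\<phi> x) * ennreal (u n x) \<partial>M) = (\<integral>\<^sup>+x. ennreal (\<phi> x * u n x) \<partial>M)"
      using \<phi>(2) uD(2) by (simp add: ennreal_mult)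
    also have "\<dots> = ennreal (?l (u n))"
      unfolding L2_inner_def using \<phi>(1,2) uD
      by (intro nn_integral_eq_integral L2_mult_integrable) auto
    finally show "(\<integral>\<^sup>+x. ennreal (\<phi> x) * ennreal (u n x) \<partial>M) \<le> ennreal (C\<^sup>2)" using u_bd[of n] by (simp add: ennreal_leI)
  qed
  finally have "(\<integral>\<^sup>+x. ennreal (\<phi> x) * g x \<partial>M) \<noteq> \<infinity>" by (auto simp: top_unique)
  then have "AE x in M. ennreal (\<phi> x) * g x \<noteq> \<infinity>" by (intro nn_integral_noteq_infinite) auto
  then have g_fin: "AE x in M. g x < \<infinity>" using \<phi>(3)
    by eventually_elim (auto simp: ennreal_mult_eq_top_iff less_top[symmetric])
  define h where "h x = enn2real (g x)" for x
  have [measurable]: "h \<in> L0_functions M" unfolding h_def[abs_def] by measurable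
  have h_nn: "0 \<le> h x" for x by (simp add: h_def)
  have gh: "AE x in M. g x = ennreal (h x)" using g_fin by eventually_elim (simp add: h_def)
  have u_le_h: "AE x in M. \<forall>n. u n x \<le> h x" using gh
  proof eventually_elim
    case (elim x)
    then show ?case using u_le_g[of _ x] h_nn[of x] by (simp add: ennreal_le_iff)
  qed
  have h_pos: "AE x in M. 0 < h x" using u_le_h u_pos[of 0] by eventually_elim (auto intro: less_le_trans)
  let ?w = "\<lambda>x. \<phi> x / (8 * h x)"
  \<comment> \<open>Since \<open>u n \<le> h\<close> a.e., the weight is below each of the weights
    that the Hardy inequality yields for \<open>u n\<close>. The shift \<alpha> is then sent to 0
    while the weight stays fixed.\<close>
  show "subcritical M q" unfolding subcritical_def
  proof (intro bexI[of _ ?w] conjI ballI)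
    show "strictly_positive M ?w"
      unfolding strictly_positive_def using \<phi>(3) h_pos by eventually_elim simp
    fix f assume f: "f \<in> D"
    have le: "(\<integral>\<^sup>+x. ennreal (\<bar>f x\<bar>\<^sup>2 * ?w x) \<partial>M) \<le> ennreal (energy (\<alpha> n) f)" for n
    proof -
      have "(\<integral>\<^sup>+x. ennreal (\<bar>f x\<bar>\<^sup>2 * ?w x) \<partial>M) \<le> (\<integral>\<^sup>+x. ennreal ((f x)\<^sup>2 * (\<phi> x / (8 * u n x))) \<partial>M)"
      proof (rule nn_integral_mono_AE)
        show "AE x in M. ennreal (\<bar>f x\<bar>\<^sup>2 * ?w x) \<le> ennreal ((f x)\<^sup>2 * (\<phi> x / (8 * u n x)))"
          using u_le_h u_pos[of n]
        proof eventually_elim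
          case (elim x)
          have "\<phi> x / (8 * h x) \<le> \<phi> x / (8 * u n x)"
            using elim \<phi>(2)[of x] by (intro divide_left_mono) (auto intro!: mult_pos_pos intro: less_le_trans)
          then have "(f x)\<^sup>2 * (\<phi> x / (8 * h x)) \<le> (f x)\<^sup>2 * (\<phi> x / (8 * u n x))" by (rule mult_left_mono) simp
          then show ?case unfolding power2_abs by (rule ennreal_leI)
        qed
      qed
      also have "\<dots> \<le> ennreal (energy (\<alpha> n) f)"
        using \<alpha>(1)[of n] by (intro Hardy_inequality[OF u _ D_L2[OF \<phi>(1)] \<phi>0 u_pos f]) simp
      finally show ?thesis .
    qed
    have "(\<lambda>n. energy (\<alpha> n) f) \<longlonglongrightarrow> B f f + 0 * L2_inner M f f"
      unfolding energy_def by (intro tendsto_intros \<alpha>_lim)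
    then have "(\<lambda>n. ennreal (energy (\<alpha> n) f)) \<longlonglongrightarrow> ennreal (B f f)" by (intro tendsto_ennrealI) simp
    then have "(\<integral>\<^sup>+x. ennreal (\<bar>f x\<bar>\<^sup>2 * ?w x) \<partial>M) \<le> ennreal (B f f)"
      using le by (intro LIMSEQ_le_const) auto
    then show "(\<integral>\<^sup>+x. ennreal (\<bar>f x\<bar>\<^sup>2 * ?w x) \<partial>M) \<le> q f" using f by (simp add: q_eq)
  qed measurable
  \<comment> \<open>Apply \<open>energy_split\<close> at \<open>t = 1\<close>: cutting off at
    \<open>u n\<close> does not raise the shifted energy, and the shift vanishes in the
    limit.\<close>
  have "supermedian (\<lambda>x. ennreal (h x))" unfolding supermedian_def
  proof (intro conjI ballI impI)
    show hm: "(\<lambda>x. ennreal (h x)) \<in> Lplus_functions M" by measurable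
    fix f assume f: "f \<in> D" "\<forall>x. 0 \<le> f x"
    let ?a = "\<lambda>n. trunc f (\<lambda>x. ennreal (u n x))"
    have a_eq: "?a n = (\<lambda>x. min (f x) (1 * u n x))" for n
      using f(2) uD(2) by (intro ext) (simp add: trunc_real)
    have a: "?a n \<in> D" "B (?a n) (?a n) \<le> energy (\<alpha> n) f" for n
    proof -
      note s = energy_split[OF u[of n] f(1) _ zero_le_one, folded a_eq]
      show aD: "?a n \<in> D" using s(1) f(2) by blast
      have "energy (\<alpha> n) (?a n) + energy (\<alpha> n) (f - ?a n) + 2 * 1 * ?l (f - ?a n) \<le> energy (\<alpha> n) f"
        using s(2) f(2) by blast
      moreover have "0 \<le> energy (\<alpha> n) (f - ?a n)"
        using aD f \<alpha>(1)[of n] by (intro energy_nonneg form.D_diff) auto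
      moreover have "0 \<le> ?l (f - ?a n)"
        using f(2) by (intro positive_functional_nonneg[OF pf form.D_diff[OF f(1) aD]]) (simp add: trunc_bounds(2))
      moreover have "0 \<le> \<alpha> n * L2_inner M (?a n) (?a n)" using \<alpha>(1)[of n] L2.nonneg[OF D_L2[OF aD]] by simp
      ultimately show "B (?a n) (?a n) \<le> energy (\<alpha> n) f" unfolding energy_def[of "\<alpha> n" "?a n"] by linarith
    qed
    have "(\<lambda>n. energy (\<alpha> n) f) \<longlonglongrightarrow> B f f + 0 * L2_inner M f f"
      unfolding energy_def by (intro tendsto_intros \<alpha>_lim)
    then have cl: "(\<lambda>n. energy (\<alpha> n) f) \<longlonglongrightarrow> B f f" by simp
    have lim: "AE x in M. (\<lambda>n. ennreal (u n x)) \<longlonglongrightarrow> ennreal (h x)" using u_lim gh by eventually_elim simp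
    show "trunc f (\<lambda>x. ennreal (h x)) \<in> D" "B (trunc f (\<lambda>x. ennreal (h x))) (trunc f (\<lambda>x. ennreal (h x))) \<le> B f f"
      using trunc_limit[OF f(1) _ hm a cl lim] f(2) by blast+
  qed
  then have "excessive M q h" using excessive_iff_supermedian[of h] h_nn by simp
  moreover have "\<not> (AE x in M. h x = 0)" by (rule AE_pos_imp_not_AE_zero[OF h_pos])
  ultimately show "\<exists>h. excessive M q h \<and> \<not> (AE x in M. h x = 0)" by blast
qed

text \<open>For each \<open>c\<close> the positive part of \<open>f - c h\<close> lies in the kernel, so it vanishes a.e. or is a.e. strictly
  positive; hence \<open>f / h\<close> is constant.\<close>

lemma extended_kernel_one_dimensional:
  assumes h: "h \<in> L0_functions M" "AE x in M. 0 < h x" "extended_form M q h = 0"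
    and f: "f \<in> L0_functions M" "extended_form M q f = 0"
  shows "\<exists>c. AE x in M. f x = c * h x"
proof -
  note [measurable] = h(1) f(1)
  have dich: "(AE x in M. f x \<le> c * h x) \<or> (AE x in M. \<not> f x \<le> c * h x)" for c
  proof -
    have "null_limit (\<lambda>x. ennreal (f x - c * h x))"
      using extended_kernel_lincomb[OF f(2) h(3), of c] by (intro extended_kernel_positive_part) auto
    then have "supermedian (\<lambda>x. ennreal (f x - c * h x))" by (rule supermedian_null_limit)
    then have "(AE x in M. ennreal (f x - c * h x) = 0) \<or> (AE x in M. 0 < ennreal (f x - c * h x))"
      by (rule supermedian_positive)
    then show ?thesis by (simp add: ennreal_eq_0_iff ennreal_less_zero_iff not_le)
  qed
  define S where "S = {c. AE x in M. f x \<le> c * h x}"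
  \<comment> \<open>Rational constants only, so that the exceptional null sets unite to a null set;
    comparison with the rationals still determines the quotient of \<open>f\<close> and
    \<open>h\<close>.\<close>
  have "AE x in M. \<forall>r::rat. f x \<le> of_rat r * h x \<longleftrightarrow> of_rat r \<in> S"
    unfolding AE_all_countable
  proof
    fix r :: rat
    show "AE x in M. f x \<le> of_rat r * h x \<longleftrightarrow> of_rat r \<in> S"
    proof (cases "of_rat r \<in> S")
      case True
      then have "AE x in M. f x \<le> of_rat r * h x" by (simp add: S_def)
      then show ?thesis by eventually_elim (use True in simp)
    next
      case False
      then have "AE x in M. \<not> f x \<le> of_rat r * h x" using dich[of "of_rat r"] by (auto simp: S_def)
      then show ?thesis by eventually_elim (use False in simp)
    qed
  qed
  then have AE1: "AE x in M. (\<forall>r::rat. f x / h x \<le> of_rat r \<longleftrightarrow> of_rat r \<in> S) \<and> 0 < h x"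
    using h(2) by eventually_elim (simp add: pos_divide_le_eq)
  obtain y where y: "\<forall>r::rat. f y / h y \<le> of_rat r \<longleftrightarrow> of_rat r \<in> S"
  proof -
    have "\<exists>y. (\<forall>r::rat. f y / h y \<le> of_rat r \<longleftrightarrow> of_rat r \<in> S) \<and> 0 < h y"
    proof (rule ccontr)
      assume no: "\<not> ?thesis"
      then have "AE x in M. \<not> ((\<forall>r::rat. f x / h x \<le> of_rat r \<longleftrightarrow> of_rat r \<in> S) \<and> 0 < h x)" by simp
      then show False by (rule AE_contradiction[OF AE1])
    qed
    then show ?thesis using that by blast
  qed
  have "AE x in M. f x = (f y / h y) * h x" using AE1
  proof eventually_elim
    case (elim x)
    have iff: "f x / h x \<le> of_rat r \<longleftrightarrow> f y / h y \<le> of_rat r" for r :: rat using elim y by blast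
    have "f x / h x = f y / h y"
    proof (rule ccontr)
      assume "f x / h x \<noteq> f y / h y"
      then consider "f x / h x < f y / h y" | "f y / h y < f x / h x" by linarith
      then show False
      proof cases
        case 1
        then obtain r where "f x / h x < of_rat r" "of_rat r < f y / h y" using of_rat_dense by blast
        then show False using iff[of r] by simp
      next
        case 2
        then obtain r where "f y / h y < of_rat r" "of_rat r < f x / h x" using of_rat_dense by blast
        then show False using iff[of r] by simp
      qed
    qed
    then show ?case using elim by (simp add: field_simps)
  qed
  then show ?thesis by blast
qed

text \<open>Reduces alternative (ii) to the existence of a single function: strict positivity
  follows from the zero-one law, and that nothing else lies in the kernel from its
  one-dimensionality.\<close>

lemma kernel_spanned_iff:
  "kernel_spanned_by_positive M q \<longleftrightarrow>
    (\<exists>h. null_limit (\<lambda>x. ennreal (h x)) \<and> h \<in> L0_functions M \<and> (\<forall>x. 0 \<le> h x) \<and> \<not> (AE x in M. h x = 0))"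
proof
  assume "kernel_spanned_by_positive M q"
  then obtain h where h: "h \<in> L0_functions M" "AE x in M. 0 < h x"
    and ker: "form_kernel (L0_functions M) (extended_form M q) = {f \<in> L0_functions M. \<exists>c::real. AE x in M. f x = c * h x}"
    unfolding kernel_spanned_by_positive_def strictly_positive_def by blast
  have "\<exists>c::real. AE x in M. h x = c * h x" by (intro exI[of _ 1]) simp
  then have "h \<in> form_kernel (L0_functions M) (extended_form M q)" using h(1) unfolding ker by simp
  then have nl: "null_limit (\<lambda>x. ennreal (h x))"
    by (intro extended_kernel_positive_part) (auto simp: form_kernel_def)
  \<comment> \<open>The given \<open>h\<close> is positive only a.e., while the right-hand side asks
    for nonnegativity at every point.\<close>
  have "(\<lambda>x. ennreal (max (h x) 0)) = (\<lambda>x. ennreal (h x))" by (auto simp: fun_eq_iff max_def ennreal_neg)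
  moreover have "AE x in M. 0 < max (h x) 0" using h(2) by eventually_elim simp
  ultimately show "\<exists>h. null_limit (\<lambda>x. ennreal (h x)) \<and> h \<in> L0_functions M \<and> (\<forall>x. 0 \<le> h x) \<and> \<not> (AE x in M. h x = 0)"
    using nl h(1) AE_pos_imp_not_AE_zero[of "\<lambda>x. max (h x) 0"] by (intro exI[of _ "\<lambda>x. max (h x) 0"]) auto
next
  assume "\<exists>h. null_limit (\<lambda>x. ennreal (h x)) \<and> h \<in> L0_functions M \<and> (\<forall>x. 0 \<le> h x) \<and> \<not> (AE x in M. h x = 0)"
  then obtain h where f: "null_limit (\<lambda>x. ennreal (h x))" and h: "h \<in> L0_functions M" "\<And>x. 0 \<le> h x" "\<not> (AE x in M. h x = 0)"
    by blast
  have h_pos: "AE x in M. 0 < h x"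
    using supermedian_positive[OF supermedian_null_limit[OF f]] h(2,3) by (simp add: ennreal_less_zero_iff ennreal_eq_0_iff order_antisym_conv)
  have h0: "extended_form M q h = 0" using extended_kernel_of_null_limit[OF f h(2)] .
  have "form_kernel (L0_functions M) (extended_form M q) = {g \<in> L0_functions M. \<exists>c::real. AE x in M. g x = c * h x}"
  proof (intro equalityI subsetI)
    fix g assume "g \<in> form_kernel (L0_functions M) (extended_form M q)"
    then show "g \<in> {g \<in> L0_functions M. \<exists>c::real. AE x in M. g x = c * h x}"
      using extended_kernel_one_dimensional[OF h(1) h_pos h0] by (auto simp: form_kernel_def)
  next
    fix g assume "g \<in> {g \<in> L0_functions M. \<exists>c::real. AE x in M. g x = c * h x}"
    then obtain c :: real where g: "g \<in> L0_functions M" "AE x in M. g x = c * h x" by blast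
    \<comment> \<open>Writes \<open>c * h\<close> as a difference, the shape in which
      \<open>extended_kernel_lincomb\<close> is stated.\<close>
    have "extended_form M q (\<lambda>x. h x - (1 - c) * h x) = 0" using extended_kernel_lincomb[OF h0 h0] .
    then obtain u where u: "\<forall>n. u n \<in> D" "(\<lambda>n. B (u n) (u n)) \<longlonglongrightarrow> 0" "AE x in M. (\<lambda>n. u n x) \<longlonglongrightarrow> h x - (1 - c) * h x"
      unfolding extended_form_zero_iff by blast
    have "AE x in M. (\<lambda>n. u n x) \<longlonglongrightarrow> g x" using u(3) g(2) by eventually_elim (simp add: algebra_simps)
    then have "extended_form M q g = 0" unfolding extended_form_zero_iff using u by blast
    then show "g \<in> form_kernel (L0_functions M) (extended_form M q)" using g(1) by (simp add: form_kernel_def)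
  qed
  then show "kernel_spanned_by_positive M q"
    unfolding kernel_spanned_by_positive_def strictly_positive_def using h(1) h_pos by blast
qed

lemma subcritical_iff: "subcritical M q \<longleftrightarrow> \<not> null_limit (\<lambda>x. \<infinity>)"
proof
  assume "subcritical M q"
  then show "\<not> null_limit (\<lambda>x. \<infinity>)"
    using subcritical_imp_null_limit_zero AE_contradiction[of "\<lambda>x. True"] by fastforce
qed (rule subcritical_and_excessive(1))

text \<open>A null limit is a.e. finite or a.e. infinite, and a nonzero a.e. finite one would put
  the form into alternative (ii). So outside (ii) the constant \<infinity> is the only possible
  nonzero element of the kernel.\<close>

lemma plus_kernel_iff:
  "plus_kernel_zero_infinity M q \<longleftrightarrow> null_limit (\<lambda>x. \<infinity>) \<and> \<not> kernel_spanned_by_positive M q"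
proof -
  have ker: "form_kernel (Lplus_functions M) (plus_form M q) = {f. null_limit f}"
    using plus_form_zero_iff by (auto simp: form_kernel_def null_limit_def)
  show ?thesis
  proof
    assume "plus_kernel_zero_infinity M q"
    then have eq: "null_limit f \<longleftrightarrow> f \<in> Lplus_functions M \<and> ((AE x in M. f x = 0) \<or> (AE x in M. f x = \<infinity>))" for f
      unfolding plus_kernel_zero_infinity_def ker by auto
    have "\<not> kernel_spanned_by_positive M q"
    proof
      assume "kernel_spanned_by_positive M q"
      then obtain h where h: "null_limit (\<lambda>x. ennreal (h x))" "\<And>x. 0 \<le> h x" "\<not> (AE x in M. h x = 0)"
        unfolding kernel_spanned_iff by blast
      then have "AE x in M. \<not> True" using eq[of "\<lambda>x. ennreal (h x)"] by (simp add: ennreal_eq_0_iff order_antisym_conv)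
      then show False using AE_contradiction[of "\<lambda>x. True"] by simp
    qed
    then show "null_limit (\<lambda>x. \<infinity>) \<and> \<not> kernel_spanned_by_positive M q" using eq[of "\<lambda>x. \<infinity>"] by simp
  next
    assume *: "null_limit (\<lambda>x. \<infinity>) \<and> \<not> kernel_spanned_by_positive M q"
    show "plus_kernel_zero_infinity M q"
      unfolding plus_kernel_zero_infinity_def ker
    proof (intro equalityI subsetI; clarify)
      fix f assume f: "null_limit f"
      have [measurable]: "f \<in> Lplus_functions M" using f by (simp add: null_limit_def)
      have "AE x in M. f x = 0" if fin: "AE x in M. f x < \<infinity>"
      proof -
        let ?h = "\<lambda>x. enn2real (f x)"
        have fh: "AE x in M. f x = ennreal (?h x)" using fin by eventually_elim simp
        have "null_limit (\<lambda>x. ennreal (?h x))" by (rule null_limit_cong[OF f _ fh]) measurable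
        moreover have "?h \<in> L0_functions M" by measurable
        ultimately have "kernel_spanned_by_positive M q" if "\<not> (AE x in M. ?h x = 0)"
          unfolding kernel_spanned_iff using that by (intro exI[of _ ?h]) simp
        then have "AE x in M. ?h x = 0" using * by blast
        with fh show ?thesis by eventually_elim simp
      qed
      then have "(AE x in M. f x = 0) \<or> (AE x in M. f x = \<infinity>)"
        using supermedian_infinite[OF supermedian_null_limit[OF f]] by blast
      then show "f \<in> Lplus_functions M \<and> ((AE x in M. f x = 0) \<or> (AE x in M. f x = \<infinity>))"
        using f by (simp add: null_limit_def)
    next
      fix f assume f: "f \<in> Lplus_functions M" and "(AE x in M. f x = 0) \<or> (AE x in M. f x = \<infinity>)"
      then consider "AE x in M. f x = 0" | "AE x in M. f x = \<infinity>" by blast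
      then show "null_limit f"
      proof cases
        case 1
        then have "AE x in M. 0 = f x" by eventually_elim simp
        then show ?thesis by (rule null_limit_cong[OF null_limit_zero f])
      next
        case 2
        then have "AE x in M. \<infinity> = f x" by eventually_elim simp
        then show ?thesis by (rule null_limit_cong[OF conjunct1[OF *] f])
      qed
    qed
  qed
qed

text \<open>If \<infinity> is a null limit, cutting the approximating functions off at an excessive
  \<open>h\<close> keeps their energies small and makes them tend to \<open>h\<close>, which leads
  to alternative (ii). Conversely, null limits are supermedian, and in the subcritical case the
  excessive function was constructed along with the Hardy weight.\<close>

lemma excessive_iff:
  "(\<exists>h. excessive M q h \<and> \<not> (AE x in M. h x = 0)) \<longleftrightarrow>
    \<not> null_limit (\<lambda>x. \<infinity>) \<or> kernel_spanned_by_positive M q"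
proof
  assume "\<exists>h. excessive M q h \<and> \<not> (AE x in M. h x = 0)"
  then obtain h where ex: "excessive M q h" and h_ne: "\<not> (AE x in M. h x = 0)" by blast
  have h: "h \<in> L0_functions M" "AE x in M. 0 \<le> h x" using ex by (auto simp: excessive_def)
  have sm: "supermedian (\<lambda>x. ennreal (h x))" using ex excessive_iff_supermedian[OF h] by simp
  have "kernel_spanned_by_positive M q" if infinity: "null_limit (\<lambda>x. \<infinity>)"
  proof -
    obtain u where u: "\<And>n. u n \<in> D" "\<And>n x. 0 \<le> u n x" "(\<lambda>n. B (u n) (u n)) \<longlonglongrightarrow> 0"
      "AE x in M. (\<lambda>n. ennreal (u n x)) \<longlonglongrightarrow> \<infinity>"
      using infinity unfolding null_limit_def by blast
    let ?v = "\<lambda>n. trunc (u n) (\<lambda>x. ennreal (h x))"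
    have v: "?v n \<in> D" "B (?v n) (?v n) \<le> B (u n) (u n)" for n
      using sm u(1,2) unfolding supermedian_def by auto
    have v0: "(\<lambda>n. B (?v n) (?v n)) \<longlonglongrightarrow> 0" by (rule form.energy_null_mono[OF v u(3)])
    have "AE x in M. (\<lambda>n. ennreal (?v n x)) \<longlonglongrightarrow> ennreal (h x)" using u(4)
    proof eventually_elim
      case (elim x)
      have "ennreal (?v n x) = min (ennreal (u n x)) (ennreal (h x))" for n
        by (simp add: trunc_def min_less_iff_disj)
      then show ?case using tendsto_min[OF elim tendsto_const[of "ennreal (h x)"]] by simp
    qed
    then have nl: "null_limit (\<lambda>x. ennreal (h x))"
      unfolding null_limit_def using v v0 h(1) by (intro conjI exI[of _ ?v]) (auto simp: trunc_bounds)
    have ae: "AE x in M. ennreal (h x) = ennreal \<bar>h x\<bar>" using h(2) by eventually_elim simp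
    have "null_limit (\<lambda>x. ennreal \<bar>h x\<bar>)" by (rule null_limit_cong[OF nl _ ae]) (use h(1) in measurable)
    then show ?thesis unfolding kernel_spanned_iff using h(1) h_ne by (intro exI[of _ "\<lambda>x. \<bar>h x\<bar>"]) simp
  qed
  then show "\<not> null_limit (\<lambda>x. \<infinity>) \<or> kernel_spanned_by_positive M q" by blast
next
  assume "\<not> null_limit (\<lambda>x. \<infinity>) \<or> kernel_spanned_by_positive M q"
  then show "\<exists>h. excessive M q h \<and> \<not> (AE x in M. h x = 0)"
  proof
    assume "kernel_spanned_by_positive M q"
    then obtain h where h: "null_limit (\<lambda>x. ennreal (h x))" "h \<in> L0_functions M" "\<And>x. 0 \<le> h x" "\<not> (AE x in M. h x = 0)"
      unfolding kernel_spanned_iff by blast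
    then have "excessive M q h" using excessive_iff_supermedian[OF h(2)] supermedian_null_limit[OF h(1)] by simp
    then show ?thesis using h(4) by blast
  qed (rule subcritical_and_excessive(2))
qed

lemma kernel_spanned_imp_null_limit_infinity:
  "kernel_spanned_by_positive M q \<Longrightarrow> null_limit (\<lambda>x. \<infinity>)"
  unfolding kernel_spanned_iff using null_limit_infinity_of_nonzero
  by (force simp: ennreal_eq_0_iff order_antisym_conv)

end

theorem corollary5p3:
  fixes M :: "'a measure" and q :: "('a \<Rightarrow> real) \<Rightarrow> ennreal"
  assumes "sigma_finite_measure M"
    and "emeasure M (space M) \<noteq> 0"
    and "quadratic_form_L2 M q"
    and "densely_defined M q"
    and "closed_form M q"
    and "first_Beurling_Deny M q"
    and "irreducible_form M q"
  shows "(subcritical M q \<and> \<not> kernel_spanned_by_positive M q \<and> \<not> plus_kernel_zero_infinity M q \<or>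
          \<not> subcritical M q \<and> kernel_spanned_by_positive M q \<and> \<not> plus_kernel_zero_infinity M q \<or>
          \<not> subcritical M q \<and> \<not> kernel_spanned_by_positive M q \<and> plus_kernel_zero_infinity M q) \<and>
         (plus_kernel_zero_infinity M q \<longleftrightarrow>
          \<not> (\<exists>h. excessive M q h \<and> \<not> (AE x in M. h x = 0)))"
proof -
  interpret irreducible_positivity_preserving_form M q
    using assms by (intro irreducible_positivity_preserving_form.intro sigma_finite_form.intro
        positivity_preserving_form.intro irreducible_positivity_preserving_form_axioms.intro)
  show ?thesis
    using subcritical_iff plus_kernel_iff excessive_iff kernel_spanned_imp_null_limit_infinity by blast
qed

end
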